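(* Let $f\in\mathcal{G}[1]$ and let $S=\{F_t\}_{t\ge0}$ be the semigroup generated by $f$. The following assertions are equivalent: (i) there is a point $z\in\Delta$ such that $F_t(z)\in\Delta$ for all $t\in\mathbb{R}$ and the point $\zeta=\lim_{t\to-\infty}F_t(z)$ is a boundary regular null point of $f$, i.e., $\zeta\in\partial\Delta$, $\angle\lim_{z\to\zeta}f(z)=0$ and $f'(\zeta)=\angle\lim_{z\to\zeta}f'(z)$ is finite; (ii) the image $h(\Delta)$, where $h\in\Sigma[1]$ is defined by $$h(z)=-\int_0^z\frac{d\xi}{f(\xi)},$$ contains a horizontal strip (or a horizontal half-plane); (iii) there is a nonempty simply connected open subset $\Omega\subset\Delta$ such that $\{F_t|_\Omega\}$ is a group of automorphisms of $\Omega$; (iv) there are real numbers $a$ and $b$ such that the differential equation $$\left[a(z^2-1)+ib(1-z)^2\right]\varphi'(z)=f(\varphi(z))$$ has a nonconstant solution $\varphi\in\operatorname{Hol}(\Delta,\Delta)$. Moreover, in this case $\varphi$ is univalent and $\Omega=\varphi(\Delta)$ is a backward flow invariant domain for $S$.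
   Context: $\Delta$ is the open unit disk in $\mathbb{C}$; $\operatorname{Hol}(\Delta,\Delta)$ is the set of holomorphic self-mappings of $\Delta$; $\angle\lim$ is the angular (nontangential) limit. A one-parameter continuous semigroup on $\Delta$ is a family $\{F_t\}_{t\ge0}$ of holomorphic self-mappings of $\Delta$ with $F_0=\mathrm{id}$, $F_{t+s}=F_t\circ F_s$, $\lim_{t\to0^+}F_t(z)=z$. Its generator is $f(z)=\lim_{t\to0^+}\frac{z-F_t(z)}{t}$, and $u(t,z)=F_t(z)$ solves the Cauchy problem $\partial_tu+f(u)=0$, $u(0,z)=z$. $\mathcal{G}[1]$ is the class of all generators of such semigroups with Denjoy-Wolff point $1$, i.e. $\lim_{t\to\infty}F_t(z)=1$ for all $z\in\Delta$; such $f$ has no zeros in $\Delta$. "$F_t(z)\in\Delta$ for all $t\in\mathbb{R}$" means that the solution of the Cauchy problem starting at $z$ extends, with values in $\Delta$, to all real $t$; $F_t(z)$ for $t<0$ denotes its value. $\Sigma[1]$ is the class of univalent holomorphic functions $h:\Delta\to\mathbb{C}$ with $h(0)=0$, $h(z)+t\in h(\Delta)$ for all $z\in\Delta$, $t\ge0$, and $\lim_{t\to\infty}h^{-1}(h(z)+t)=1$; for $f\in\mathcal G[1]$ the function $h(z)=-\int_0^z d\xi/f(\xi)$ belongs to $\Sigma[1]$ and $F_t(z)=h^{-1}(h(z)+t)$. A horizontal strip is $\{w:c_1<\operatorname{Im}w<c_2\}$ with $c_1<c_2$ finite; a horizontal half-plane is one whose boundary is parallel to the real axis. A (nonempty) simply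 connected domain $\Omega\subset\Delta$ is a backward flow invariant domain (BFID) for $S$ if $S$ can be extended to a group on $\Omega$, i.e. each $F_t|_\Omega$, $t\ge0$, is an automorphism of $\Omega$. *)

theory Defs
  imports "HOL-Complex_Analysis.Complex_Analysis"
begin

abbreviation unit_disk :: "complex set" ("\<Delta>")
  where "\<Delta> \<equiv> ball 0 1"

definition continuous_semigroup :: "(real \<Rightarrow> complex \<Rightarrow> complex) \<Rightarrow> bool" where
  "continuous_semigroup F \<longleftrightarrow>
     (\<forall>t\<ge>0. F t holomorphic_on \<Delta> \<and> F t ` \<Delta> \<subseteq> \<Delta>) \<and>
     (\<forall>z\<in>\<Delta>. F 0 z = z) \<and>
     (\<forall>t\<ge>0. \<forall>s\<ge>0. \<forall>z\<in>\<Delta>. F (t + s) z = F t (F s z)) \<and>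
     (\<forall>z\<in>\<Delta>. ((\<lambda>t. F t z) \<longlongrightarrow> z) (at_right 0))"

text \<open>Only the values of the generator on the unit disk matter.\<close>

definition is_generator :: "(complex \<Rightarrow> complex) \<Rightarrow> (real \<Rightarrow> complex \<Rightarrow> complex) \<Rightarrow> bool" where
  "is_generator f F \<longleftrightarrow>
     (\<forall>z\<in>\<Delta>. ((\<lambda>t. (z - F t z) / complex_of_real t) \<longlongrightarrow> f z) (at_right 0))"

definition G1 :: "(complex \<Rightarrow> complex) set" where
  "G1 = {f. \<exists>F. continuous_semigroup F \<and> is_generator f F \<and>
              (\<forall>z\<in>\<Delta>. ((\<lambda>t. F t z) \<longlongrightarrow> 1) at_top)}"

definition Sigma1 :: "(complex \<Rightarrow> complex) set" where
  "Sigma1 = {h. h holomorphic_on \<Delta> \<and> inj_on h \<Delta> \<and> h 0 = 0 \<and>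
                (\<forall>z\<in>\<Delta>. \<forall>t\<ge>0. h z + complex_of_real t \<in> h ` \<Delta>) \<and>
                (\<forall>z\<in>\<Delta>. ((\<lambda>t. inv_into \<Delta> h (h z + complex_of_real t)) \<longlongrightarrow> 1) at_top)}"

text \<open>The integral is taken along the segment from 0 to \<open>z\<close>; since \<open>f\<close> is holomorphic and has no
  zeros in \<open>\<Delta>\<close> when \<open>f \<in> G1\<close>, it does not depend on the path.\<close>

definition koenigs :: "(complex \<Rightarrow> complex) \<Rightarrow> complex \<Rightarrow> complex" where
  "koenigs f z = - contour_integral (linepath 0 z) (\<lambda>\<xi>. 1 / f \<xi>)"

text \<open>Angular limits at a boundary point \<open>\<zeta>\<close>, by means of the Stolz regions
  \<open>\<bar>z - \<zeta>\<bar> < M (1 - \<bar>z\<bar>)\<close> with \<open>M > 1\<close>.\<close>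

definition angular_limit :: "(complex \<Rightarrow> complex) \<Rightarrow> complex \<Rightarrow> complex \<Rightarrow> bool" where
  "angular_limit g \<zeta> L \<longleftrightarrow>
     (\<forall>M>1. (g \<longlongrightarrow> L) (at \<zeta> within {z \<in> \<Delta>. dist z \<zeta> < M * (1 - norm z)}))"

definition boundary_regular_null_point :: "(complex \<Rightarrow> complex) \<Rightarrow> complex \<Rightarrow> bool" where
  "boundary_regular_null_point f \<zeta> \<longleftrightarrow>
     \<zeta> \<in> sphere 0 1 \<and> angular_limit f \<zeta> 0 \<and> (\<exists>L. angular_limit (deriv f) \<zeta> L)"

text \<open>Solutions in the unit disk, defined for all real times, of the Cauchy problem
  \<open>u' + f(u) = 0\<close>, \<open>u(0) = z\<close>; for negative \<open>t\<close> the value \<open>u t\<close> is what \<open>F\<^sub>t(z)\<close> stands for.\<close>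

definition full_trajectory :: "(complex \<Rightarrow> complex) \<Rightarrow> complex \<Rightarrow> (real \<Rightarrow> complex) \<Rightarrow> bool" where
  "full_trajectory f z u \<longleftrightarrow>
     u 0 = z \<and> (\<forall>t. u t \<in> \<Delta> \<and> (u has_vector_derivative - f (u t)) (at t))"

definition horizontal_strip :: "complex set \<Rightarrow> bool" where
  "horizontal_strip A \<longleftrightarrow> (\<exists>c1 c2. c1 < c2 \<and> A = {w. c1 < Im w \<and> Im w < c2})"

definition horizontal_half_plane :: "complex set \<Rightarrow> bool" where
  "horizontal_half_plane A \<longleftrightarrow> (\<exists>c. A = {w. c < Im w} \<or> A = {w. Im w < c})"

definition automorphism_of :: "complex set \<Rightarrow> (complex \<Rightarrow> complex) \<Rightarrow> bool" where
  "automorphism_of \<Omega> g \<longleftrightarrow>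
     g holomorphic_on \<Omega> \<and> bij_betw g \<Omega> \<Omega> \<and> inv_into \<Omega> g holomorphic_on \<Omega>"

text \<open>A simply connected set in the sense of the library is path-connected, so \<open>\<Omega>\<close> is a domain.\<close>

definition BFID :: "(real \<Rightarrow> complex \<Rightarrow> complex) \<Rightarrow> complex set \<Rightarrow> bool" where
  "BFID F \<Omega> \<longleftrightarrow>
     \<Omega> \<noteq> {} \<and> open \<Omega> \<and> simply_connected \<Omega> \<and> \<Omega> \<subseteq> \<Delta> \<and>
     (\<forall>t\<ge>0. automorphism_of \<Omega> (F t))"

definition nonconstant_solution ::
  "(complex \<Rightarrow> complex) \<Rightarrow> real \<Rightarrow> real \<Rightarrow> (complex \<Rightarrow> complex) \<Rightarrow> bool" where
  "nonconstant_solution f a b \<phi> \<longleftrightarrow>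
     \<phi> holomorphic_on \<Delta> \<and> \<phi> ` \<Delta> \<subseteq> \<Delta> \<and> \<not> \<phi> constant_on \<Delta> \<and>
     (\<forall>z\<in>\<Delta>. (complex_of_real a * (z\<^sup>2 - 1) + \<i> * complex_of_real b * (1 - z)\<^sup>2) * deriv \<phi> z
              = f (\<phi> z))"

end

theory Submission
  imports Defs
begin

text \<open>
  All conditions are equivalent to the image of the Koenigs function containing a horizontal strip.
  After a Cayley transform sending the Denjoy-Wolff point to infinity, Wolff's lemma says that the
  semigroup increases real parts, so its generator \<open>P\<close> and the derivative \<open>Q = 1 / P\<close> of the Koenigs
  function \<open>H\<close> have nonnegative real part; in particular \<open>H\<close> is injective and conjugates the
  semigroup to translations. Hence (iii) and (iv) merely describe translation-invariant subdomains of the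
  image.

  By the Julia-Caratheodory theorem \<open>(w - i \<eta>) Q(w)\<close> has an angular limit \<open>s \<ge> 0\<close> at every boundary
  point \<open>i \<eta>\<close>, and the point is a regular null point iff \<open>s > 0\<close>. If \<open>s > 0\<close>, then \<open>H\<close>
  behaves like \<open>s log (w - i \<eta>)\<close>, with bounded imaginary part along the normal, and Bloch's
  theorem yields discs of fixed size in the image arbitrarily far to the left, hence a strip.
  Conversely, the trajectories through a strip converge to one boundary point, and if this is \<open>i \<eta>\<close>, the
  width of the strip bounds \<open>s\<close> from below.
  If the limit of a backward trajectory is the Denjoy-Wolff point, a Phragmen-Lindelof argument in the region
  cut off by the trajectory shows that the image contains all horizontal lines close to it on one side.
\<close>

section \<open>Holomorphic functions with nonnegative real part\<close>

text \<open>\<open>H\<close> has no usable boundary values: near the axis one only knows that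
  Harnack's inequality bounds \<open>Q\<close> by a multiple of 1 / Re w. Two facts take their
  place. As Re \<open>Q\<close> is nonnegative, Im \<open>H\<close> is nondecreasing upwards on
  vertical lines and Re \<open>H\<close> to the right on horizontal ones; and every vertical
  interval near the axis contains some point, not known explicitly, at which \<open>H\<close> is
  controlled. Values elsewhere are squeezed between controlled points above and below. In (i) the
  limit 1 needs an argument of its own because P(w) / w has a finite angular limit at infinity for
  every such field: the Denjoy-Wolff point is always a regular null point, so its regularity says
  nothing about the image, and only the trajectory itself can be exploited. Re \<open>Q\<close> may
  vanish identically. Then \<open>Q\<close> is an imaginary constant, the semigroup consists of
  parabolic automorphisms, and strict monotonicity fails; this case is settled by the identity,
  which solves the equation in (iv). Holomorphy of \<open>f\<close> is not part of being a generator
  and has to be derived.\<close>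

lemma norm_diff_less_norm_add_cnj:
  assumes "Re a > 0" "Re b > 0"
  shows "norm (a - b) < norm (a + cnj b)"
proof -
  have "(norm (a + cnj b))\<^sup>2 - (norm (a - b))\<^sup>2 = 4 * Re a * Re b"
    by (simp add: cmod_power2) (simp add: power2_eq_square algebra_simps)
  moreover have "4 * Re a * Re b > 0" using assms by simp
  ultimately have "(norm (a - b))\<^sup>2 < (norm (a + cnj b))\<^sup>2" by linarith
  then show ?thesis by (rule power2_less_imp_less) simp
qed

lemma Re_pos_imp_add_cnj_nonzero:
  assumes "Re a > 0" "Re b > 0" shows "a + cnj b \<noteq> 0"
  using assms by (auto simp: complex_eq_iff)

section \<open>Schwarz-Pick and Harnack inequalities in the half-plane\<close>

lemma schwarz_ball_half_plane:
  assumes "R holomorphic_on ball 0 1" "\<And>z. norm z < 1 \<Longrightarrow> Re (R z) > 0" "norm \<xi> < 1"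
  shows "norm (R \<xi> - R 0) \<le> norm \<xi> * norm (R \<xi> + cnj (R 0))"
proof -
  define T where "T = (\<lambda>z. (R z - R 0) / (R z + cnj (R 0)))"
  have nz: "R z + cnj (R 0) \<noteq> 0" if "norm z < 1" for z
    using assms(2)[OF that] assms(2)[of 0] Re_pos_imp_add_cnj_nonzero by simp
  have "T holomorphic_on ball 0 1"
    unfolding T_def using nz by (intro holomorphic_intros assms(1)) auto
  moreover have "norm (T z) < 1" if "norm z < 1" for z
    unfolding T_def norm_divide using nz[OF that]
      norm_diff_less_norm_add_cnj[OF assms(2)[OF that] assms(2)[of 0]] by simp
  moreover have "T 0 = 0" by (simp add: T_def)
  ultimately have "norm (T \<xi>) \<le> norm \<xi>"
    using Schwarz_Lemma(1)[of T \<xi>] assms(3) by blast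
  then show ?thesis using nz[OF assms(3)] by (simp add: T_def norm_divide field_simps)
qed

text \<open>This is the conformal map of the disc onto the half-plane that takes 0 to
  \<open>b\<close> and 1 to infinity. The free parameter moves Schwarz's lemma from the origin to an
  arbitrary base point.\<close>

lemma Re_moebius_disc_half_plane:
  assumes "Re b > 0" "norm z < 1"
  shows "Re ((b + cnj b * z) / (1 - z)) > 0"
proof -
  have z1: "z \<noteq> 1" using assms(2) by auto
  have "(b + cnj b * z) / (1 - z) = (b + cnj b * z) * (1 - cnj z) / (of_real ((norm (1 - z))\<^sup>2))"
    by (simp add: complex_div_cnj[of _ "1 - z"])
  moreover have "Re ((b + cnj b * z) * (1 - cnj z)) = Re b * (1 - (norm z)\<^sup>2)"
    by (simp add: cmod_power2) (simp add: power2_eq_square algebra_simps)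
  ultimately have "Re ((b + cnj b * z) / (1 - z)) = Re b * (1 - (norm z)\<^sup>2) / (norm (1 - z))\<^sup>2"
    by (metis Re_divide_of_real)
  moreover have "1 - (norm z)\<^sup>2 > 0" using assms(2) by (simp add: abs_square_less_1)
  ultimately show ?thesis using assms z1 by simp
qed

lemma moebius_half_plane_disc_inverse:
  assumes "Re w > 0" "Re b > 0"
  defines "\<xi> \<equiv> (w - b) / (w + cnj b)"
  shows "norm \<xi> < 1" "(b + cnj b * \<xi>) / (1 - \<xi>) = w"
proof -
  note nz = Re_pos_imp_add_cnj_nonzero[OF assms(1,2)]
  show "norm \<xi> < 1"
    using norm_diff_less_norm_add_cnj[OF assms(1,2)] nz by (simp add: \<xi>_def norm_divide)
  have bb: "b + cnj b \<noteq> 0" using assms(2) Re_pos_imp_add_cnj_nonzero by blast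
  have "1 - \<xi> = (b + cnj b) / (w + cnj b)" "b + cnj b * \<xi> = w * (b + cnj b) / (w + cnj b)"
    using nz by (simp_all add: \<xi>_def field_simps)
  then show "(b + cnj b * \<xi>) / (1 - \<xi>) = w" using nz bb by simp
qed

lemma schwarz_pick_half_plane:
  assumes "R holomorphic_on {w. Re w > 0}" "\<And>w. Re w > 0 \<Longrightarrow> Re (R w) > 0"
    and a: "Re a > 0" and b: "Re b > 0"
  shows "norm (R a - R b) * norm (a + cnj b) \<le> norm (a - b) * norm (R a + cnj (R b))"
proof -
  define m where "m = (\<lambda>z. (b + cnj b * z) / (1 - z))"
  define \<xi> where "\<xi> = (a - b) / (a + cnj b)"
  note \<xi> = moebius_half_plane_disc_inverse[OF a b, folded \<xi>_def]
  have m: "m holomorphic_on ball 0 1" unfolding m_def by (intro holomorphic_intros) auto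
  have mpos: "Re (m z) > 0" if "norm z < 1" for z
    unfolding m_def using Re_moebius_disc_half_plane[OF b that] .
  have msub: "m ` ball 0 1 \<subseteq> {w. Re w > 0}" using mpos by auto
  have hol: "(\<lambda>z. R (m z)) holomorphic_on ball 0 1"
    using holomorphic_on_compose_gen[OF m assms(1) msub] by (simp add: o_def)
  have "norm (R (m \<xi>) - R (m 0)) \<le> norm \<xi> * norm (R (m \<xi>) + cnj (R (m 0)))"
    by (rule schwarz_ball_half_plane[OF hol _ \<xi>(1)]) (use assms(2) mpos in auto)
  moreover have "m \<xi> = a" "m 0 = b" using \<xi>(2) by (simp_all add: m_def)
  ultimately show ?thesis using Re_pos_imp_add_cnj_nonzero[OF a b]
    by (simp add: \<xi>_def norm_divide field_simps)
qed

text \<open>Subtracting \<open>\<i> * Im (R 0)\<close> makes the value at 0 real, so that the real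
  part at 0 controls the whole modulus. Schwarz's lemma needs strictly positive real parts, hence
  the perturbation by \<open>\<epsilon>\<close>.\<close>

lemma harnack_disc:
  assumes R: "R holomorphic_on ball 0 1" "\<And>z. norm z < 1 \<Longrightarrow> Re (R z) \<ge> 0" and \<xi>: "norm \<xi> < 1"
  shows "norm (R \<xi> - \<i> * Im (R 0)) * (1 - norm \<xi>) \<le> Re (R 0) * (1 + norm \<xi>)"
proof (rule field_le_epsilon)
  fix e :: real assume e: "e > 0"
  define \<epsilon> where "\<epsilon> = e / 3"
  have \<epsilon>: "\<epsilon> > 0" and e3: "e = 3 * \<epsilon>" using e by (simp_all add: \<epsilon>_def)
  define X where "X = R \<xi> - \<i> * Im (R 0)"
  have "norm ((R \<xi> + \<epsilon>) - (R 0 + \<epsilon>)) \<le> norm \<xi> * norm ((R \<xi> + \<epsilon>) + cnj (R 0 + \<epsilon>))"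
    by (rule schwarz_ball_half_plane[of "\<lambda>z. R z + \<epsilon>", OF _ _ \<xi>])
      (use assms \<epsilon> in \<open>auto intro!: holomorphic_intros add_nonneg_pos\<close>)
  moreover have "(R \<xi> + \<epsilon>) - (R 0 + \<epsilon>) = X - Re (R 0)"
    "(R \<xi> + \<epsilon>) + cnj (R 0 + \<epsilon>) = X + of_real (Re (R 0) + 2 * \<epsilon>)"
    by (auto simp: X_def complex_eq_iff)
  ultimately have "norm (X - Re (R 0)) \<le> norm \<xi> * norm (X + of_real (Re (R 0) + 2 * \<epsilon>))"
    by metis
  moreover have "norm (X - Re (R 0)) \<ge> norm X - Re (R 0)"
    using norm_triangle_ineq2[of X "Re (R 0)"] R(2)[of 0] by simp
  moreover have "norm (X + of_real (Re (R 0) + 2 * \<epsilon>)) \<le> norm X + (Re (R 0) + 2 * \<epsilon>)"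
    using norm_triangle_ineq[of X "of_real (Re (R 0) + 2 * \<epsilon>)"] R(2)[of 0] \<epsilon>
    unfolding norm_of_real by simp
  ultimately have "norm X - Re (R 0) \<le> norm \<xi> * (norm X + (Re (R 0) + 2 * \<epsilon>))"
    by (smt (verit) mult_left_mono norm_ge_zero)
  then have "norm X * (1 - norm \<xi>) \<le> Re (R 0) * (1 + norm \<xi>) + norm \<xi> * (2 * \<epsilon>)"
    by (simp add: algebra_simps)
  moreover have "norm \<xi> * (2 * \<epsilon>) \<le> 1 * (2 * \<epsilon>)" using \<xi> \<epsilon> by (intro mult_right_mono) auto
  ultimately show "norm (R \<xi> - \<i> * Im (R 0)) * (1 - norm \<xi>) \<le> Re (R 0) * (1 + norm \<xi>) + e"
    using \<epsilon> unfolding X_def[symmetric] e3 by linarith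
qed

text \<open>Multiplying the disc inequality by \<open>1 + norm \<xi>\<close> produces
  \<open>1 - (norm \<xi>)\<^sup>2\<close>, which is explicit: \<open>4 * (Re w * Re b)\<close> over
  the square of \<open>norm (w + cnj b)\<close>. That 4 cancels the crude bound 4 for the square of
  \<open>1 + norm \<xi>\<close>.\<close>

lemma harnack_half_plane:
  assumes R: "R holomorphic_on {w. Re w > 0}" "\<And>w. Re w > 0 \<Longrightarrow> Re (R w) \<ge> 0"
    and w: "Re w > 0" and b: "Re b > 0"
  shows "norm (R w - \<i> * Im (R b)) \<le> Re (R b) * (norm (w + cnj b))\<^sup>2 / (Re w * Re b)"
proof -
  define m where "m = (\<lambda>z. (b + cnj b * z) / (1 - z))"
  define \<xi> where "\<xi> = (w - b) / (w + cnj b)"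
  note \<xi> = moebius_half_plane_disc_inverse[OF w b, folded \<xi>_def]
  have m: "m holomorphic_on ball 0 1" unfolding m_def by (intro holomorphic_intros) auto
  have mpos: "Re (m z) > 0" if "norm z < 1" for z
    unfolding m_def using Re_moebius_disc_half_plane[OF b that] .
  have msub: "m ` ball 0 1 \<subseteq> {w. Re w > 0}" using mpos by auto
  have hol: "(\<lambda>z. R (m z)) holomorphic_on ball 0 1"
    using holomorphic_on_compose_gen[OF m R(1) msub] by (simp add: o_def)
  have "norm (R (m \<xi>) - \<i> * Im (R (m 0))) * (1 - norm \<xi>) \<le> Re (R (m 0)) * (1 + norm \<xi>)"
    by (rule harnack_disc[OF hol _ \<xi>(1)]) (use R(2) mpos in auto)
  moreover have "m \<xi> = w" "m 0 = b" using \<xi>(2) by (simp_all add: m_def)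
  ultimately have 1: "norm (R w - \<i> * Im (R b)) * (1 - norm \<xi>) \<le> Re (R b) * (1 + norm \<xi>)" by simp
  have nz: "norm (w + cnj b) > 0" using Re_pos_imp_add_cnj_nonzero[OF w b] by simp
  have "(norm (w + cnj b))\<^sup>2 - (norm (w - b))\<^sup>2 = 4 * (Re w * Re b)"
    by (simp add: cmod_power2) (simp add: power2_eq_square algebra_simps)
  then have "(norm (w - b))\<^sup>2 = (norm (w + cnj b))\<^sup>2 - 4 * (Re w * Re b)" by linarith
  moreover have "(norm \<xi>)\<^sup>2 = (norm (w - b))\<^sup>2 / (norm (w + cnj b))\<^sup>2"
    by (simp add: \<xi>_def norm_divide power_divide)
  ultimately have 2: "1 - (norm \<xi>)\<^sup>2 = 4 * (Re w * Re b) / (norm (w + cnj b))\<^sup>2"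
    using nz by (simp add: diff_divide_distrib)
  have "norm (R w - \<i> * Im (R b)) * (1 - norm \<xi>) * (1 + norm \<xi>) \<le> Re (R b) * (1 + norm \<xi>) * (1 + norm \<xi>)"
    using 1 by (intro mult_right_mono) auto
  also have "\<dots> = Re (R b) * (1 + norm \<xi>)\<^sup>2" by (simp add: power2_eq_square)
  also have "\<dots> \<le> Re (R b) * 2\<^sup>2"
    using \<xi>(1) R(2)[OF b] by (intro mult_left_mono power_mono) auto
  finally have "norm (R w - \<i> * Im (R b)) * (1 - (norm \<xi>)\<^sup>2) \<le> 4 * Re (R b)"
    by (simp add: power2_eq_square algebra_simps)
  then show ?thesis unfolding 2 using nz w b by (simp add: field_simps)
qed

lemma harnack_half_plane_norm:
  assumes R: "R holomorphic_on {w. Re w > 0}" "\<And>w. Re w > 0 \<Longrightarrow> Re (R w) \<ge> 0"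
    and w: "Re w > 0" and b: "Re b > 0"
  shows "norm (R w) \<le> norm (R b) * (1 + (norm (w + cnj b))\<^sup>2 / (Re w * Re b))"
proof -
  have "norm (R w) \<le> norm (R w - \<i> * Im (R b)) + norm (\<i> * Im (R b))"
    by (metis diff_add_cancel norm_triangle_ineq)
  also have "norm (R w - \<i> * Im (R b)) \<le> Re (R b) * ((norm (w + cnj b))\<^sup>2 / (Re w * Re b))"
    using harnack_half_plane[OF assms] by simp
  also have "\<dots> \<le> norm (R b) * ((norm (w + cnj b))\<^sup>2 / (Re w * Re b))"
    using w b complex_Re_le_cmod by (intro mult_right_mono) auto
  also have "norm (\<i> * Im (R b)) \<le> norm (R b)" by (simp add: norm_mult abs_Im_le_cmod)
  finally show ?thesis by (simp add: algebra_simps)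
qed

text \<open>\<open>s\<close> is the infimum of \<open>Re (R w) / Re w\<close>, the largest multiple
  of the identity that can be subtracted while the real part stays nonnegative. Harnack's inequality
  for the difference, based at a nearly minimal point, makes the remainder small relative to
  \<open>norm w\<close> in each sector.\<close>

lemma julia_caratheodory_infinity:
  assumes R: "R holomorphic_on {w. Re w > 0}" "\<And>w. Re w > 0 \<Longrightarrow> Re (R w) \<ge> 0"
  shows "\<exists>s\<ge>0. \<forall>M>0. \<forall>e>0.
       \<exists>B>0. \<forall>w. Re w > 0 \<longrightarrow> norm w \<le> M * Re w \<longrightarrow> norm w \<ge> B \<longrightarrow> norm (R w / w - of_real s) < e"
proof -
  define S where "S = (\<lambda>w. Re (R w) / Re w) ` {w. Re w > 0}"
  define s where "s = Inf S"
  have ne: "S \<noteq> {}" unfolding S_def by (auto intro: exI[of _ 1])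
  have S0: "x \<ge> 0" if "x \<in> S" for x using that R(2) by (auto simp: S_def)
  have bdd: "bdd_below S" using S0 by (meson bdd_belowI)
  have s0: "s \<ge> 0" unfolding s_def using S0 ne by (simp add: cInf_greatest)
  define R1 where "R1 = (\<lambda>w. R w - of_real s * w)"
  have R1h: "R1 holomorphic_on {w. Re w > 0}" unfolding R1_def by (intro holomorphic_intros R)
  have R1p: "Re (R1 w) \<ge> 0" if "Re w > 0" for w
  proof -
    have "s \<le> Re (R w) / Re w" unfolding s_def using that bdd by (intro cInf_lower) (auto simp: S_def)
    then show ?thesis using that by (simp add: R1_def field_simps)
  qed
  have "\<exists>B>0. \<forall>w. Re w > 0 \<longrightarrow> norm w \<le> M * Re w \<longrightarrow> norm w \<ge> B \<longrightarrow> norm (R w / w - of_real s) < e"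
    if M: "M > 0" and e: "e > 0" for M e :: real
  proof -
    \<comment> \<open>In the sector Harnack's inequality costs a factor
      \<open>4 * norm w * M\<close>, which turns this excess into
      \<open>e * norm w / 2\<close>.\<close>
    have "\<exists>x\<in>S. x < s + e / (8 * M)" using ne bdd M e unfolding s_def
      by (intro iffD1[OF cInf_less_iff]) auto
    then obtain b where b: "Re b > 0" "Re (R b) / Re b < s + e / (8 * M)" by (auto simp: S_def)
    then have R1b: "Re (R1 b) / Re b \<le> e / (8 * M)" by (simp add: R1_def field_simps)
    \<comment> \<open>Beyond \<open>B\<close>, \<open>norm (w + cnj b)\<close> is at most
      \<open>2 * norm w\<close>, and the constant \<open>Im (R1 b)\<close> is at most a quarter of
      \<open>e * norm w\<close>.\<close>
    define B where "B = norm b + 4 * \<bar>Im (R1 b)\<bar> / e + 1"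
    have "B * e = norm b * e + 4 * \<bar>Im (R1 b)\<bar> + e" using e by (simp add: B_def field_simps)
    then have B: "B > 0" "B \<ge> norm b" "\<bar>Im (R1 b)\<bar> * 4 \<le> B * e"
      using e by (auto simp: B_def intro!: add_nonneg_pos)
    have "norm (R w / w - of_real s) < e"
      if w: "Re w > 0" "norm w \<le> M * Re w" "norm w \<ge> B" for w
    proof -
      have w0: "norm w > 0" using w B by linarith
      have "norm (w + cnj b) \<le> 2 * norm w"
        using norm_triangle_ineq[of w "cnj b"] w(3) B(2) by simp
      then have "(norm (w + cnj b))\<^sup>2 \<le> (2 * norm w)\<^sup>2" by (intro power_mono) auto
      then have "(norm (w + cnj b))\<^sup>2 / Re w \<le> (2 * norm w)\<^sup>2 / Re w"
        using w by (intro divide_right_mono) auto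
      also have "\<dots> = 4 * norm w * (norm w / Re w)" by (simp add: power2_eq_square)
      also have "\<dots> \<le> 4 * norm w * M" using w by (intro mult_left_mono) (auto simp: field_simps)
      finally have q: "(norm (w + cnj b))\<^sup>2 / Re w \<le> 4 * norm w * M" .
      have "norm (R1 w) \<le> norm (R1 w - \<i> * Im (R1 b)) + norm (\<i> * Im (R1 b))"
        by (metis diff_add_cancel norm_triangle_ineq)
      also have "norm (R1 w - \<i> * Im (R1 b)) \<le> Re (R1 b) / Re b * ((norm (w + cnj b))\<^sup>2 / Re w)"
        using harnack_half_plane[OF R1h R1p w(1) b(1)] by (simp add: field_simps)
      also have "\<dots> \<le> e / (8 * M) * (4 * norm w * M)"
        using R1b q w e M by (intro mult_mono) auto
      also have "\<dots> = e * norm w / 2" using M by simp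
      also have "norm (\<i> * Im (R1 b)) \<le> B * e / 4" using B(3) by (simp add: norm_mult)
      also have "\<dots> \<le> norm w * e / 4" using w(3) e by (simp add: mult_right_mono)
      finally have "norm (R1 w) \<le> (3/4) * e * norm w" by (simp add: algebra_simps)
      also have "\<dots> < e * norm w" using e w0 by simp
      finally have "norm (R1 w / w) < e" using w0 by (simp add: norm_divide divide_less_eq)
      moreover have "R1 w / w = R w / w - of_real s" using w0 by (simp add: R1_def diff_divide_distrib)
      ultimately show ?thesis by simp
    qed
    then show ?thesis using B(1) by blast
  qed
  then show ?thesis using s0 by blast
qed

text \<open>The inversion \<open>1 / w\<close> preserves the half-plane and each of its sectors, and
  exchanges 0 with infinity.\<close>

lemma julia_caratheodory_zero:
  assumes R: "R holomorphic_on {w. Re w > 0}" "\<And>w. Re w > 0 \<Longrightarrow> Re (R w) \<ge> 0"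
  shows "\<exists>s\<ge>0. \<forall>M>0. \<forall>e>0.
       \<exists>d>0. \<forall>w. Re w > 0 \<longrightarrow> norm w \<le> M * Re w \<longrightarrow> norm w \<le> d \<longrightarrow> norm (w * R w - of_real s) < e"
proof -
  define R' where "R' = (\<lambda>w. R (1 / w))"
  have p: "Re (1 / w) > 0" if "Re w > 0" for w :: complex
    using that by (simp add: Re_divide sum_power2_gt_zero_iff)
  have "(\<lambda>w. 1 / w) holomorphic_on {w. Re w > 0}" by (intro holomorphic_intros) auto
  then have "R' holomorphic_on {w. Re w > 0}" unfolding R'_def
    using holomorphic_on_compose_gen[OF _ R(1), of "\<lambda>w. 1 / w"] p by (auto simp: o_def)
  then obtain s where s: "s \<ge> 0" "\<And>M e. M > 0 \<Longrightarrow> e > 0 \<Longrightarrow>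
       \<exists>B>0. \<forall>w. Re w > 0 \<longrightarrow> norm w \<le> M * Re w \<longrightarrow> norm w \<ge> B \<longrightarrow> norm (R' w / w - of_real s) < e"
    using julia_caratheodory_infinity[of R'] R(2) p unfolding R'_def by blast
  have "\<exists>d>0. \<forall>w. Re w > 0 \<longrightarrow> norm w \<le> M * Re w \<longrightarrow> norm w \<le> d \<longrightarrow> norm (w * R w - of_real s) < e"
    if Me: "M > 0" "e > 0" for M e
  proof -
    obtain B where B: "B > 0" "\<forall>w. Re w > 0 \<longrightarrow> norm w \<le> M * Re w \<longrightarrow> norm w \<ge> B \<longrightarrow>
      norm (R' w / w - of_real s) < e" using s(2)[OF Me] by blast
    have "norm (w * R w - of_real s) < e" if w: "Re w > 0" "norm w \<le> M * Re w" "norm w \<le> 1 / B" for w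
    proof -
      have n: "norm w > 0" using w(1) by auto
      have "Re (1 / w) = Re w / (norm w)\<^sup>2" by (simp add: Re_divide cmod_power2)
      moreover have "norm (1 / w) = norm w / (norm w)\<^sup>2"
        using n by (simp add: norm_divide power2_eq_square)
      ultimately have "norm (1 / w) \<le> M * Re (1 / w)"
        using w(2) by (metis divide_right_mono times_divide_eq_right zero_le_power2)
      moreover have "norm (1 / w) \<ge> B" using w(3) n B(1) by (simp add: norm_divide field_simps)
      ultimately have "norm (R' (1 / w) / (1 / w) - of_real s) < e" using B(2) p[OF w(1)] by blast
      then show ?thesis by (simp add: R'_def mult.commute)
    qed
    then show ?thesis using B(1) by (intro exI[of _ "1 / B"]) auto
  qed
  then show ?thesis using s(1) by blast
qed

section \<open>Primitives near the imaginary axis\<close>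

lemma convex_rhp: "convex {w. Re w > 0}" and open_rhp: "open {w. Re w > 0}"
  by (auto simp: convex_halfspace_Re_gt open_halfspace_Re_gt)

lemma has_vector_derivative_horizontal:
  assumes "(G has_field_derivative g) (at (Complex t y))"
  shows "((\<lambda>t. G (Complex t y)) has_vector_derivative g) (at t)"
proof -
  have eq: "Complex t y = of_real t + \<i> * of_real y" for t by (simp add: complex_eq_iff)
  have "((\<lambda>t. of_real t + \<i> * of_real y) has_vector_derivative 1) (at t)"
    by (auto intro!: derivative_eq_intros)
  from field_vector_diff_chain_at[OF this assms[unfolded eq]] show ?thesis
    by (simp add: o_def eq)
qed

lemma horizontal_derivative_bound:
  assumes G: "\<And>t. x \<le> t \<Longrightarrow> t \<le> b \<Longrightarrow> (G has_field_derivative g t) (at (Complex t y))"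
    and \<phi>: "\<And>t. x \<le> t \<Longrightarrow> t \<le> b \<Longrightarrow> (\<phi> has_real_derivative \<phi>' t) (at t)"
    and le: "\<And>t. x \<le> t \<Longrightarrow> t \<le> b \<Longrightarrow> norm (g t) \<le> \<phi>' t"
    and x: "x \<le> b"
  shows "norm (G (Complex b y) - G (Complex x y)) \<le> \<phi> b - \<phi> x"
proof (cases "x = b")
  case False
  then have xb: "x < b" using x by simp
  have G': "((\<lambda>t. G (Complex t y)) has_vector_derivative g t) (at t)" if "x \<le> t" "t \<le> b" for t
    by (rule has_vector_derivative_horizontal) (use G that in auto)
  show ?thesis
  proof (rule differentiable_bound_general[OF xb, of "\<lambda>t. G (Complex t y)" \<phi> g \<phi>'])
    show "continuous_on {x..b} (\<lambda>t. G (Complex t y))"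
      using G' by (intro continuous_at_imp_continuous_on ballI has_vector_derivative_continuous) auto
    show "continuous_on {x..b} \<phi>"
      using \<phi> by (intro continuous_at_imp_continuous_on ballI DERIV_isCont) auto
  qed (use G' \<phi> le in \<open>auto simp: has_real_derivative_iff_has_vector_derivative\<close>)
qed auto

text \<open>Multiplication by \<open>- \<i>\<close> turns imaginary parts into real parts, so the
  mean value theorem for real parts yields both claims, with possibly different points
  \<open>y\<close>.\<close>

lemma vertical_mvt:
  assumes G: "\<And>t. t \<in> {a..b} \<Longrightarrow> (G has_field_derivative g (Complex x t)) (at (Complex x t))"
    and ab: "a \<le> b"
  shows "\<exists>y\<in>{a..b}. Re (G (Complex x b)) - Re (G (Complex x a)) = - Im (g (Complex x y)) * (b - a)"
    and "\<exists>y\<in>{a..b}. Im (G (Complex x b)) - Im (G (Complex x a)) = Re (g (Complex x y)) * (b - a)"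
proof -
  have seg: "u = Complex x (Im u) \<and> Im u \<in> {a..b}"
    if "u \<in> closed_segment (Complex x a) (Complex x b)" for u
    using that ab by (auto simp: closed_segment_same_Re closed_segment_eq_real_ivl complex_eq_iff)
  have G': "(G has_field_derivative g u) (at u)"
    if "u \<in> closed_segment (Complex x a) (Complex x b)" for u
    using seg[OF that] G by metis
  obtain u where u: "u \<in> closed_segment (Complex x a) (Complex x b)"
    "Re (G (Complex x b)) - Re (G (Complex x a)) = Re (g u * (Complex x b - Complex x a))"
    using complex_mvt_line[OF G'] by blast
  have "Re (g u * (Complex x b - Complex x a)) = - Im (g u) * (b - a)" by (simp add: algebra_simps)
  then show "\<exists>y\<in>{a..b}. Re (G (Complex x b)) - Re (G (Complex x a)) = - Im (g (Complex x y)) * (b - a)"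
    using u(2) seg[OF u(1)] by metis
  have iG: "((\<lambda>w. - \<i> * G w) has_field_derivative - \<i> * g u) (at u)"
    if "u \<in> closed_segment (Complex x a) (Complex x b)" for u
    by (rule DERIV_cmult) (rule G'[OF that])
  obtain u where u: "u \<in> closed_segment (Complex x a) (Complex x b)"
    "Re (- \<i> * G (Complex x b)) - Re (- \<i> * G (Complex x a)) = Re (- \<i> * g u * (Complex x b - Complex x a))"
    using complex_mvt_line[OF iG] by blast
  have "Re (- \<i> * g u * (Complex x b - Complex x a)) = Re (g u) * (b - a)" by (simp add: algebra_simps)
  then have u2: "Im (G (Complex x b)) - Im (G (Complex x a)) = Re (g u) * (b - a)" using u(2) by simp
  then show "\<exists>y\<in>{a..b}. Im (G (Complex x b)) - Im (G (Complex x a)) = Re (g (Complex x y)) * (b - a)"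
    using seg[OF u(1)] u2 by metis
qed

text \<open>By the Cauchy-Riemann equations the upward derivative of \<open>Im H\<close> is
  \<open>Re Q\<close>.\<close>

lemma Im_mono_vertical:
  assumes H: "\<And>w. Re w > 0 \<Longrightarrow> (H has_field_derivative Q w) (at w)"
    and Q: "\<And>w. Re w > 0 \<Longrightarrow> Re (Q w) \<ge> 0" and x: "x > 0" and "a \<le> b"
  shows "Im (H (Complex x a)) \<le> Im (H (Complex x b))"
proof -
  obtain y where "Im (H (Complex x b)) - Im (H (Complex x a)) = Re (Q (Complex x y)) * (b - a)"
    using vertical_mvt(2)[of a b H Q x] H x assms(4) by auto
  then show ?thesis using Q[of "Complex x y"] x assms(4) by (smt (verit) complex.sel(1) mult_nonneg_nonneg)
qed

lemma Im_strict_mono_vertical: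
  assumes H: "\<And>w. Re w > 0 \<Longrightarrow> (H has_field_derivative Q w) (at w)"
    and Q: "\<And>w. Re w > 0 \<Longrightarrow> Re (Q w) > 0" and x: "x > 0" and "a < b"
  shows "Im (H (Complex x a)) < Im (H (Complex x b))"
proof -
  obtain y where "Im (H (Complex x b)) - Im (H (Complex x a)) = Re (Q (Complex x y)) * (b - a)"
    using vertical_mvt(2)[of a b H Q x] H x assms(4) by auto
  then show ?thesis using Q[of "Complex x y"] x assms(4) by (smt (verit) complex.sel(1) mult_pos_pos)
qed

lemma Re_mono_horizontal:
  assumes H: "\<And>w. Re w > 0 \<Longrightarrow> (H has_field_derivative Q w) (at w)"
    and Q: "\<And>w. Re w > 0 \<Longrightarrow> Re (Q w) \<ge> 0" and x: "a > 0" and "a \<le> b"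
  shows "Re (H (Complex a y)) \<le> Re (H (Complex b y))"
proof -
  have seg: "u = Complex (Re u) y \<and> Re u > 0"
    if "u \<in> closed_segment (Complex a y) (Complex b y)" for u
    using that assms(3,4) by (auto simp: closed_segment_same_Im closed_segment_eq_real_ivl complex_eq_iff)
  obtain u where "u \<in> closed_segment (Complex a y) (Complex b y)"
    "Re (H (Complex b y)) - Re (H (Complex a y)) = Re (Q u * (Complex b y - Complex a y))"
    using complex_mvt_line[of "Complex a y" "Complex b y" H Q] H seg by blast
  moreover have "Re (Q u * (Complex b y - Complex a y)) = Re (Q u) * (b - a)" by (simp add: algebra_simps)
  ultimately show ?thesis using Q seg assms(4) by (smt (verit) mult_nonneg_nonneg)
qed

text \<open>Harnack's inequality bounds \<open>Q\<close> by a multiple of \<open>1 / Re w\<close>; this becomes bounded after integrating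
  twice. So a primitive of \<open>H\<close> is bounded up to the imaginary axis, and the mean value theorem provides
  points at which \<open>H\<close> itself is controlled.\<close>

lemma primitive_bound_unit_box:
  assumes H: "\<And>w. Re w > 0 \<Longrightarrow> (H has_field_derivative Q w) (at w)"
    and Q: "\<And>w. Re w > 0 \<Longrightarrow> Re (Q w) \<ge> 0"
    and K: "\<And>w. Re w > 0 \<Longrightarrow> (K has_field_derivative (H w - H 1)) (at w)"
    and x: "0 < x" "x \<le> 1" and y: "\<bar>y\<bar> \<le> 2"
  shows "norm (K (Complex x y) - K 1) \<le> 63 * norm (Q 1)"
proof -
  define q where "q = norm (Q 1)"
  have Qhol: "Q holomorphic_on {w. Re w > 0}"
    using derivative_is_holomorphic[OF open_rhp] H by blast
  \<comment> \<open>Harnack's inequality based at 1: on the box the squared norm is at most 4 + 4,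
    and the summand 1 is at most \<open>1 / t\<close>, which makes 9.\<close>
  have Qb: "norm (Q (Complex t v)) \<le> 9 * q / t" if "0 < t" "t \<le> 1" "\<bar>v\<bar> \<le> 2" for t v
  proof -
    have "norm (Q (Complex t v)) \<le> q * (1 + (norm (Complex t v + 1))\<^sup>2 / t)"
      using harnack_half_plane_norm[OF Qhol Q, of "Complex t v" 1] that by (simp add: q_def)
    moreover have "(norm (Complex t v + 1))\<^sup>2 = (t + 1)\<^sup>2 + v\<^sup>2" by (simp add: cmod_power2)
    moreover have "(t + 1)\<^sup>2 \<le> 2\<^sup>2" using that by (intro power_mono) auto
    moreover have "v\<^sup>2 \<le> 2\<^sup>2" using that abs_le_square_iff[of v 2] by simp
    ultimately have "norm (Q (Complex t v)) \<le> q * (1 + (norm (Complex t v + 1))\<^sup>2 / t)"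
      and "(norm (Complex t v + 1))\<^sup>2 / t \<le> 8 / t"  using that by (auto intro!: divide_right_mono)
    moreover have "1 \<le> 1 / t" using that by simp
    ultimately have "norm (Q (Complex t v)) \<le> q * (1 / t + 8 / t)"
      using mult_left_mono[of "1 + (norm (Complex t v + 1))\<^sup>2 / t" "1 / t + 8 / t" q] by (simp add: q_def)
    then show ?thesis by (simp add: field_simps)
  qed
  have q0: "q \<ge> 0" by (simp add: q_def)
  have seg: "Re u = 1 \<and> u = Complex 1 (Im u) \<and> \<bar>Im u\<bar> \<le> 2"
    if "u \<in> closed_segment 1 (Complex 1 v)" "\<bar>v\<bar> \<le> 2" for u v
    using that by (auto simp: closed_segment_same_Re closed_segment_eq_real_ivl complex_eq_iff split: if_splits)
  have H1: "norm (H (Complex 1 v) - H 1) \<le> 18 * q" if v: "\<bar>v\<bar> \<le> 2" for v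
  proof -
    have "norm (H (Complex 1 v) - H 1) \<le> 9 * q * norm (Complex 1 v - 1)"
    proof (rule field_differentiable_bound[where S = "closed_segment 1 (Complex 1 v)" and f' = Q])
      fix z assume "z \<in> closed_segment 1 (Complex 1 v)"
      note z = seg[OF this v]
      show "(H has_field_derivative Q z) (at z within closed_segment 1 (Complex 1 v))"
        using has_field_derivative_at_within[OF H[of z]] conjunct1[OF z] by simp
      have "norm (Q (Complex 1 (Im z))) \<le> 9 * q" using Qb[of 1 "Im z"] conjunct2[OF conjunct2[OF z]] by simp
      then show "norm (Q z) \<le> 9 * q" using z by metis
    qed auto
    also have "Complex 1 v - 1 = \<i> * of_real v" by (simp add: complex_eq_iff)
    also have "norm (\<i> * of_real v) \<le> 2" using v by (simp add: norm_mult)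
    then have "9 * q * norm (\<i> * of_real v) \<le> 9 * q * 2" using q0 by (intro mult_left_mono) auto
    finally show ?thesis by simp
  qed
  \<comment> \<open>First integration: along the line of real part 1 up to height 2, which costs
    \<open>9 * q * 2\<close>, then horizontally, where \<open>9 * q / t\<close> integrates to a
    logarithm.\<close>
  have H2: "norm (H (Complex t v) - H 1) \<le> 18 * q - 9 * q * ln t" if t: "0 < t" "t \<le> 1" and v: "\<bar>v\<bar> \<le> 2" for t v
  proof -
    have "norm (H (Complex 1 v) - H (Complex t v)) \<le> 9 * q * ln 1 - 9 * q * ln t"
    proof (rule horizontal_derivative_bound[where g = "\<lambda>s. Q (Complex s v)" and \<phi>' = "\<lambda>s. 9 * q / s"])
      show "((\<lambda>s. 9 * q * ln s) has_real_derivative 9 * q / s) (at s)" if "t \<le> s" for s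
        using that t by (auto intro!: derivative_eq_intros)
    qed (use H Qb t v in auto)
    moreover have "norm (H (Complex t v) - H 1) \<le>
        norm (H (Complex 1 v) - H (Complex t v)) + norm (H (Complex 1 v) - H 1)"
      using norm_triangle_ineq4[of "H (Complex 1 v) - H 1" "H (Complex 1 v) - H (Complex t v)"] by simp
    ultimately show ?thesis using H1[OF v] by simp
  qed
  have "norm (K (Complex 1 y) - K 1) \<le> 18 * q * norm (Complex 1 y - 1)"
  proof (rule field_differentiable_bound[where S = "closed_segment 1 (Complex 1 y)" and f' = "\<lambda>w. H w - H 1"])
    fix z assume "z \<in> closed_segment 1 (Complex 1 y)"
    note z = seg[OF this y]
    show "(K has_field_derivative H z - H 1) (at z within closed_segment 1 (Complex 1 y))"
      using has_field_derivative_at_within[OF K[of z]] conjunct1[OF z] by simp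
    show "norm (H z - H 1) \<le> 18 * q" using H1[of "Im z"] z by metis
  qed auto
  also have "Complex 1 y - 1 = \<i> * of_real y" by (simp add: complex_eq_iff)
  also have "norm (\<i> * of_real y) \<le> 2" using y by (simp add: norm_mult)
  then have "18 * q * norm (\<i> * of_real y) \<le> 18 * q * 2" using q0 by (intro mult_left_mono) auto
  finally have K1: "norm (K (Complex 1 y) - K 1) \<le> 36 * q" by simp
  \<comment> \<open>Second integration: the right-hand side is the increment of a primitive of
    \<open>18 * q - 9 * q * ln s\<close>. It stays below \<open>27 * q\<close> down to the axis, and
    27 + 36 = 63.\<close>
  have "norm (K (Complex 1 y) - K (Complex x y)) \<le>
      (27 * q * 1 - 9 * q * (1 * ln 1)) - (27 * q * x - 9 * q * (x * ln x))"
  proof (rule horizontal_derivative_bound[where g = "\<lambda>s. H (Complex s y) - H 1"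
        and \<phi>' = "\<lambda>s. 18 * q - 9 * q * ln s"])
    show "((\<lambda>s. 27 * q * s - 9 * q * (s * ln s)) has_real_derivative 18 * q - 9 * q * ln s) (at s)"
      if "x \<le> s" for s
      using that x by (auto intro!: derivative_eq_intros simp: field_simps)
  qed (use K H2 x y in auto)
  moreover have "9 * q * (x * ln x) \<le> 0" "27 * q * x \<ge> 0"
    using q0 x by (auto intro!: mult_nonneg_nonpos mult_nonneg_nonneg)
  ultimately have "norm (K (Complex 1 y) - K (Complex x y)) \<le> 27 * q" by simp
  moreover have "norm (K (Complex x y) - K 1) \<le>
        norm (K (Complex 1 y) - K (Complex x y)) + norm (K (Complex 1 y) - K 1)"
    using norm_triangle_ineq4[of "K (Complex 1 y) - K 1" "K (Complex 1 y) - K (Complex x y)"] by simp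
  ultimately show ?thesis using K1 by (simp add: q_def)
qed

text \<open>The increment of \<open>K\<close> over the vertical segment is at most twice 63,
  uniformly in \<open>x\<close>, although \<open>H\<close> itself may be unbounded near the axis. So
  only the existence of a good height in the interval can be claimed, separately for real and
  imaginary part.\<close>

lemma box_mean_value_unit:
  assumes H: "\<And>w. Re w > 0 \<Longrightarrow> (H has_field_derivative Q w) (at w)"
    and Q: "\<And>w. Re w > 0 \<Longrightarrow> Re (Q w) \<ge> 0"
    and x: "0 < x" "x \<le> 1" and ab: "-2 \<le> a" "a \<le> b" "b \<le> 2"
  shows "\<exists>y\<in>{a..b}. (b - a) * \<bar>Im (H (Complex x y) - H 1)\<bar> \<le> 126 * norm (Q 1)"
    and "\<exists>y\<in>{a..b}. (b - a) * \<bar>Re (H (Complex x y) - H 1)\<bar> \<le> 126 * norm (Q 1)"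
proof -
  have "H holomorphic_on {w. Re w > 0}" using H open_rhp by (auto simp: holomorphic_on_open)
  then have "(\<lambda>w. H w - H 1) holomorphic_on {w. Re w > 0}" by (intro holomorphic_intros)
  from holomorphic_convex_primitive'[OF convex_rhp open_rhp this]
  obtain K where "\<And>w. w \<in> {w. Re w > 0} \<Longrightarrow> (K has_field_derivative H w - H 1) (at w within {w. Re w > 0})"
    by blast
  then have K: "\<And>w. Re w > 0 \<Longrightarrow> (K has_field_derivative H w - H 1) (at w)"
    using at_within_open[OF _ open_rhp] by (metis mem_Collect_eq)
  have bd: "norm (K (Complex x y) - K 1) \<le> 63 * norm (Q 1)" if "\<bar>y\<bar> \<le> 2" for y
    using primitive_bound_unit_box[of H Q K x y] H Q K x that by blast
  have d: "norm (K (Complex x b) - K (Complex x a)) \<le> 126 * norm (Q 1)"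
  proof -
    have "\<bar>a\<bar> \<le> 2" "\<bar>b\<bar> \<le> 2" using ab by auto
    from bd[OF this(1)] bd[OF this(2)] show ?thesis
      using norm_triangle_ineq4[of "K (Complex x b) - K 1" "K (Complex x a) - K 1"] by simp
  qed
  have K': "\<And>t. t \<in> {a..b} \<Longrightarrow> (K has_field_derivative H (Complex x t) - H 1) (at (Complex x t))"
    using K x by auto
  have R: "\<bar>Re (K (Complex x b)) - Re (K (Complex x a))\<bar> \<le> 126 * norm (Q 1)"
    using abs_Re_le_cmod[of "K (Complex x b) - K (Complex x a)"] d by simp
  have I: "\<bar>Im (K (Complex x b)) - Im (K (Complex x a))\<bar> \<le> 126 * norm (Q 1)"
    using abs_Im_le_cmod[of "K (Complex x b) - K (Complex x a)"] d by simp
  have ba: "b - a \<ge> 0" using ab(2) by simp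
  obtain y where y: "y \<in> {a..b}"
    "Re (K (Complex x b)) - Re (K (Complex x a)) = - Im (H (Complex x y) - H 1) * (b - a)"
    using vertical_mvt(1)[where g = "\<lambda>w. H w - H 1", OF K' ab(2)] by blast
  from y(2) have "\<bar>Re (K (Complex x b)) - Re (K (Complex x a))\<bar> = (b - a) * \<bar>Im (H (Complex x y) - H 1)\<bar>"
    using ba by (simp only: abs_mult abs_minus_cancel abs_of_nonneg mult.commute)
  then show "\<exists>y\<in>{a..b}. (b - a) * \<bar>Im (H (Complex x y) - H 1)\<bar> \<le> 126 * norm (Q 1)"
    using R y(1) by (metis (no_types))
  obtain y where y: "y \<in> {a..b}"
    "Im (K (Complex x b)) - Im (K (Complex x a)) = Re (H (Complex x y) - H 1) * (b - a)"
    using vertical_mvt(2)[where g = "\<lambda>w. H w - H 1", OF K' ab(2)] by blast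
  from y(2) have "\<bar>Im (K (Complex x b)) - Im (K (Complex x a))\<bar> = (b - a) * \<bar>Re (H (Complex x y) - H 1)\<bar>"
    using ba by (simp only: abs_mult abs_of_nonneg mult.commute)
  then show "\<exists>y\<in>{a..b}. (b - a) * \<bar>Re (H (Complex x y) - H 1)\<bar> \<le> 126 * norm (Q 1)"
    using I y(1) by (metis (no_types))
qed

text \<open>The unit box is rescaled by \<open>r\<close> and moved to height \<open>c\<close>. One
  factor \<open>r\<close> comes from the chain rule, the other from the length of the
  interval.\<close>

lemma box_mean_value:
  assumes H: "\<And>w. Re w > 0 \<Longrightarrow> (H has_field_derivative Q w) (at w)"
    and Q: "\<And>w. Re w > 0 \<Longrightarrow> Re (Q w) \<ge> 0"
    and x: "0 < x" "x \<le> r" and ab: "c - 2 * r \<le> a" "a \<le> b" "b \<le> c + 2 * r"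
  shows "\<exists>y\<in>{a..b}. (b - a) * \<bar>Im (H (Complex x y) - H (Complex r c))\<bar> \<le> 126 * r\<^sup>2 * norm (Q (Complex r c))"
    and "\<exists>y\<in>{a..b}. (b - a) * \<bar>Re (H (Complex x y) - H (Complex r c))\<bar> \<le> 126 * r\<^sup>2 * norm (Q (Complex r c))"
proof -
  have r: "r > 0" using x by simp
  define m where "m = (\<lambda>w. of_real r * w + \<i> * of_real c)"
  have mpos: "Re (m w) > 0" if "Re w > 0" for w using that r by (simp add: m_def)
  have H': "((\<lambda>w. H (m w)) has_field_derivative of_real r * Q (m w)) (at w)" if "Re w > 0" for w
  proof -
    have "(m has_field_derivative of_real r) (at w)"
      unfolding m_def by (auto intro!: derivative_eq_intros)
    from DERIV_chain[OF H[OF mpos[OF that]] this] show ?thesis by (simp add: o_def mult.commute)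
  qed
  have Q': "Re (of_real r * Q (m w)) \<ge> 0" if "Re w > 0" for w
    using Q[OF mpos[OF that]] r by simp
  have m1: "m 1 = Complex r c" by (simp add: m_def complex_eq_iff)
  have mx: "m (Complex (x / r) t) = Complex x (c + r * t)" for t
    using r by (simp add: m_def complex_eq_iff)
  have pre: "0 < x / r" "x / r \<le> 1" "- 2 \<le> (a - c) / r" "(a - c) / r \<le> (b - c) / r" "(b - c) / r \<le> 2"
    using x r ab by (auto simp: field_simps)
  have in_ab: "c + r * t \<in> {a..b}" if "t \<in> {(a - c) / r..(b - c) / r}" for t
    using that r by (auto simp: field_simps)
  have scale: "(b - a) * X \<le> 126 * r\<^sup>2 * norm (Q (Complex r c))"
    if "((b - c) / r - (a - c) / r) * X \<le> 126 * norm (of_real r * Q (m 1))" for X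
    using that r unfolding m1 by (simp add: norm_mult field_simps power2_eq_square)
  obtain t where t: "t \<in> {(a - c) / r..(b - c) / r}"
    "((b - c) / r - (a - c) / r) * \<bar>Im (H (m (Complex (x / r) t)) - H (m 1))\<bar> \<le> 126 * norm (of_real r * Q (m 1))"
    using box_mean_value_unit(1)[OF H' Q' pre] by blast
  show "\<exists>y\<in>{a..b}. (b - a) * \<bar>Im (H (Complex x y) - H (Complex r c))\<bar> \<le> 126 * r\<^sup>2 * norm (Q (Complex r c))"
    using scale[OF t(2)] in_ab[OF t(1)] unfolding m1 mx by blast
  obtain t where t: "t \<in> {(a - c) / r..(b - c) / r}"
    "((b - c) / r - (a - c) / r) * \<bar>Re (H (m (Complex (x / r) t)) - H (m 1))\<bar> \<le> 126 * norm (of_real r * Q (m 1))"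
    using box_mean_value_unit(2)[OF H' Q' pre] by blast
  show "\<exists>y\<in>{a..b}. (b - a) * \<bar>Re (H (Complex x y) - H (Complex r c))\<bar> \<le> 126 * r\<^sup>2 * norm (Q (Complex r c))"
    using scale[OF t(2)] in_ab[OF t(1)] unfolding m1 mx by blast
qed

text \<open>The Noshiro-Warschawski criterion. The factor \<open>c\<close> admits derivatives in a
  rotated half-plane, such as an imaginary constant.\<close>

lemma inj_on_Re_deriv_pos:
  assumes "convex S" "\<And>w. w \<in> S \<Longrightarrow> (H has_field_derivative Q w) (at w)"
    and pos: "\<And>w. w \<in> S \<Longrightarrow> Re (c * Q w) > 0"
  shows "inj_on H S"
proof (rule inj_onI, rule ccontr)
  fix v w assume vw: "v \<in> S" "w \<in> S" "H v = H w" "v \<noteq> w"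
  \<comment> \<open>Dividing by \<open>w - v\<close> makes the increment of \<open>Re G\<close>
    equal to some \<open>Re (c * Q u)\<close>, while \<open>H v = H w\<close> makes it
    vanish.\<close>
  define G where "G = (\<lambda>u. c / (w - v) * H u)"
  have sub: "closed_segment v w \<subseteq> S" using assms(1) vw by (simp add: closed_segment_subset)
  have "(G has_field_derivative c / (w - v) * Q u) (at u)" if "u \<in> closed_segment v w" for u
    unfolding G_def by (rule DERIV_cmult) (use assms(2) sub that in blast)
  from complex_mvt_line[of v w G, OF this] obtain u where u: "u \<in> closed_segment v w"
    "Re (G w) - Re (G v) = Re (c / (w - v) * Q u * (w - v))" by blast
  then show False using vw pos[of u] sub by (auto simp: G_def)
qed

text \<open>By the open mapping theorem a nonconstant \<open>Q\<close> with a purely imaginary value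
  would also take values with negative real part.\<close>

lemma Re_nonneg_dichotomy:
  assumes Q: "Q holomorphic_on S" "open S" "connected S" "\<And>w. w \<in> S \<Longrightarrow> Re (Q w) \<ge> 0"
  shows "(\<forall>w\<in>S. Re (Q w) > 0) \<or> Q constant_on S"
proof (rule ccontr)
  assume "\<not> ?thesis"
  then obtain w where w: "w \<in> S" "Re (Q w) \<le> 0" and nc: "\<not> Q constant_on S" by force
  have "open (Q ` S)" by (rule open_mapping_thm[OF Q(1-3,2) order_refl nc])
  then obtain e where e: "e > 0" "ball (Q w) e \<subseteq> Q ` S" using w(1) by (meson image_eqI open_contains_ball)
  have "Q w - of_real (e / 2) \<in> ball (Q w) e" using e(1) by (simp add: dist_norm)
  then obtain v where "v \<in> S" "Q v = Q w - of_real (e / 2)" using e(2) by (metis image_iff subsetD)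
  then have "Re (Q v) < 0" using w(2) e(1) by simp
  then show False using Q(4)[OF \<open>v \<in> S\<close>] by simp
qed

section \<open>Koenigs functions of the right half-plane\<close>

text \<open>Formulated for an image closed under translation instead of a semigroup, and without
  fixing \<open>H\<close> at a point: in this form it is stable under reflection and vertical
  shifts, which reduce directions and boundary points to one case.\<close>

locale half_plane_koenigs =
  fixes H Q :: "complex \<Rightarrow> complex"
  assumes H_deriv: "Re w > 0 \<Longrightarrow> (H has_field_derivative Q w) (at w)"
    and Q_nonneg: "Re w > 0 \<Longrightarrow> Re (Q w) \<ge> 0"
    and inj: "inj_on H {w. Re w > 0}"
    and starlike: "Re w > 0 \<Longrightarrow> t \<ge> 0 \<Longrightarrow> H w + of_real t \<in> H ` {w. Re w > 0}"
begin

abbreviation D where "D \<equiv> H ` {w. Re w > 0}"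

definition G where "G = inv_into {w. Re w > 0} H"

lemma G_H: "Re w > 0 \<Longrightarrow> G (H w) = w"
  unfolding G_def using inj by simp

lemma H_G: "p \<in> D \<Longrightarrow> H (G p) = p" and Re_G_pos: "p \<in> D \<Longrightarrow> Re (G p) > 0"
  using G_H by auto

lemma H_hol: "H holomorphic_on {w. Re w > 0}"
  using H_deriv open_rhp by (auto simp: holomorphic_on_open)

lemma Q_hol: "Q holomorphic_on {w. Re w > 0}"
  using derivative_is_holomorphic[OF open_rhp] H_deriv by blast

lemma D_open: "open D"
  using open_mapping_thm3[OF H_hol open_rhp inj] .

lemma Q_nz: "Re w > 0 \<Longrightarrow> Q w \<noteq> 0"
  using holomorphic_injective_imp_regular[OF H_hol open_rhp inj, of w] H_deriv DERIV_imp_deriv by force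

lemma starlike': "p \<in> D \<Longrightarrow> t \<ge> 0 \<Longrightarrow> p + of_real t \<in> D"
  using starlike by auto

lemma G_deriv: "p \<in> D \<Longrightarrow> (G has_field_derivative inverse (Q (G p))) (at p)"
proof -
  assume p: "p \<in> D"
  have "(G has_field_derivative inverse (Q (G p))) (at (H (G p)))"
    by (rule has_field_derivative_inverse_strong[OF H_deriv Q_nz open_rhp _ holomorphic_on_imp_continuous_on[OF H_hol]])
      (use Re_G_pos[OF p] G_H in auto)
  then show ?thesis using H_G[OF p] by simp
qed

lemma G_cont: "continuous_on D G"
  using G_deriv by (meson DERIV_isCont continuous_at_imp_continuous_on)

lemma Re_inverse_Q: "Re w > 0 \<Longrightarrow> Re (inverse (Q w)) \<ge> 0"
  using Q_nonneg[of w] by (simp add: zero_le_divide_iff)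

lemma Re_G_mvt:
  assumes "\<And>s. t1 \<le> s \<Longrightarrow> s \<le> t2 \<Longrightarrow> Complex s c \<in> D" "t1 \<le> t2"
  obtains u where "u \<in> D"
    "Re (G (Complex t2 c)) - Re (G (Complex t1 c)) = Re (inverse (Q (G u))) * (t2 - t1)"
proof -
  have seg: "Complex (Re u) c = u \<and> t1 \<le> Re u \<and> Re u \<le> t2"
    if "u \<in> closed_segment (Complex t1 c) (Complex t2 c)" for u
    using that assms(2) by (auto simp: closed_segment_same_Im closed_segment_eq_real_ivl complex_eq_iff)
  then have inD: "u \<in> D" if "u \<in> closed_segment (Complex t1 c) (Complex t2 c)" for u
    using assms(1) that by metis
  obtain u where u: "u \<in> closed_segment (Complex t1 c) (Complex t2 c)"
    "Re (G (Complex t2 c)) - Re (G (Complex t1 c)) = Re (inverse (Q (G u)) * (Complex t2 c - Complex t1 c))"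
    using complex_mvt_line[of "Complex t1 c" "Complex t2 c" G "\<lambda>u. inverse (Q (G u))"] G_deriv inD by blast
  have "Re (Z * (Complex t2 c - Complex t1 c)) = Re Z * (t2 - t1)" for Z
    by (simp add: algebra_simps)
  from that[OF inD[OF u(1)] u(2)[unfolded this]] show thesis .
qed

text \<open>Horizontal lines in \<open>D\<close> are trajectories seen through \<open>H\<close>, and
  their velocity \<open>1 / Q\<close> has nonnegative real part; so following a trajectory backwards
  can only decrease the real part.\<close>

lemma Re_G_mono:
  assumes "\<And>s. t1 \<le> s \<Longrightarrow> s \<le> t2 \<Longrightarrow> Complex s c \<in> D" "t1 \<le> t2"
  shows "Re (G (Complex t1 c)) \<le> Re (G (Complex t2 c))"
proof -
  obtain u where u: "u \<in> D"
    "Re (G (Complex t2 c)) - Re (G (Complex t1 c)) = Re (inverse (Q (G u))) * (t2 - t1)"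
    using Re_G_mvt[OF assms] by blast
  then show ?thesis using Re_inverse_Q[OF Re_G_pos[OF u(1)]] assms(2)
    by (metis diff_ge_0_iff_ge mult_nonneg_nonneg)
qed

lemma Re_G_strict_mono:
  assumes "\<And>s. t1 \<le> s \<Longrightarrow> s \<le> t2 \<Longrightarrow> Complex s c \<in> D" "t1 < t2" "\<And>w. Re w > 0 \<Longrightarrow> Re (Q w) > 0"
  shows "Re (G (Complex t1 c)) < Re (G (Complex t2 c))"
proof -
  obtain u where u: "u \<in> D"
    "Re (G (Complex t2 c)) - Re (G (Complex t1 c)) = Re (inverse (Q (G u))) * (t2 - t1)"
    using Re_G_mvt[OF assms(1) less_imp_le[OF assms(2)]] by blast
  moreover have "Re (inverse (Q (G u))) > 0"
    using assms(3)[OF Re_G_pos[OF u(1)]] by (simp add: sum_power2_gt_zero_iff)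
  ultimately show ?thesis using assms(2) by (metis diff_gt_0_iff_gt mult_pos_pos)
qed

text \<open>Comparison of \<open>Re H\<close> with \<open>s * ln r\<close> on the normal; for
  \<open>s > 0\<close> it drives \<open>Re H\<close> to minus infinity at the origin.\<close>

lemma Re_H_log_decay:
  assumes d: "d > 0" and s: "\<And>r. 0 < r \<Longrightarrow> r \<le> d \<Longrightarrow> Re (Q (of_real r)) \<ge> s / r"
    and r: "0 < r" "r \<le> d"
  shows "Re (H (of_real r)) \<le> Re (H (of_real d)) - s * (ln d - ln r)"
proof -
  have "((\<lambda>t. Re (H (of_real t)) - s * ln t) has_real_derivative Re (Q (of_real t)) - s / t) (at t)" if "t > 0" for t
  proof -
    have "((\<lambda>t. H (Complex t 0)) has_vector_derivative Q (of_real t)) (at t)"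
      by (rule has_vector_derivative_horizontal) (use H_deriv[of "of_real t"] that in \<open>simp add: complex_of_real_def\<close>)
    from bounded_linear.has_vector_derivative[OF bounded_linear_Re this]
    have "((\<lambda>t. Re (H (of_real t))) has_real_derivative Re (Q (of_real t))) (at t)"
      by (simp add: has_real_derivative_iff_has_vector_derivative complex_of_real_def)
    from DERIV_diff[OF this DERIV_cmult[OF DERIV_ln_divide[OF that], of s]] show ?thesis by simp
  qed
  then have "Re (H (of_real r)) - s * ln r \<le> Re (H (of_real d)) - s * ln d"
    using s r by (intro DERIV_nonneg_imp_nondecreasing[OF r(2), of "\<lambda>t. Re (H (of_real t)) - s * ln t"])
      (metis diff_ge_0_iff_ge less_le_trans)
  then show ?thesis by (simp add: algebra_simps)
qed

text \<open>Since \<open>Im H\<close> is nondecreasing on the vertical line through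
  \<open>r\<close>, its value at height 0 lies between those at a controlled point of height in
  [-1, 0] and one of height in [0, 1].\<close>

lemma Im_H_radial_bound:
  assumes r: "0 < r" "r \<le> 1"
  shows "\<bar>Im (H (of_real r)) - Im (H 1)\<bar> \<le> 126 * norm (Q 1)"
proof -
  obtain y where y: "y \<in> {0..1}" "(1 - 0) * \<bar>Im (H (Complex r y) - H (Complex 1 0))\<bar> \<le> 126 * 1\<^sup>2 * norm (Q (Complex 1 0))"
    using box_mean_value(1)[OF H_deriv Q_nonneg r, of 0 0 1] by auto
  obtain y' where y': "y' \<in> {-1..0}" "(0 - (-1)) * \<bar>Im (H (Complex r y') - H (Complex 1 0))\<bar> \<le> 126 * 1\<^sup>2 * norm (Q (Complex 1 0))"
    using box_mean_value(1)[OF H_deriv Q_nonneg r, of 0 "-1" 0] by auto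
  have "Im (H (Complex r 0)) \<le> Im (H (Complex r y))"
    using Im_mono_vertical[of H Q r 0 y] H_deriv Q_nonneg r y by auto
  moreover have "Im (H (Complex r y')) \<le> Im (H (Complex r 0))"
    using Im_mono_vertical[of H Q r y' 0] H_deriv Q_nonneg r y' by auto
  ultimately have "\<bar>Im (H (Complex r 0)) - Im (H (Complex 1 0))\<bar> \<le> 126 * norm (Q (Complex 1 0))"
    using y(2) y'(2) by simp
  moreover have "Complex 1 0 = 1" by (simp add: complex_eq_iff)
  ultimately show ?thesis by (simp add: complex_of_real_def)
qed

text \<open>\<open>Q\<close> has order \<open>s / r\<close> at \<open>r\<close>, so the image of a
  disc of radius proportional to \<open>r\<close> contains a disc whose size does not depend on
  \<open>r\<close>. The centres run to the left with bounded, not necessarily convergent, imaginary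
  parts; the strip is therefore placed around a cluster value, and starlikeness fills it to the
  right.\<close>

lemma strip_of_angular_pole:
  assumes s: "s > 0" and "d > 0"
    and ang: "\<And>w. Re w > 0 \<Longrightarrow> norm w \<le> 2 * Re w \<Longrightarrow> norm w \<le> d \<Longrightarrow> norm (w * Q w - of_real s) < s / 10"
  shows "\<exists>c1 c2. c1 < c2 \<and> {w. c1 < Im w \<and> Im w < c2} \<subseteq> D"
proof -
  define d1 where "d1 = min 1 (d / 2)"
  have d1: "0 < d1" "d1 \<le> 1" "2 * d1 \<le> d" using assms(2) by (auto simp: d1_def)
  \<comment> \<open>The factor \<open>3 - 2 * sqrt 2\<close> from Bloch's lemma, times the radius
    \<open>r / 4\<close>, times the lower bound \<open>9 / 10 * s / r\<close> for the
    derivative.\<close>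
  define \<delta> where "\<delta> = (3 - 2 * sqrt 2) * (s * (9 / 40))"
  have sq: "3 - 2 * sqrt 2 > 0"
  proof -
    have "sqrt 2 < 3 / 2" by (rule real_less_lsqrt) (auto simp: power2_eq_square)
    then show ?thesis by simp
  qed
  have \<delta>: "\<delta> > 0" unfolding \<delta>_def using sq s by simp
  have Qr: "norm (of_real r * Q (of_real r) - of_real s) < s / 10" if "0 < r" "r \<le> d1" for r
    using ang[of "of_real r"] that d1 by simp
  have Qlow: "norm (Q (of_real r)) \<ge> 9 / 10 * s / r" if r: "0 < r" "r \<le> d1" for r
  proof -
    have "s - norm (of_real r * Q (of_real r)) \<le> norm (of_real s - of_real r * Q (of_real r))"
      using norm_triangle_ineq2[of "of_real s" "of_real r * Q (of_real r)"] s by simp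
    then have "norm (of_real r * Q (of_real r)) \<ge> 9 / 10 * s"
      using Qr[OF r] by (simp add: norm_minus_commute)
    then show ?thesis using r by (simp add: norm_mult field_simps)
  qed
  have balls: "ball (H (of_real r)) \<delta> \<subseteq> D" if r: "0 < r" "r \<le> d1" for r
  proof -
    \<comment> \<open>The disc lies in the sector \<open>norm w \<le> 2 * Re w\<close>, because 5/4
      is less than twice 3/4.\<close>
    have z: "3 / 4 * r \<le> Re z \<and> norm z \<le> 5 / 4 * r \<and> 3 / 4 * r \<le> norm z" if "z \<in> cball (of_real r) (r / 4)" for z
    proof -
      have "norm (of_real r - z) \<le> r / 4" using that by (simp add: dist_norm)
      then show ?thesis using abs_Re_le_cmod[of "of_real r - z"] norm_triangle_ineq2[of z "of_real r"]
        norm_triangle_ineq2[of "of_real r" z] r by (auto simp: norm_minus_commute)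
    qed
    have zp: "Re z > 0" if "z \<in> cball (of_real r) (r / 4)" for z using z[OF that] r by (smt (verit) mult_pos_pos divide_pos_pos)
    have sub: "cball (of_real r) (r / 4) \<subseteq> {w. Re w > 0}" using zp by auto
    \<comment> \<open>Bloch's lemma requires that the derivative at most doubles on the disc: 11/10
      divided by 3/4 is 22/15, below twice 9/10.\<close>
    have Qup: "norm (Q z) \<le> 2 * norm (Q (of_real r))" if "z \<in> cball (of_real r) (r / 4)" for z
    proof -
      have "norm (z * Q z - of_real s) < s / 10"
        by (rule ang) (use z[OF that] zp[OF that] r d1 in auto)
      then have "norm (z * Q z) \<le> 11 / 10 * s"
        using norm_triangle_ineq[of "z * Q z - of_real s" "of_real s"] s by simp
      moreover have "3 / 4 * r * norm (Q z) \<le> norm z * norm (Q z)"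
        using z[OF that] by (intro mult_right_mono) auto
      ultimately have "3 / 4 * r * norm (Q z) \<le> 11 / 10 * s" by (simp add: norm_mult)
      then have "norm (Q z) \<le> 22 / 15 * s / r" using r by (simp add: field_simps)
      also have "\<dots> \<le> 2 * (9 / 10 * s / r)" using r s by (simp add: field_simps)
      also have "\<dots> \<le> 2 * norm (Q (of_real r))" using Qlow[OF r] by simp
      finally show ?thesis .
    qed
    have dv: "deriv H z = Q z" if "z \<in> cball (of_real r) (r / 4)" for z
      using H_deriv[OF zp[OF that]] by (rule DERIV_imp_deriv)
    have "ball (H (of_real r)) ((3 - 2 * sqrt 2) * (r / 4) * norm (deriv H (of_real r))) \<subseteq> H ` ball (of_real r) (r / 4)"
    proof (rule Bloch_lemma)
      show "H holomorphic_on cball (of_real r) (r / 4)" using H_hol sub holomorphic_on_subset by blast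
      show "norm (deriv H z) \<le> 2 * norm (deriv H (of_real r))" if "z \<in> ball (of_real r) (r / 4)" for z
        using Qup[of z] dv[of z] dv[of "of_real r"] that r by auto
    qed (use r in auto)
    moreover have "\<delta> \<le> (3 - 2 * sqrt 2) * (r / 4) * norm (deriv H (of_real r))"
    proof -
      have "s * (9 / 40) \<le> r / 4 * norm (Q (of_real r))" using Qlow[OF r] r by (simp add: field_simps)
      then have "\<delta> \<le> (3 - 2 * sqrt 2) * (r / 4 * norm (Q (of_real r)))"
        unfolding \<delta>_def using sq by (intro mult_left_mono) auto
      then show ?thesis using dv[of "of_real r"] r by (simp add: mult.assoc)
    qed
    moreover have "H ` ball (of_real r) (r / 4) \<subseteq> D" 
      by (rule image_mono) (use sub ball_subset_cball[of "complex_of_real r" "r / 4"] in blast)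
    ultimately show ?thesis by (meson dual_order.trans subset_ball)
  qed
  have ReQ: "Re (Q (of_real r)) \<ge> (s / 2) / r" if r: "0 < r" "r \<le> d1" for r
  proof -
    have "\<bar>Re (of_real r * Q (of_real r) - of_real s)\<bar> < s / 10"
      using Qr[OF r] abs_Re_le_cmod order_le_less_trans by blast
    then have "\<bar>r * Re (Q (of_real r)) - s\<bar> < s / 10" by simp
    then have "r * Re (Q (of_real r)) \<ge> s / 2" using s by linarith
    then show ?thesis using r by (simp add: field_simps)
  qed
  have small: "\<exists>\<rho>>0. \<rho> \<le> d1 \<and> (\<forall>r. 0 < r \<longrightarrow> r \<le> \<rho> \<longrightarrow> Re (H (of_real r)) \<le> x)" for x
  proof -
    \<comment> \<open>Below this radius the logarithmic decay with slope \<open>s / 2\<close>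
      exceeds the distance from \<open>x\<close> to \<open>Re (H d1)\<close>.\<close>
    define \<rho> where "\<rho> = min d1 (exp (ln d1 - 2 / s * (\<bar>x - Re (H (of_real d1))\<bar>)))"
    have "Re (H (of_real r)) \<le> x" if r: "0 < r" "r \<le> \<rho>" for r
    proof -
      have "ln r \<le> ln d1 - 2 / s * (\<bar>x - Re (H (of_real d1))\<bar>)"
        using r unfolding \<rho>_def by (metis exp_le_cancel_iff exp_ln min.bounded_iff)
      then have "s / 2 * (2 / s * (\<bar>x - Re (H (of_real d1))\<bar>)) \<le> s / 2 * (ln d1 - ln r)"
        using s by (intro mult_left_mono) auto
      then have "\<bar>x - Re (H (of_real d1))\<bar> \<le> s / 2 * (ln d1 - ln r)" using s by simp
      moreover have "Re (H (of_real r)) \<le> Re (H (of_real d1)) - s / 2 * (ln d1 - ln r)"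
        using Re_H_log_decay[OF d1(1) ReQ, of r] r by (simp add: \<rho>_def)
      ultimately show ?thesis by linarith
    qed
    then show ?thesis using d1 by (intro exI[of _ \<rho>]) (auto simp: \<rho>_def)
  qed
  define B where "B = 126 * norm (Q 1)"
  have "\<exists>c. \<forall>\<rho>>0. \<exists>r. 0 < r \<and> r \<le> \<rho> \<and> \<bar>Im (H (of_real r)) - c\<bar> < \<delta> / 2"
  proof -
    define f where "f n = Im (H (of_real (1 / real (Suc n))))" for n
    have "compact {Im (H 1) - B..Im (H 1) + B}" by simp
    moreover have "\<forall>n. f n \<in> {Im (H 1) - B..Im (H 1) + B}"
    proof
      fix n
      have "\<bar>f n - Im (H 1)\<bar> \<le> B" unfolding f_def B_def by (rule Im_H_radial_bound) auto
      then show "f n \<in> {Im (H 1) - B..Im (H 1) + B}" by auto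
    qed
    ultimately obtain c k where ck: "strict_mono k" "(f \<circ> k) \<longlonglongrightarrow> c"
      unfolding compact_def by metis
    have "\<exists>r. 0 < r \<and> r \<le> \<rho> \<and> \<bar>Im (H (of_real r)) - c\<bar> < \<delta> / 2" if \<rho>: "\<rho> > 0" for \<rho>
    proof -
      have "\<forall>\<^sub>F n in sequentially. dist ((f \<circ> k) n) c < \<delta> / 2"
        by (rule tendstoD[OF ck(2)]) (use \<delta> in simp)
      moreover have "\<forall>\<^sub>F n in sequentially. 1 / \<rho> \<le> real n" 
        using filterlim_real_sequentially unfolding filterlim_at_top by blast
      ultimately have "\<forall>\<^sub>F n in sequentially. dist ((f \<circ> k) n) c < \<delta> / 2 \<and> 1 / \<rho> \<le> real n"
        by (rule eventually_conj)
      then obtain n where n: "dist ((f \<circ> k) n) c < \<delta> / 2" "1 / \<rho> \<le> real n"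
        by (auto simp: eventually_sequentially)
      have "real n \<le> real (Suc (k n))" using seq_suble[OF ck(1), of n] by simp
      then have "1 / \<rho> \<le> real (Suc (k n))" using n(2) by linarith
      then have "1 / real (Suc (k n)) \<le> \<rho>" using \<rho> by (simp add: field_simps del: of_nat_Suc)
      then show ?thesis using n(1) by (intro exI[of _ "1 / real (Suc (k n))"]) (auto simp: f_def dist_real_def)
    qed
    then show ?thesis by blast
  qed
  then obtain c where c: "\<And>\<rho>. \<rho> > 0 \<Longrightarrow> \<exists>r. 0 < r \<and> r \<le> \<rho> \<and> \<bar>Im (H (of_real r)) - c\<bar> < \<delta> / 2" by blast
  have "v \<in> D" if v: "c - \<delta> / 2 < Im v" "Im v < c + \<delta> / 2" for v
  proof -
    obtain \<rho> where \<rho>: "\<rho> > 0" "\<rho> \<le> d1" "\<And>r. 0 < r \<Longrightarrow> r \<le> \<rho> \<Longrightarrow> Re (H (of_real r)) \<le> Re v" using small by blast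
    obtain r where r: "0 < r" "r \<le> \<rho>" "\<bar>Im (H (of_real r)) - c\<bar> < \<delta> / 2" using c[OF \<rho>(1)] by blast
    define p where "p = Complex (Re (H (of_real r))) (Im v)"
    have "H (of_real r) - p = \<i> * of_real (Im (H (of_real r)) - Im v)" by (simp add: p_def complex_eq_iff)
    then have "dist (H (of_real r)) p = \<bar>Im (H (of_real r)) - Im v\<bar>"
      by (simp add: dist_norm norm_mult del: of_real_diff)
    also have "\<dots> < \<delta>" using r(3) v by linarith
    finally have "p \<in> ball (H (of_real r)) \<delta>" by simp
    then have "p \<in> D" using balls[of r] r \<rho> by auto
    moreover have "v = p + of_real (Re v - Re (H (of_real r)))" by (simp add: p_def complex_eq_iff)
    ultimately show ?thesis using starlike'[of p "Re v - Re (H (of_real r))"] \<rho>(3)[OF r(1,2)] by simp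
  qed
  then show ?thesis using \<delta> by (intro exI[of _ "c - \<delta> / 2"] exI[of _ "c + \<delta> / 2"]) auto
qed

end

text \<open>The lower bound \<open>\<delta>\<close> may fail for \<open>Re k\<close> on the far part
  of the frontier; there the logarithm makes up for it. Shifting by 1 avoids the branch cut and
  keeps the gain nonnegative on the half-plane. The signs are reversed to fit the maximum
  principle.\<close>

lemma max_principle_with_logarithmic_gain:
  fixes k :: "complex \<Rightarrow> complex"
  assumes V: "open V" "bounded V" "closure V \<subseteq> {v. Re v > 0}"
    and k: "k holomorphic_on {v. Re v > 0}" and \<epsilon>: "\<epsilon> > 0"
    and bd: "\<And>v. v \<in> frontier V \<Longrightarrow> \<delta> \<le> Re (k v) + \<epsilon> * ln (norm (v + 1))"
    and v0: "v0 \<in> V"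
  shows "\<delta> \<le> Re (k v0) + \<epsilon> * ln (norm (v0 + 1))"
proof -
  define f where "f = (\<lambda>v. - k v - of_real \<epsilon> * Ln (v + 1))"
  have nn: "v + 1 \<notin> \<real>\<^sub>\<le>\<^sub>0" if "Re v > 0" for v
    using that by (auto simp: complex_nonpos_Reals_iff)
  have f: "f holomorphic_on {v. Re v > 0}"
    unfolding f_def using nn by (intro holomorphic_intros k) auto
  have Ref: "Re (f v) = - (Re (k v) + \<epsilon> * ln (norm (v + 1)))" if "Re v > 0" for v
  proof -
    have "v + 1 \<noteq> 0" using that by (auto simp: complex_eq_iff)
    then show ?thesis by (simp add: f_def)
  qed
  have sub: "frontier V \<subseteq> {v. Re v > 0}" "V \<subseteq> {v. Re v > 0}"
    using V(3) closure_subset by (auto simp: frontier_def)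
  have "Re (f v0) \<le> - \<delta>"
  proof (rule maximum_real_frontier[of f V])
    show "f holomorphic_on interior V" using f sub V(1) holomorphic_on_subset by (metis interior_open)
    show "continuous_on (closure V) f"
      using f V(3) holomorphic_on_imp_continuous_on holomorphic_on_subset by blast
    show "Re (f z) \<le> - \<delta>" if "z \<in> frontier V" for z
      using bd[OF that] Ref[of z] sub(1) that by auto
  qed (use V v0 in auto)
  then show ?thesis using Ref[of v0] v0 sub(2) by auto
qed

section \<open>A Phragmen-Lindelof argument below a backward trajectory\<close>

context half_plane_koenigs begin

text \<open>If the line through \<open>H q\<close> left the image at a point \<open>p\<close>, then, the image being starlike, a fourth root
  of \<open>H - p\<close> would be a holomorphic function with positive real part. On the boundary of the region below the
  orbit and left of \<open>q\<close> this real part is bounded away from 0, hence by the maximum principle (with a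
  logarithm compensating the point at infinity) also inside, which contradicts \<open>H \<rightarrow> p\<close> along the trajectory of
  \<open>q\<close>.\<close>

lemma line_below_tangential_orbit:
  assumes pos: "\<And>w. Re w > 0 \<Longrightarrow> Re (Q w) > 0"
    and ray: "\<And>t. t \<le> 0 \<Longrightarrow> Complex t c \<in> D"
    and lim: "filterlim (\<lambda>t. Im (G (Complex t c))) at_bot at_bot"
    and y: "y < Im (G (Complex 0 c))" and t: "t \<ge> 0"
  shows "H (Complex (Re (G (Complex 0 c))) y) - of_real t \<in> D"
proof (rule ccontr)
  assume notin: "H (Complex (Re (G (Complex 0 c))) y) - of_real t \<notin> D"
  define w where "w t = G (Complex t c)" for t
  define x0 where "x0 = Re (w 0)"
  define y0 where "y0 = Im (w 0)"
  define q where "q = Complex x0 y"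
  have wD: "Re (w t) > 0" "H (w t) = Complex t c" if "t \<le> 0" for t
    using Re_G_pos[OF ray[OF that]] H_G[OF ray[OF that]] by (simp_all add: w_def)
  have x0: "x0 > 0" using wD(1)[of 0] by (simp add: x0_def)
  have w0: "w 0 = Complex x0 y0" by (simp add: x0_def y0_def complex_eq_iff)
  have yy: "y < y0" using y by (simp add: y0_def w_def)
  have q: "Re q > 0" "H q \<in> D" using x0 by (auto simp: q_def)
  define h where "h = Im (H q)"
  have hc: "h < c" using Im_strict_mono_vertical[of H Q x0 y y0] H_deriv pos x0 yy wD(2)[of 0]
    unfolding h_def q_def w0[symmetric] by auto
  \<comment> \<open>The orbit is a curve of constant \<open>Im H\<close>, and \<open>Im H\<close>
    increases upwards: a point at a lower \<open>H\<close>-height lies under the orbit point on the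
    same vertical line.\<close>
  have below: "Im v < Im (w s)" if "s \<le> 0" "Re v = Re (w s)" "Im (H v) < c" for v s
  proof (rule ccontr)
    assume "\<not> Im v < Im (w s)"
    then have "Im (H (Complex (Re (w s)) (Im (w s)))) \<le> Im (H (Complex (Re (w s)) (Im v)))"
      using Im_mono_vertical[of H Q "Re (w s)" "Im (w s)" "Im v"] H_deriv Q_nonneg wD(1)[OF that(1)] by auto
    then have "Im (H (w s)) \<le> Im (H v)" unfolding complex_surj that(2)[symmetric]
      by (metis complex_surj that(2))
    then show False using that wD(2)[OF that(1)] by simp
  qed
  have below': "Im v \<le> Im (w s)" if "s \<le> 0" "Re v = Re (w s)" "Im (H v) \<le> c" for v s
  proof (rule ccontr)
    assume "\<not> Im v \<le> Im (w s)"
    then have "Im (H (Complex (Re (w s)) (Im (w s)))) < Im (H (Complex (Re (w s)) (Im v)))"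
      using Im_strict_mono_vertical[of H Q "Re (w s)" "Im (w s)" "Im v"] H_deriv pos wD(1)[OF that(1)] by auto
    then have "Im (H (w s)) < Im (H v)" by (metis complex_surj that(2))
    then show False using that wD(2)[OF that(1)] by simp
  qed
  \<comment> \<open>\<open>p\<close> is the first point where the backward trajectory of \<open>H q\<close> leaves \<open>D\<close>.\<close>
  define Bad where "Bad = {0..} \<inter> (\<lambda>t. H q - of_real t) -` (- D)"
  define T where "T = Inf Bad"
  define p where "p = H q - of_real T"
  have "t \<in> Bad" using t notin by (auto simp: Bad_def q_def x0_def w_def)
  moreover have "closed Bad" unfolding Bad_def
    by (intro continuous_closed_preimage continuous_intros) (use D_open in auto)
  moreover have bdd: "bdd_below Bad" by (auto simp: Bad_def)
  ultimately have "T \<in> Bad" unfolding T_def by (intro closed_contains_Inf) auto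
  then have T0: "T \<ge> 0" and pD: "p \<notin> D" by (auto simp: Bad_def p_def)
  have before: "H q - of_real t \<in> D" if "0 \<le> t" "t < T" for t
    using that cInf_lower[OF _ bdd, of t] unfolding T_def[symmetric] by (force simp: Bad_def)
  have Tpos: "T > 0" using T0 pD q(2) by (cases "T = 0") (auto simp: p_def)
  have imp: "Im p = h" by (simp add: p_def h_def)
  \<comment> \<open>A value of \<open>H\<close> on the half-line from \<open>p\<close> to the left
    would put \<open>p\<close> into the image by starlikeness. Hence the principal logarithm of
    \<open>H - p\<close> is holomorphic.\<close>
  have slit: "H v - p \<notin> \<real>\<^sub>\<le>\<^sub>0" if "Re v > 0" for v
  proof
    assume "H v - p \<in> \<real>\<^sub>\<le>\<^sub>0"
    then have "p = H v + of_real (- Re (H v - p))" "- Re (H v - p) \<ge> 0"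
      by (auto simp: complex_nonpos_Reals_iff complex_eq_iff)
    then show False using pD starlike[OF that, of "- Re (H v - p)"] by metis
  qed
  have Hcont: "continuous_on {v. Re v > 0} H" using H_hol holomorphic_on_imp_continuous_on by blast
  \<comment> \<open>On the line of real part \<open>x0\<close>, compactness treats heights from
    \<open>y - 1\<close> to \<open>y0\<close>, and lower down \<open>Im H\<close> falls short of
    \<open>Im p\<close> by at least \<open>e\<close>. Where \<open>Im H = c\<close>, it exceeds
    \<open>Im p = h\<close> by a fixed amount.\<close>
  obtain d where d: "d > 0" "\<And>v. Re v = x0 \<Longrightarrow> Im v \<le> y0 \<Longrightarrow> norm (H v - p) \<ge> d"
    "\<And>v. Im (H v) = c \<Longrightarrow> norm (H v - p) \<ge> d"
  proof -
    define I where "I = (\<lambda>s. norm (H (Complex x0 s) - p)) ` {y - 1..y0}"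
    have "continuous_on {y - 1..y0} (\<lambda>s. norm (H (Complex x0 s) - p))"
      by (intro continuous_intros continuous_on_compose2[OF Hcont]) (use x0 in \<open>auto simp: Complex_eq intro!: continuous_intros\<close>)
    then have "compact I" unfolding I_def by (intro compact_continuous_image) auto
    moreover have "I \<noteq> {}" using yy by (auto simp: I_def)
    ultimately obtain m where m: "m \<in> I" "\<And>x. x \<in> I \<Longrightarrow> m \<le> x" using compact_attains_inf by metis
    obtain s where "m = norm (H (Complex x0 s) - p)" using m(1) by (auto simp: I_def)
    moreover have "H (Complex x0 s) - p \<noteq> 0" using slit[of "Complex x0 s"] x0 by fastforce
    ultimately have "m > 0" by simp
    define e where "e = h - Im (H (Complex x0 (y - 1)))"
    have "e > 0" using Im_strict_mono_vertical[of H Q x0 "y - 1" y] H_deriv pos x0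
      by (auto simp: e_def h_def q_def)
    define d where "d = min m (min e (c - h))"
    have "norm (H v - p) \<ge> d" if v: "Re v = x0" "Im v \<le> y0" and veq: "Complex x0 (Im v) = v" for v
    proof (cases "Im v \<ge> y - 1")
      case True
      have "norm (H (Complex x0 (Im v)) - p) \<in> I"
        unfolding I_def by (rule image_eqI[of _ _ "Im v"]) (use True v in auto)
      then have "m \<le> norm (H v - p)" using m(2) veq by simp
      then show ?thesis by (simp add: d_def)
    next
      case False
      have "Im (H (Complex x0 (Im v))) \<le> Im (H (Complex x0 (y - 1)))"
        using Im_mono_vertical[of H Q x0 "Im v" "y - 1"] H_deriv Q_nonneg x0 False by auto
      then have "Im (H v) \<le> h - e" using veq by (simp add: e_def)
      then have "\<bar>Im (H v - p)\<bar> \<ge> e" using imp by simp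
      then show ?thesis using abs_Im_le_cmod[of "H v - p"] by (simp add: d_def)
    qed
    then have "norm (H v - p) \<ge> d" if "Re v = x0" "Im v \<le> y0" for v
      using that by (metis complex_surj)
    moreover have "norm (H v - p) \<ge> d" if "Im (H v) = c" for v
      using abs_Im_le_cmod[of "H v - p"] that imp by (simp add: d_def)
    moreover have "d > 0" using \<open>m > 0\<close> \<open>e > 0\<close> hc by (simp add: d_def)
    ultimately show thesis using that by blast
  qed
  \<comment> \<open>The argument of a fourth root is at most pi / 4, which bounds
    \<open>Re k\<close> below by a multiple of its modulus; a square root could have arguments
    arbitrarily close to pi / 2.\<close>
  define k where "k = (\<lambda>v. exp (Ln (H v - p) / 4))"
  have khol: "k holomorphic_on {v. Re v > 0}"
    unfolding k_def using slit by (intro holomorphic_intros H_hol) auto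
  have Rek: "Re (k v) \<ge> exp (ln (norm (H v - p)) / 4) * cos (pi / 4) \<and> norm (H v - p) > 0" if v: "Re v > 0" for v
  proof -
    have nz: "H v - p \<noteq> 0" using slit[OF v] by auto
    have "\<bar>Im (Ln (H v - p)) / 4\<bar> \<le> pi / 4"
      using mpi_less_Im_Ln[OF nz] Im_Ln_le_pi[OF nz] by auto
    then have "cos (pi / 4) \<le> cos \<bar>Im (Ln (H v - p)) / 4\<bar>"
      by (intro cos_monotone_0_pi_le) auto
    then have "cos (pi / 4) \<le> cos (Im (Ln (H v - p)) / 4)" by (simp only: cos_abs_real)
    then have "exp (ln (norm (H v - p)) / 4) * cos (pi / 4) \<le> exp (ln (norm (H v - p)) / 4) * cos (Im (Ln (H v - p)) / 4)"
      by (intro mult_left_mono) auto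
    then show ?thesis using nz by (simp add: k_def Re_exp)
  qed
  define \<delta> where "\<delta> = exp (ln d / 4) * cos (pi / 4)"
  have \<delta>: "\<delta> > 0" by (simp add: \<delta>_def cos_45)
  have Rek_pos: "Re (k v) > 0" if "Re v > 0" for v
  proof -
    have "exp (ln (norm (H v - p)) / 4) * cos (pi / 4) > 0" by (simp add: cos_45)
    then show ?thesis using Rek[OF that] by linarith
  qed
  have Rek_far: "Re (k v) \<ge> \<delta>" if "Re v > 0" "norm (H v - p) \<ge> d" for v
  proof -
    have "ln d \<le> ln (norm (H v - p))" using d(1) that(2) Rek[OF that(1)] by simp
    then have "\<delta> \<le> exp (ln (norm (H v - p)) / 4) * cos (pi / 4)"
      unfolding \<delta>_def by (intro mult_right_mono) (auto simp: cos_45)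
    then show ?thesis using Rek[OF that(1)] by linarith
  qed
  \<comment> \<open>\<open>exp (4 * ln \<delta>)\<close> is the fourth power of
    \<open>\<delta>\<close>, so at distance \<open>\<tau>\<close> from \<open>p\<close> the fourth
    root is smaller than \<open>\<delta>\<close>.\<close>
  define \<tau> where "\<tau> = min (T / 2) (exp (4 * ln \<delta>) / 2)"
  have \<tau>: "0 < \<tau>" "\<tau> < T" "\<tau> < exp (4 * ln \<delta>)" using Tpos by (auto simp: \<tau>_def min_less_iff_disj)
  define t0 where "t0 = T - \<tau>"
  have t0: "0 < t0" "t0 < T" using \<tau> by (auto simp: t0_def)
  define u where "u t = G (H q - of_real t)" for t
  have u: "Re (u t) > 0" "H (u t) = H q - of_real t" if "0 \<le> t" "t \<le> t0" for t
    using before[of t] that t0 Re_G_pos H_G by (auto simp: u_def)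
  have u0: "u 0 = q" using G_H[OF q(1)] by (simp add: u_def)
  define v0 where "v0 = u t0"
  have v0pos: "Re v0 > 0" using u(1)[of t0] t0 by (simp add: v0_def)
  have "H v0 - p = of_real \<tau>" using u(2)[of t0] t0 by (simp add: v0_def p_def t0_def)
  then have "k v0 = of_real (exp (ln \<tau> / 4))" using \<tau>(1) by (simp add: k_def Ln_of_real flip: exp_of_real)
  moreover have "exp (ln \<tau> / 4) < \<delta>"
  proof -
    have "ln \<tau> < 4 * ln \<delta>" using \<tau> by (metis ln_exp ln_less_cancel_iff exp_gt_zero)
    then have "exp (ln \<tau> / 4) < exp (ln \<delta>)" by simp
    then show ?thesis using \<delta> by simp
  qed
  ultimately have kv0: "Re (k v0) < \<delta>" by simp
  define N where "N = ln (norm (v0 + 1))"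
  have norm1: "norm (v + 1) \<ge> 1" if "Re v > 0" for v
    using complex_Re_le_cmod[of "v + 1"] that by simp
  have N: "N \<ge> 0" using norm1[OF v0pos] by (simp add: N_def)
  \<comment> \<open>Small enough that the logarithmic gain at \<open>v0\<close> does not lift
    \<open>Re k\<close> up to \<open>\<delta>\<close>.\<close>
  define \<epsilon> where "\<epsilon> = (\<delta> - Re (k v0)) / (2 * (N + 1))"
  have \<epsilon>: "\<epsilon> > 0" using kv0 N by (simp add: \<epsilon>_def)
  have \<epsilon>N: "Re (k v0) + \<epsilon> * N < \<delta>"
  proof -
    have "\<epsilon> * N < \<epsilon> * (2 * (N + 1))" using \<epsilon> N by (intro mult_strict_left_mono) auto
    also have "\<dots> = \<delta> - Re (k v0)" using N by (simp add: \<epsilon>_def)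
    finally show ?thesis by simp
  qed
  have ucont: "continuous_on {0..t0} u" unfolding u_def
    by (intro continuous_on_compose2[OF G_cont] continuous_intros) (use before t0 in auto)
  then have "compact (u ` {0..t0})" by (intro compact_continuous_image) auto
  then obtain R0 where R0: "\<And>t. 0 \<le> t \<Longrightarrow> t \<le> t0 \<Longrightarrow> norm (u t) < R0"
  proof -
    assume *: "\<And>R0. (\<And>t. 0 \<le> t \<Longrightarrow> t \<le> t0 \<Longrightarrow> norm (u t) < R0) \<Longrightarrow> thesis"
    obtain R0 where "\<forall>x\<in>u ` {0..t0}. norm x < R0"
      using compact_imp_bounded[OF \<open>compact (u ` {0..t0})\<close>] unfolding bounded_pos_less by blast
    then show thesis by (intro *[of R0]) auto
  qed
  \<comment> \<open>The ball of radius \<open>R\<close> contains the arc \<open>u\<close> up to time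
    \<open>t0\<close>, and on its bounding circle the gain alone reaches
    \<open>\<delta>\<close>.\<close>
  define R where "R = max R0 (1 + exp (\<delta> / \<epsilon>))"
  have R: "norm (u t) < R" if "0 \<le> t" "t \<le> t0" for t using R0[OF that] by (simp add: R_def)
  have R1: "R > 1" "ln (R - 1) \<ge> \<delta> / \<epsilon>"
  proof -
    have e: "exp (\<delta> / \<epsilon>) \<le> R - 1" by (simp add: R_def)
    then show "R > 1" using exp_gt_zero[of "\<delta> / \<epsilon>"] by linarith
    then show "ln (R - 1) \<ge> \<delta> / \<epsilon>" using e by (simp add: ln_ge_iff)
  qed
  have "\<forall>\<^sub>F s in at_bot. Im (w s) < - R" using lim
    unfolding w_def[symmetric] filterlim_at_bot_dense by blast
  then obtain s1 where s1: "\<And>s. s \<le> s1 \<Longrightarrow> Im (w s) < - R" by (auto simp: eventually_at_bot_linorder)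
  \<comment> \<open>The orbit point at time \<open>s0\<close> lies below the ball of radius
    \<open>R\<close>. On its vertical line everything under the orbit is outside the ball, so the
    left side contributes no frontier to \<open>V\<close>, and \<open>u\<close> cannot cross
    it.\<close>
  define s0 where "s0 = min s1 (-1)"
  have s0: "s0 < 0" "Im (w s0) < - R" using s1[of s0] by (auto simp: s0_def)
  define X where "X = Re (w s0)"
  have X: "X > 0" "X < x0" using wD(1)[of s0] s0 Re_G_strict_mono[of s0 0 c] ray pos
    by (auto simp: X_def x0_def w_def)
  define V where "V = {v. X < Re v} \<inter> {v. Re v < x0} \<inter> {v. norm v < R} \<inter> ({v. Re v > 0} \<inter> (\<lambda>v. Im (H v)) -` {..<c})"
  have Vo: "open V" unfolding V_def
    by (intro open_Int open_halfspace_Re_gt open_halfspace_Re_lt continuous_open_preimage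
        continuous_on_Im Hcont open_rhp open_lessThan open_Collect_less continuous_intros)
  have Vb: "bounded V" by (rule bounded_subset[of "ball 0 R"]) (auto simp: V_def)
  define C where "C = {v. X \<le> Re v} \<inter> {v. Re v \<le> x0} \<inter> {v. norm v \<le> R}"
  have Cc: "closed C" unfolding C_def
    by (intro closed_Int closed_halfspace_Re_ge closed_halfspace_Re_le closed_Collect_le continuous_intros)
  have "closed (C \<inter> (\<lambda>v. Im (H v)) -` {..c})"
    by (intro continuous_closed_preimage Cc closed_atMost continuous_on_Im continuous_on_subset[OF Hcont])
      (use X in \<open>auto simp: C_def\<close>)
  moreover have "V \<subseteq> C \<inter> (\<lambda>v. Im (H v)) -` {..c}" by (auto simp: V_def C_def)
  ultimately have clV: "closure V \<subseteq> C \<inter> (\<lambda>v. Im (H v)) -` {..c}" by (rule closure_minimal[rotated])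
  have v0V: "v0 \<in> V"
  proof -
    have Imu: "Im (H (u t)) < c" if "0 \<le> t" "t \<le> t0" for t using u(2)[OF that] hc by (simp add: h_def)
    have "Re (u t0) < x0"
    proof -
      have "Complex s h \<in> D" if "Re (H q) - t0 \<le> s" "s \<le> Re (H q)" for s
      proof -
        have "H q - of_real (Re (H q) - s) = Complex s h" by (simp add: complex_eq_iff h_def)
        then show ?thesis using before[of "Re (H q) - s"] that t0 by auto
      qed
      then have "Re (G (Complex (Re (H q) - t0) h)) < Re (G (Complex (Re (H q)) h))"
        using Re_G_strict_mono[of "Re (H q) - t0" "Re (H q)" h] pos t0 by auto
      moreover have "Complex (Re (H q) - t0) h = H q - of_real t0" "Complex (Re (H q)) h = H q"
        by (simp_all add: complex_eq_iff h_def)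
      ultimately show ?thesis using G_H[OF q(1)] by (simp add: u_def) (simp add: q_def)
    qed
    moreover have "X < Re (u t0)"
    proof (rule ccontr)
      assume "\<not> X < Re (u t0)"
      moreover have "X \<le> Re (u 0)" using X u0 by (simp add: q_def)
      moreover have "continuous_on {0..t0} (\<lambda>t. Re (u t))" by (intro continuous_on_Re ucont)
      ultimately obtain t where t: "0 \<le> t" "t \<le> t0" "Re (u t) = X"
        using IVT2'[of "\<lambda>t. Re (u t)" t0 X 0] t0 by force
      have "Im (u t) < Im (w s0)" by (rule below) (use s0 t Imu[OF t(1,2)] in \<open>auto simp: X_def\<close>)
      then have "\<bar>Im (u t)\<bar> > R" using s0(2) by linarith
      then show False using R[OF t(1,2)] abs_Im_le_cmod[of "u t"] by linarith
    qed
    ultimately show ?thesis using R[of t0] Imu[of t0] v0pos t0 by (auto simp: V_def v0_def)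
  qed
  have "\<delta> \<le> Re (k v0) + \<epsilon> * ln (norm (v0 + 1))"
  proof (rule max_principle_with_logarithmic_gain[OF Vo Vb _ khol \<epsilon> _ v0V])
    show "closure V \<subseteq> {v. Re v > 0}" using clV X by (auto simp: C_def)
    fix v assume "v \<in> frontier V"
    then have v: "v \<in> C" "Im (H v) \<le> c" "v \<notin> V"
      using clV Vo by (auto simp: frontier_def interior_open)
    have vpos: "Re v > 0" using v X by (auto simp: C_def)
    have gain: "\<epsilon> * ln (norm (v + 1)) \<ge> 0" using norm1[OF vpos] \<epsilon> by simp
    have "Re v \<noteq> X"
    proof
      assume "Re v = X"
      then have "Im v \<le> Im (w s0)" using below'[of s0 v] s0 v by (auto simp: X_def)
      then have "\<bar>Im v\<bar> > R" using s0(2) by linarith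
      then show False using v abs_Im_le_cmod[of v] by (auto simp: C_def)
    qed
    then consider "norm v = R" | "Re v = x0" | "Im (H v) = c"
      using v vpos by (force simp: V_def C_def)
    then show "\<delta> \<le> Re (k v) + \<epsilon> * ln (norm (v + 1))"
    proof cases
      case 1
      have "norm (v + 1) \<ge> R - 1" using norm_triangle_ineq2[of v "-1"] 1 by simp
      moreover have "norm (v + 1) > 0" using norm1[OF vpos] by linarith
      ultimately have "ln (R - 1) \<le> ln (norm (v + 1))"
        using R1(1) ln_le_cancel_iff[of "R - 1" "norm (v + 1)"] by simp
      then have "\<epsilon> * (\<delta> / \<epsilon>) \<le> \<epsilon> * ln (norm (v + 1))" using R1(2) \<epsilon> by (intro mult_left_mono) auto
      then show ?thesis using Rek_pos[OF vpos] \<epsilon> by simp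
    next
      case 2
      have "Im v \<le> Im (w 0)" by (rule below') (use 2 v in \<open>auto simp: x0_def\<close>)
      then show ?thesis using Rek_far[OF vpos d(2)] 2 gain by (simp add: y0_def)
    next
      case 3
      then show ?thesis using Rek_far[OF vpos d(3)] gain by simp
    qed
  qed
  then show False using \<epsilon>N by (simp add: N_def)
qed

text \<open>On the unit segment under the orbit point \<open>Im H\<close> runs continuously from
  \<open>m\<close> to \<open>c\<close>, so every height of the strip is attained. From the attained
  point the line is filled to the right by starlikeness and to the left by
  \<open>line_below_tangential_orbit\<close>.\<close>

lemma strip_of_tangential_orbit_below:
  assumes pos: "\<And>w. Re w > 0 \<Longrightarrow> Re (Q w) > 0"
    and ray: "\<And>t. t \<le> 0 \<Longrightarrow> Complex t c \<in> D"
    and lim: "filterlim (\<lambda>t. Im (G (Complex t c))) at_bot at_bot"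
  shows "\<exists>c1 c2. c1 < c2 \<and> {w. c1 < Im w \<and> Im w < c2} \<subseteq> D"
proof -
  define x0 where "x0 = Re (G (Complex 0 c))"
  define y0 where "y0 = Im (G (Complex 0 c))"
  have x0: "x0 > 0" using Re_G_pos[OF ray] by (simp add: x0_def)
  define m where "m = Im (H (Complex x0 (y0 - 1)))"
  have "H (Complex x0 y0) = Complex 0 c" using H_G[OF ray[of 0]] by (simp add: x0_def y0_def)
  then have c: "Im (H (Complex x0 y0)) = c" by simp
  have "m < c" using Im_strict_mono_vertical[of H Q x0 "y0 - 1" y0] H_deriv pos x0
    unfolding m_def c[symmetric] by auto
  moreover have "v \<in> D" if v: "m < Im v" "Im v < c" for v
  proof -
    have "continuous_on {y0 - 1..y0} (\<lambda>s. Im (H (Complex x0 s)))"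
      by (intro continuous_on_Im continuous_on_compose2[OF holomorphic_on_imp_continuous_on[OF H_hol]])
        (use x0 in \<open>auto simp: Complex_eq intro!: continuous_intros\<close>)
    then obtain y where y: "y0 - 1 \<le> y" "y \<le> y0" "Im (H (Complex x0 y)) = Im v"
      using IVT'[of "\<lambda>s. Im (H (Complex x0 s))" "y0 - 1" "Im v" y0] v c by (auto simp: m_def)
    define q where "q = H (Complex x0 y)"
    have q: "q \<in> D" "Im q = Im v" using x0 y by (auto simp: q_def)
    have yy: "y < y0" using y v c by (cases "y = y0") auto
    show ?thesis
    proof (cases "Re v \<ge> Re q")
      case True
      have "v = q + of_real (Re v - Re q)" using q(2) by (simp add: complex_eq_iff)
      then show ?thesis using starlike'[OF q(1), of "Re v - Re q"] True by (metis diff_ge_0_iff_ge)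
    next
      case False
      have "v = q - of_real (Re q - Re v)" using q(2) by (simp add: complex_eq_iff)
      moreover have "q - of_real (Re q - Re v) \<in> D"
        using line_below_tangential_orbit[OF pos ray lim, of y "Re q - Re v"] yy False
        by (auto simp: q_def x0_def y0_def)
      ultimately show ?thesis by simp
    qed
  qed
  ultimately show ?thesis by (intro exI[of _ m] exI[of _ c]) auto
qed

end

section \<open>Backward orbits\<close>

text \<open>Reflection makes trajectories escaping upwards into ones escaping downwards.\<close>

lemma half_plane_koenigs_cnj:
  assumes "half_plane_koenigs H Q"
  shows "half_plane_koenigs (\<lambda>w. cnj (H (cnj w))) (\<lambda>w. cnj (Q (cnj w)))"
proof -
  interpret half_plane_koenigs H Q by fact
  show ?thesis
  proof
    show "((\<lambda>w. cnj (H (cnj w))) has_field_derivative cnj (Q (cnj w))) (at w)" if "Re w > 0" for w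
      using has_field_derivative_cnj_cnj[OF H_deriv[of "cnj w"]] that by (simp add: o_def)
    show "Re (cnj (Q (cnj w))) \<ge> 0" if "Re w > 0" for w using Q_nonneg[of "cnj w"] that by simp
    show "inj_on (\<lambda>w. cnj (H (cnj w))) {w. Re w > 0}"
    proof (rule inj_onI)
      fix v w assume "v \<in> {w. Re w > 0}" "w \<in> {w. Re w > 0}" "cnj (H (cnj v)) = cnj (H (cnj w))"
      then have "cnj v = cnj w" using inj_onD[OF inj, of "cnj v" "cnj w"] by simp
      then show "v = w" by simp
    qed
    show "cnj (H (cnj w)) + of_real t \<in> (\<lambda>w. cnj (H (cnj w))) ` {w. Re w > 0}"
      if w: "Re w > 0" and t: "t \<ge> 0" for w t
    proof -
      obtain v where v: "Re v > 0" "H (cnj w) + of_real t = H v" using starlike[of "cnj w" t] w t by auto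
      then have "cnj (H (cnj w)) + of_real t = cnj (H (cnj (cnj v)))"
        by (metis complex_cnj_add complex_cnj_cnj complex_cnj_complex_of_real)
      then show ?thesis using v(1) by (intro image_eqI[of _ _ "cnj v"]) auto
    qed
  qed
qed

text \<open>Moves the boundary point of height \<open>\<eta>\<close> to the origin, where the
  Julia-Caratheodory limit is stated, without changing the image.\<close>

lemma half_plane_koenigs_shift:
  assumes "half_plane_koenigs H Q"
  shows "half_plane_koenigs (\<lambda>w. H (w + Complex 0 \<eta>)) (\<lambda>w. Q (w + Complex 0 \<eta>))"
    and "(\<lambda>w. H (w + Complex 0 \<eta>)) ` {w. Re w > 0} = H ` {w. Re w > 0}"
proof -
  interpret half_plane_koenigs H Q by fact
  show im: "(\<lambda>w. H (w + Complex 0 \<eta>)) ` {w. Re w > 0} = H ` {w. Re w > 0}"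
  proof (intro equalityI subsetI)
    fix p assume "p \<in> H ` {w. Re w > 0}"
    then obtain w where "Re w > 0" "p = H w" by auto
    then show "p \<in> (\<lambda>w. H (w + Complex 0 \<eta>)) ` {w. Re w > 0}"
      by (intro image_eqI[of _ _ "w - Complex 0 \<eta>"]) auto
  qed auto
  show "half_plane_koenigs (\<lambda>w. H (w + Complex 0 \<eta>)) (\<lambda>w. Q (w + Complex 0 \<eta>))"
  proof
    show "((\<lambda>w. H (w + Complex 0 \<eta>)) has_field_derivative Q (w + Complex 0 \<eta>)) (at w)" if "Re w > 0" for w
      using H_deriv[of "w + Complex 0 \<eta>"] that by (simp add: DERIV_shift)
    show "Re (Q (w + Complex 0 \<eta>)) \<ge> 0" if "Re w > 0" for w
      using Q_nonneg[of "w + Complex 0 \<eta>"] that by simp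
    show "inj_on (\<lambda>w. H (w + Complex 0 \<eta>)) {w. Re w > 0}"
    proof (rule inj_onI)
      fix v w assume "v \<in> {w. Re w > 0}" "w \<in> {w. Re w > 0}" "H (v + Complex 0 \<eta>) = H (w + Complex 0 \<eta>)"
      then have "v + Complex 0 \<eta> = w + Complex 0 \<eta>"
        using inj_onD[OF inj, of "v + Complex 0 \<eta>" "w + Complex 0 \<eta>"] by simp
      then show "v = w" by simp
    qed
    show "H (w + Complex 0 \<eta>) + of_real t \<in> (\<lambda>w. H (w + Complex 0 \<eta>)) ` {w. Re w > 0}"
      if "Re w > 0" "t \<ge> 0" for w t
      unfolding im using starlike[of "w + Complex 0 \<eta>" t] that by simp
  qed
qed

context half_plane_koenigs begin

lemma orbit_cont:
  assumes "\<And>t. t \<in> T \<Longrightarrow> Complex t c \<in> D"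
  shows "continuous_on T (\<lambda>t. G (Complex t c))"
  by (rule continuous_on_compose2[OF G_cont]) (use assms in \<open>auto simp: Complex_eq intro!: continuous_intros\<close>)

text \<open>Backwards in time the real part stays bounded by \<open>x0\<close>, so the escape
  happens in the imaginary part, whose sign is eventually constant by continuity. The upward case is
  reflected into the downward one.\<close>

lemma strip_of_orbit_to_infinity:
  assumes pos: "\<And>w. Re w > 0 \<Longrightarrow> Re (Q w) > 0"
    and ray: "\<And>t. t \<le> 0 \<Longrightarrow> Complex t c \<in> D"
    and lim: "filterlim (\<lambda>t. norm (G (Complex t c))) at_top at_bot"
  shows "\<exists>c1 c2. c1 < c2 \<and> {w. c1 < Im w \<and> Im w < c2} \<subseteq> D"
proof -
  define w where "w t = G (Complex t c)" for t
  define x0 where "x0 = Re (w 0)"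
  have X: "0 < Re (w t)" "Re (w t) \<le> x0" if "t \<le> 0" for t
    using Re_G_pos[OF ray[OF that]] Re_G_mono[of t 0 c] ray that by (auto simp: w_def x0_def)
  have Imbig: "\<forall>\<^sub>F t in at_bot. \<bar>Im (w t)\<bar> \<ge> B" for B
  proof -
    have "\<forall>\<^sub>F t in at_bot. norm (w t) \<ge> B + x0"
      using lim unfolding w_def filterlim_at_top by blast
    then show ?thesis using eventually_le_at_bot[of 0]
    proof eventually_elim
      case (elim t)
      then show ?case using X[of t] cmod_le[of "w t"] by simp
    qed
  qed
  from Imbig[of 1] obtain t1 where t1: "\<And>t. t \<le> t1 \<Longrightarrow> \<bar>Im (w t)\<bar> \<ge> 1" by (auto simp: eventually_at_bot_linorder)
  define t2 where "t2 = min t1 0"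
  have t2: "t2 \<le> 0" "\<And>t. t \<le> t2 \<Longrightarrow> \<bar>Im (w t)\<bar> \<ge> 1" using t1 by (auto simp: t2_def)
  have cont: "continuous_on {t..t2} (\<lambda>t. Im (w t))" for t
    unfolding w_def by (intro continuous_on_Im orbit_cont ray) (use t2 in auto)
  have sgn: "Im (w t) > 0 \<longleftrightarrow> Im (w t2) > 0" if t: "t \<le> t2" for t
  proof (rule ccontr)
    assume "\<not> ?thesis"
    then have "Im (w t) \<le> 0 \<and> 0 \<le> Im (w t2) \<or> Im (w t2) \<le> 0 \<and> 0 \<le> Im (w t)" by linarith
    then obtain s where "s \<le> t2" "Im (w s) = 0"
      using IVT'[of "\<lambda>t. Im (w t)" t 0 t2, OF _ _ t cont] IVT2'[of "\<lambda>t. Im (w t)" t2 0 t, OF _ _ t cont] by metis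
    then show False using t2(2)[of s] by simp
  qed
  show ?thesis
  proof (cases "Im (w t2) > 0")
    case False
    have "\<forall>\<^sub>F t in at_bot. Im (w t) \<le> B" for B
      using Imbig[of "- B"] Imbig[of 1] eventually_le_at_bot[of t2]
    proof eventually_elim
      case (elim t)
      then show ?case using sgn[of t] False by linarith
    qed
    then have "filterlim (\<lambda>t. Im (G (Complex t c))) at_bot at_bot"
      unfolding w_def filterlim_at_bot by blast
    then show ?thesis using strip_of_tangential_orbit_below[OF pos ray] by blast
  next
    case True
    interpret c: half_plane_koenigs "\<lambda>w. cnj (H (cnj w))" "\<lambda>w. cnj (Q (cnj w))"
      by (rule half_plane_koenigs_cnj) (rule half_plane_koenigs_axioms)
    have inD: "c.D = cnj ` D"
    proof (intro equalityI subsetI)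
      fix p assume "p \<in> cnj ` D"
      then obtain v where "Re v > 0" "p = cnj (H v)" by auto
      then show "p \<in> c.D" by (intro image_eqI[of _ _ "cnj v"]) auto
    qed auto
    have Gc: "c.G p = cnj (G (cnj p))" if "cnj p \<in> D" for p
    proof -
      have "c.G (cnj (H (cnj (cnj (G (cnj p)))))) = cnj (G (cnj p))"
        by (rule c.G_H) (use Re_G_pos[OF that] in simp)
      then show ?thesis using H_G[OF that] by simp
    qed
    have ray': "cnj (Complex t (- c)) \<in> D" if "t \<le> 0" for t
      using ray[OF that] by (simp add: complex_cnj)
    have G': "Im (c.G (Complex t (- c))) = - Im (w t)" if "t \<le> 0" for t
      using Gc[OF ray'[OF that]] by (simp add: complex_cnj w_def)
    have ev: "\<forall>\<^sub>F t in at_bot. Im (c.G (Complex t (- c))) \<le> B" for B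
      using Imbig[of "- B"] Imbig[of 1] eventually_le_at_bot[of t2] eventually_le_at_bot[of 0]
    proof eventually_elim
      case (elim t)
      then show ?case using sgn[of t] True G'[of t] by linarith
    qed
    have "\<exists>c1 c2. c1 < c2 \<and> {w. c1 < Im w \<and> Im w < c2} \<subseteq> c.D"
    proof (rule c.strip_of_tangential_orbit_below)
      show "Complex t (- c) \<in> c.D" if "t \<le> 0" for t
        unfolding inD using imageI[OF ray'[OF that], of cnj] by (simp only: complex_cnj_cnj)
      show "filterlim (\<lambda>t. Im (c.G (Complex t (- c)))) at_bot at_bot"
        using ev unfolding filterlim_at_bot by blast
      show "Re (cnj (Q (cnj w))) > 0" if "Re w > 0" for w using pos[of "cnj w"] that by simp
    qed
    then obtain c1 c2 where c12: "c1 < c2" "{w. c1 < Im w \<and> Im w < c2} \<subseteq> cnj ` D" unfolding inD by blast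
    have "v \<in> D" if "- c2 < Im v" "Im v < - c1" for v
    proof -
      have "cnj v \<in> cnj ` D" using c12(2) that by auto
      then show ?thesis by (metis complex_cnj_cancel_iff image_iff)
    qed
    then show ?thesis using c12(1) by (intro exI[of _ "- c2"] exI[of _ "- c1"]) auto
  qed
qed

text \<open>The point is that \<open>N\<close> does not depend on \<open>x\<close>: arbitrarily
  close to the axis, \<open>Re H\<close> is not low on the whole segment.\<close>

lemma Re_H_not_uniformly_low:
  assumes "\<alpha> < \<beta>"
  obtains N where "\<And>x. 0 < x \<Longrightarrow> x \<le> \<beta> - \<alpha> \<Longrightarrow> \<exists>y\<in>{\<alpha>..\<beta>}. Re (H (Complex x y)) \<ge> N"
proof -
  define r where "r = \<beta> - \<alpha>"
  have r: "r > 0" using assms by (simp add: r_def)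
  define C where "C = 126 * r\<^sup>2 * norm (Q (Complex r \<alpha>))"
  have "\<exists>y\<in>{\<alpha>..\<beta>}. Re (H (Complex x y)) \<ge> Re (H (Complex r \<alpha>)) - C / r" if x: "0 < x" "x \<le> r" for x
  proof -
    obtain y where y: "y \<in> {\<alpha>..\<beta>}" "(\<beta> - \<alpha>) * \<bar>Re (H (Complex x y) - H (Complex r \<alpha>))\<bar> \<le> C"
      using box_mean_value(2)[OF H_deriv Q_nonneg x, of \<alpha> \<alpha> \<beta>] assms unfolding C_def r_def by auto
    then have "\<bar>Re (H (Complex x y) - H (Complex r \<alpha>))\<bar> \<le> C / r"
      using r by (simp add: r_def field_simps)
    then show ?thesis using y(1) by (intro bexI[of _ y]) auto
  qed
  then show thesis using that by (simp add: r_def) blast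
qed

text \<open>An orbit oscillating between the heights \<open>\<alpha>\<close> and \<open>\<beta>\<close> while approaching the imaginary axis would
  make \<open>Re H\<close> uniformly small on a vertical segment close to the axis, which the box estimate excludes.\<close>

lemma no_backward_oscillation:
  assumes ray: "\<And>t. t \<le> 0 \<Longrightarrow> Complex t c \<in> D"
    and X0: "((\<lambda>t. Re (G (Complex t c))) \<longlongrightarrow> 0) at_bot"
    and ab: "\<alpha> < \<beta>"
    and low: "\<exists>\<^sub>F t in at_bot. Im (G (Complex t c)) \<le> \<alpha>"
    and high: "\<exists>\<^sub>F t in at_bot. Im (G (Complex t c)) \<ge> \<beta>"
  shows False
proof -
  define w where "w t = G (Complex t c)" for t
  obtain N where N: "\<And>x. 0 < x \<Longrightarrow> x \<le> \<beta> - \<alpha> \<Longrightarrow> \<exists>y\<in>{\<alpha>..\<beta>}. Re (H (Complex x y)) \<ge> N"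
    using Re_H_not_uniformly_low[OF ab] by blast
  have "\<forall>\<^sub>F t in at_bot. Re (w t) < \<beta> - \<alpha>"
    using order_tendstoD(2)[OF X0, of "\<beta> - \<alpha>"] ab by (simp add: w_def)
  then obtain t1 where t1: "\<And>t. t \<le> t1 \<Longrightarrow> Re (w t) < \<beta> - \<alpha>" by (auto simp: eventually_at_bot_linorder)
  define T where "T = min t1 (min 0 (N - 1))"
  have T: "T \<le> t1" "T \<le> 0" "T < N" by (auto simp: T_def)
  obtain a where a: "a \<le> T" "Im (w a) \<le> \<alpha>"
    using low eventually_le_at_bot[of T] unfolding w_def by (metis (mono_tags, lifting) eventually_mono frequently_def)
  obtain b where b: "b \<le> T" "Im (w b) \<ge> \<beta>"
    using high eventually_le_at_bot[of T] unfolding w_def by (metis (mono_tags, lifting) eventually_mono frequently_def)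
  have cont: "continuous_on {s..t} (\<lambda>t. Im (w t))" if "t \<le> 0" for s t
    unfolding w_def by (intro continuous_on_Im orbit_cont ray) (use that in auto)
  \<comment> \<open>At the earlier of the two times the real part is least. Every height
    \<open>y\<close> between \<open>\<alpha>\<close> and \<open>\<beta>\<close> is crossed at some
    later time \<open>t\<close>, further to the right and with \<open>t < N\<close>; since
    \<open>Re H = t\<close> there, monotonicity along the horizontal line gives
    \<open>Re H < N\<close> at abscissa \<open>Re (w m)\<close>, too.\<close>
  define m where "m = min a b"
  have m: "m \<le> T" "m \<le> 0" using a b T by (auto simp: m_def)
  have cross: "\<exists>t. m \<le> t \<and> t \<le> T \<and> Im (w t) = y" if y: "y \<in> {\<alpha>..\<beta>}" for y
  proof (cases "a \<le> b")
    case True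
    then show ?thesis using IVT'[of "\<lambda>t. Im (w t)" a y b, OF _ _ True cont] a b y T by (force simp: m_def)
  next
    case False
    then have ba: "b \<le> a" by simp
    show ?thesis using IVT2'[of "\<lambda>t. Im (w t)" a y b, OF _ _ ba cont] a b y T by (force simp: m_def)
  qed
  have mpos: "Re (w m) > 0" using Re_G_pos[OF ray[OF m(2)]] by (simp add: w_def)
  obtain y where y: "y \<in> {\<alpha>..\<beta>}" "Re (H (Complex (Re (w m)) y)) \<ge> N"
    using N[of "Re (w m)"] mpos t1[of m] m T by auto
  obtain t where t: "m \<le> t" "t \<le> T" "Im (w t) = y" using cross[OF y(1)] by blast
  have t0: "t \<le> 0" using t T by simp
  have "Re (w m) \<le> Re (w t)" unfolding w_def by (rule Re_G_mono) (use ray t t0 in auto)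
  then have "Re (H (Complex (Re (w m)) y)) \<le> Re (H (Complex (Re (w t)) y))"
    using Re_mono_horizontal[of H Q "Re (w m)" "Re (w t)" y] H_deriv Q_nonneg mpos by auto
  also have "Complex (Re (w t)) y = w t" using t(3) by (simp add: complex_eq_iff)
  also have "Re (H (w t)) = t" using H_G[OF ray[OF t0]] by (simp add: w_def)
  finally show False using y(2) t T by simp
qed

text \<open>Without escape there is a finite cluster point \<open>l\<close> for times tending to
  minus infinity. It is not interior, because \<open>Re H\<close> equals the time along the orbit.
  Hence the monotone real parts tend to 0, and nonconvergent imaginary parts would be the
  oscillation excluded above.\<close>

lemma backward_orbit_converges:
  assumes ray: "\<And>t. t \<le> 0 \<Longrightarrow> Complex t c \<in> D"
  shows "filterlim (\<lambda>t. norm (G (Complex t c))) at_top at_bot \<or>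
    (\<exists>\<eta>. ((\<lambda>t. G (Complex t c)) \<longlongrightarrow> Complex 0 \<eta>) at_bot)"
proof (rule disjCI)
  define w where "w t = G (Complex t c)" for t
  assume "\<not> (\<exists>\<eta>. ((\<lambda>t. G (Complex t c)) \<longlongrightarrow> Complex 0 \<eta>) at_bot)"
  then have nc: "\<not> (w \<longlongrightarrow> Complex 0 \<eta>) at_bot" for \<eta> unfolding w_def by blast
  have wpos: "Re (w t) > 0" "H (w t) = Complex t c" if "t \<le> 0" for t
    using Re_G_pos[OF ray[OF that]] H_G[OF ray[OF that]] by (auto simp: w_def)
  have mono: "Re (w s) \<le> Re (w t)" if "s \<le> t" "t \<le> 0" for s t
    unfolding w_def by (rule Re_G_mono) (use that ray in auto)
  show "filterlim (\<lambda>t. norm (G (Complex t c))) at_top at_bot"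
  proof (rule ccontr)
    assume "\<not> ?thesis"
    then obtain R where "\<not> (\<forall>\<^sub>F t in at_bot. norm (w t) \<ge> R)"
      unfolding filterlim_at_top w_def by blast
    then have "\<forall>n::nat. \<exists>t. t \<le> - real n \<and> norm (w t) < R"
      unfolding eventually_at_bot_linorder by (metis not_le)
    then obtain t where t: "\<And>n. t n \<le> - real n" "\<And>n. norm (w (t n)) < R" by metis
    have "\<forall>n. w (t n) \<in> cball 0 R" using t(2) by (simp add: less_imp_le)
    then obtain l k where lk: "strict_mono k" "((\<lambda>n. w (t n)) \<circ> k) \<longlonglongrightarrow> l"
      using compact_cball[of "0::complex" R] unfolding compact_def by metis
    have lim: "(\<lambda>n. w (t (k n))) \<longlonglongrightarrow> l" using lk(2) by (simp add: o_def)
    have tk: "filterlim (\<lambda>n. t (k n)) at_bot sequentially"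
    proof (rule filterlim_at_bot_mono)
      show "filterlim (\<lambda>n. - real n) at_bot sequentially"
        using filterlim_real_sequentially by (simp add: filterlim_uminus_at_top)
      have "t (k n) \<le> - real n" for n using t(1)[of "k n"] seq_suble[OF lk(1), of n] by linarith
      then show "\<forall>\<^sub>F n in sequentially. t (k n) \<le> - real n" by simp
    qed
    have tneg: "t (k n) \<le> 0" for n using t(1)[of "k n"] by linarith
    have Rel: "(\<lambda>n. Re (w (t (k n)))) \<longlonglongrightarrow> Re l" using lim by (rule tendsto_Re)
    have "Re l \<ge> 0"
      by (rule LIMSEQ_le_const[OF Rel]) (use wpos tneg in \<open>force intro: less_imp_le\<close>)
    moreover have "\<not> Re l > 0"
    proof
      assume "Re l > 0"
      then have "isCont H l" using H_deriv DERIV_isCont by blast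
      then have "(\<lambda>n. H (w (t (k n)))) \<longlonglongrightarrow> H l" using lim isCont_tendsto_compose by blast
      then have "(\<lambda>n. Re (H (w (t (k n))))) \<longlonglongrightarrow> Re (H l)" by (rule tendsto_Re)
      then have "(\<lambda>n. t (k n)) \<longlonglongrightarrow> Re (H l)" using wpos(2)[OF tneg] by simp
      then show False using tk not_tendsto_and_filterlim_at_infinity[of sequentially "\<lambda>n. t (k n)"]
        by (meson at_bot_le_at_infinity filterlim_mono order_refl sequentially_bot)
    qed
    ultimately have Rel0: "Re l = 0" by simp
    have X0: "((\<lambda>t. Re (w t)) \<longlongrightarrow> 0) at_bot"
    proof (rule tendstoI)
      fix e :: real assume "e > 0"
      then obtain n where n: "Re (w (t (k n))) < e"
        using order_tendstoD(2)[OF Rel, of e] Rel0 by (auto simp: eventually_sequentially)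
      show "\<forall>\<^sub>F s in at_bot. dist (Re (w s)) 0 < e"
        using eventually_le_at_bot[of "t (k n)"]
      proof eventually_elim
        case (elim s)
        then show ?case using mono[OF elim tneg] wpos(1)[of s] tneg[of n] n by auto
      qed
    qed
    define \<eta> where "\<eta> = Im l"
    have freq: "\<exists>\<^sub>F s in at_bot. \<bar>Im (w s) - \<eta>\<bar> < e" if "e > 0" for e
    proof (rule ccontr)
      assume "\<not> ?thesis"
      then have "\<forall>\<^sub>F s in at_bot. \<not> \<bar>Im (w s) - \<eta>\<bar> < e" by (simp add: not_frequently)
      then have "\<forall>\<^sub>F n in sequentially. \<not> \<bar>Im (w (t (k n))) - \<eta>\<bar> < e"
        using tk unfolding filterlim_iff by blast
      moreover have "\<forall>\<^sub>F n in sequentially. \<bar>Im (w (t (k n))) - \<eta>\<bar> < e"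
        using tendstoD[OF tendsto_Im[OF lim] that] by (simp add: dist_real_def \<eta>_def)
      ultimately have "\<forall>\<^sub>F n in sequentially. False" by eventually_elim simp
      then show False by simp
    qed
    have "((\<lambda>s. Im (w s)) \<longlongrightarrow> \<eta>) at_bot"
    proof (rule tendstoI, rule ccontr)
      fix e :: real assume e: "e > 0" and "\<not> (\<forall>\<^sub>F s in at_bot. dist (Im (w s)) \<eta> < e)"
      then have "\<exists>\<^sub>F s in at_bot. \<not> dist (Im (w s)) \<eta> < e" by (simp add: frequently_def)
      then have "\<exists>\<^sub>F s in at_bot. Im (w s) \<ge> \<eta> + e \<or> Im (w s) \<le> \<eta> - e"
        by (rule frequently_elim1) (auto simp: dist_real_def)
      then consider "\<exists>\<^sub>F s in at_bot. Im (w s) \<ge> \<eta> + e" | "\<exists>\<^sub>F s in at_bot. Im (w s) \<le> \<eta> - e"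
        by (auto simp: frequently_disj_iff)
      then show False
      proof cases
        case 1
        have "\<exists>\<^sub>F s in at_bot. \<bar>Im (w s) - \<eta>\<bar> < e / 2" using freq[OF half_gt_zero[OF e]] .
        then have "\<exists>\<^sub>F s in at_bot. Im (w s) \<le> \<eta> + e / 2" by (rule frequently_elim1) linarith
        then show False using no_backward_oscillation[OF ray X0[unfolded w_def], of "\<eta> + e / 2" "\<eta> + e"] 1 e
          by (auto simp: w_def)
      next
        case 2
        have "\<exists>\<^sub>F s in at_bot. \<bar>Im (w s) - \<eta>\<bar> < e / 2" using freq[OF half_gt_zero[OF e]] .
        then have "\<exists>\<^sub>F s in at_bot. Im (w s) \<ge> \<eta> - e / 2" by (rule frequently_elim1) linarith
        then show False using no_backward_oscillation[OF ray X0[unfolded w_def], of "\<eta> - e" "\<eta> - e / 2"] 2 e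
          by (auto simp: w_def)
      qed
    qed
    from tendsto_Complex[OF X0 this] show False using nc[of \<eta>] by simp
  qed
qed

text \<open>When \<open>r\<close> tends to 0, the right-hand side tends to 252 times the angular
  limit \<open>s\<close>, so \<open>s\<close> cannot vanish if \<open>c1 < c2\<close>. At a common
  abscissa both orbits are within \<open>r\<close> of height \<open>\<eta>\<close>; controlled
  heights are taken just above and just below this window, and monotonicity of \<open>Im H\<close>
  squeezes \<open>c1\<close> and \<open>c2\<close> between their values.\<close>

lemma pole_residue_lower_bound:
  assumes ray: "\<And>t. t \<le> 0 \<Longrightarrow> Complex t c1 \<in> D" "\<And>t. t \<le> 0 \<Longrightarrow> Complex t c2 \<in> D"
    and lim: "((\<lambda>t. G (Complex t c1)) \<longlongrightarrow> Complex 0 \<eta>) at_bot" "((\<lambda>t. G (Complex t c2)) \<longlongrightarrow> Complex 0 \<eta>) at_bot"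
    and r: "r > 0"
  shows "c2 - c1 \<le> 252 * r * norm (Q (Complex r \<eta>))"
proof -
  have near: "\<exists>t0\<le>0. \<forall>t\<le>t0. Re (G (Complex t c)) < r \<and> \<bar>Im (G (Complex t c)) - \<eta>\<bar> < r"
    if "((\<lambda>t. G (Complex t c)) \<longlongrightarrow> Complex 0 \<eta>) at_bot" for c
  proof -
    from tendstoD[OF that r] obtain t0 where t0: "\<And>t. t \<le> t0 \<Longrightarrow> dist (G (Complex t c)) (Complex 0 \<eta>) < r"
      by (auto simp: eventually_at_bot_linorder)
    have "Re (G (Complex t c)) < r \<and> \<bar>Im (G (Complex t c)) - \<eta>\<bar> < r" if "t \<le> min t0 0" for t
      using t0[of t] that abs_Re_le_cmod[of "G (Complex t c) - Complex 0 \<eta>"]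
        abs_Im_le_cmod[of "G (Complex t c) - Complex 0 \<eta>"] by (auto simp: dist_norm)
    then show ?thesis by (intro exI[of _ "min t0 0"]) auto
  qed
  obtain t1 where t1: "t1 \<le> 0" "\<And>t. t \<le> t1 \<Longrightarrow> Re (G (Complex t c1)) < r \<and> \<bar>Im (G (Complex t c1)) - \<eta>\<bar> < r"
    using near[OF lim(1)] by blast
  obtain t2 where t2: "t2 \<le> 0" "\<And>t. t \<le> t2 \<Longrightarrow> Re (G (Complex t c2)) < r \<and> \<bar>Im (G (Complex t c2)) - \<eta>\<bar> < r"
    using near[OF lim(2)] by blast
  \<comment> \<open>Both orbits still have to pass this abscissa on their way to the axis, and do so
    at times when they are already close to the limit.\<close>
  define x where "x = min (Re (G (Complex t1 c1))) (Re (G (Complex t2 c2)))"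
  have x: "0 < x" "x \<le> r" using Re_G_pos ray t1 t2 by (force simp: x_def)+
  have hit: "\<exists>t\<le>t0. Re (G (Complex t c)) = x"
    if ray: "\<And>t. t \<le> 0 \<Longrightarrow> Complex t c \<in> D" and lim: "((\<lambda>t. G (Complex t c)) \<longlongrightarrow> Complex 0 \<eta>) at_bot"
      and t0: "t0 \<le> 0" "x \<le> Re (G (Complex t0 c))" for c t0
  proof -
    have "((\<lambda>t. Re (G (Complex t c))) \<longlongrightarrow> 0) at_bot" using tendsto_Re[OF lim] by simp
    from order_tendstoD(2)[OF this x(1)] obtain s where s: "\<And>t. t \<le> s \<Longrightarrow> Re (G (Complex t c)) < x"
      by (auto simp: eventually_at_bot_linorder)
    have "continuous_on {min s t0..t0} (\<lambda>t. Re (G (Complex t c)))"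
      by (intro continuous_on_Re orbit_cont ray) (use t0 in auto)
    then show ?thesis using IVT'[of "\<lambda>t. Re (G (Complex t c))" "min s t0" x t0] s[of "min s t0"] t0 by force
  qed
  obtain a where a: "a \<le> t1" "Re (G (Complex a c1)) = x"
    using hit[OF ray(1) lim(1) t1(1)] by (auto simp: x_def)
  obtain b where b: "b \<le> t2" "Re (G (Complex b c2)) = x"
    using hit[OF ray(2) lim(2) t2(1)] by (auto simp: x_def)
  define y1 where "y1 = Im (G (Complex a c1))"
  define y2 where "y2 = Im (G (Complex b c2))"
  have "Complex x y1 = G (Complex a c1)" "Complex x y2 = G (Complex b c2)"
    using a b by (auto simp: y1_def y2_def complex_eq_iff)
  then have ImH: "Im (H (Complex x y1)) = c1" "Im (H (Complex x y2)) = c2"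
    using H_G ray a b t1 t2 by auto
  have y12: "\<bar>y1 - \<eta>\<bar> < r" "\<bar>y2 - \<eta>\<bar> < r" using t1(2)[OF a(1)] t2(2)[OF b(1)] by (auto simp: y1_def y2_def)
  define q where "q = 126 * r\<^sup>2 * norm (Q (Complex r \<eta>))"
  obtain y where y: "y \<in> {\<eta> + r..\<eta> + 2 * r}" "(\<eta> + 2 * r - (\<eta> + r)) * \<bar>Im (H (Complex x y) - H (Complex r \<eta>))\<bar> \<le> q"
    using box_mean_value(1)[OF H_deriv Q_nonneg x, of \<eta> "\<eta> + r" "\<eta> + 2 * r"] r unfolding q_def by auto
  obtain y' where y': "y' \<in> {\<eta> - 2 * r..\<eta> - r}" "(\<eta> - r - (\<eta> - 2 * r)) * \<bar>Im (H (Complex x y') - H (Complex r \<eta>))\<bar> \<le> q"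
    using box_mean_value(1)[OF H_deriv Q_nonneg x, of \<eta> "\<eta> - 2 * r" "\<eta> - r"] r unfolding q_def by auto
  have "c2 \<le> Im (H (Complex x y))" "Im (H (Complex x y')) \<le> c1"
    using Im_mono_vertical[of H Q x y2 y] Im_mono_vertical[of H Q x y' y1] H_deriv Q_nonneg x y y' y12 ImH by auto
  then have "c2 - c1 \<le> \<bar>Im (H (Complex x y) - H (Complex r \<eta>))\<bar> + \<bar>Im (H (Complex x y') - H (Complex r \<eta>))\<bar>" by simp
  then have "r * (c2 - c1) \<le> r * (\<bar>Im (H (Complex x y) - H (Complex r \<eta>))\<bar> + \<bar>Im (H (Complex x y') - H (Complex r \<eta>))\<bar>)"
    using r by (intro mult_left_mono) auto
  also have "\<dots> \<le> 2 * q" using y(2) y'(2) by (simp add: algebra_simps)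
  also have "\<dots> = r * (252 * r * norm (Q (Complex r \<eta>)))" by (simp add: q_def power2_eq_square)
  finally show ?thesis using r by (simp only: mult_le_cancel_left_pos)
qed

text \<open>Each point of the line at height \<open>c\<close> is the centre of a disc of fixed
  radius in the strip. Harnack's inequality for \<open>G\<close> at relative distance at most 1/2
  has the constant (1 + 1/2) / (1 - 1/2) = 3, and \<open>Re G\<close> tends to 0 along the
  line.\<close>

lemma orbit_limit_parallel:
  assumes strip: "{w. c1 < Im w \<and> Im w < c2} \<subseteq> D" and c: "c1 < c" "c < c2"
    and c': "\<bar>c' - c\<bar> \<le> min (c - c1) (c2 - c) / 2"
    and lim: "((\<lambda>t. G (Complex t c)) \<longlongrightarrow> Complex 0 \<eta>) at_bot"
  shows "((\<lambda>t. G (Complex t c')) \<longlongrightarrow> Complex 0 \<eta>) at_bot"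
proof -
  define d where "d = min (c - c1) (c2 - c)"
  have d: "d > 0" "\<bar>c' - c\<bar> \<le> d / 2" using c c' by (auto simp: d_def)
  have bd: "norm (G (Complex t c') - \<i> * Im (G (Complex t c))) \<le> 3 * Re (G (Complex t c))" for t
  proof -
    define R where "R \<xi> = G (Complex t c + of_real d * \<xi>)" for \<xi>
    have inD: "Complex t c + of_real d * \<xi> \<in> D" if "norm \<xi> < 1" for \<xi>
    proof -
      have "\<bar>d * Im \<xi>\<bar> < d" using d(1) that abs_Im_le_cmod[of \<xi>] by (simp add: abs_mult)
      then have "c1 < c + d * Im \<xi>" "c + d * Im \<xi> < c2" by (auto simp: d_def)
      then show ?thesis using strip by auto
    qed
    have Gh: "G holomorphic_on D" using G_deriv D_open by (auto simp: holomorphic_on_open)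
    have "R holomorphic_on ball 0 1" unfolding R_def
      using holomorphic_on_compose_gen[OF _ Gh, of "\<lambda>\<xi>. Complex t c + of_real d * \<xi>" "ball 0 1"] inD
      by (force simp: o_def intro!: holomorphic_intros)
    moreover have "Re (R \<xi>) \<ge> 0" if "norm \<xi> < 1" for \<xi>
      using Re_G_pos[OF inD[OF that]] by (simp add: R_def)
    moreover define \<xi> where "\<xi> = \<i> * of_real ((c' - c) / d)"
    moreover have n: "norm \<xi> \<le> 1 / 2" using d
      unfolding \<xi>_def norm_mult norm_ii norm_of_real by (simp add: field_simps)
    ultimately have "norm (R \<xi> - \<i> * Im (R 0)) * (1 - norm \<xi>) \<le> Re (R 0) * (1 + norm \<xi>)"
      by (intro harnack_disc) auto
    moreover have "norm (R \<xi> - \<i> * Im (R 0)) * (1 / 2) \<le> norm (R \<xi> - \<i> * Im (R 0)) * (1 - norm \<xi>)"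
      using n by (intro mult_left_mono) auto
    moreover have "Re (R 0) * (1 + norm \<xi>) \<le> Re (R 0) * (3 / 2)"
      using n Re_G_pos[OF inD[of 0]] by (intro mult_left_mono) (auto simp: R_def)
    moreover have "Complex t c + of_real d * \<xi> = Complex t c'" using d by (simp add: \<xi>_def complex_eq_iff)
    ultimately show ?thesis by (simp add: R_def)
  qed
  have "((\<lambda>t. G (Complex t c') - \<i> * Im (G (Complex t c))) \<longlongrightarrow> 0) at_bot"
  proof (rule Lim_null_comparison)
    show "\<forall>\<^sub>F t in at_bot. norm (G (Complex t c') - \<i> * Im (G (Complex t c))) \<le> 3 * Re (G (Complex t c))"
      using bd by simp
    show "((\<lambda>t. 3 * Re (G (Complex t c))) \<longlongrightarrow> 0) at_bot" using tendsto_mult_left[OF tendsto_Re[OF lim], of 3] by simp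
  qed
  moreover have "((\<lambda>t. \<i> * of_real (Im (G (Complex t c)))) \<longlongrightarrow> \<i> * of_real \<eta>) at_bot"
    using tendsto_mult_left[OF tendsto_of_real[OF tendsto_Im[OF lim]], of \<i>] by simp
  ultimately have "((\<lambda>t. (G (Complex t c') - \<i> * Im (G (Complex t c))) + \<i> * of_real (Im (G (Complex t c)))) \<longlongrightarrow> 0 + \<i> * of_real \<eta>) at_bot"
    by (rule tendsto_add)
  then show ?thesis by (simp add: Complex_eq)
qed

lemma angular_pole_of_strip:
  assumes strip: "{w. c1 < Im w \<and> Im w < c2} \<subseteq> D" and c: "c1 < c" "c < c2"
    and lim: "((\<lambda>t. G (Complex t c)) \<longlongrightarrow> Complex 0 \<eta>) at_bot"
  obtains s where "s > 0"
    "\<And>M e. M > 0 \<Longrightarrow> e > 0 \<Longrightarrow> \<exists>d>0. \<forall>w. Re w > 0 \<longrightarrow> norm w \<le> M * Re w \<longrightarrow> norm w \<le> d \<longrightarrow>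
       norm (w * Q (w + Complex 0 \<eta>) - of_real s) < e"
proof -
  interpret sh: half_plane_koenigs "\<lambda>w. H (w + Complex 0 \<eta>)" "\<lambda>w. Q (w + Complex 0 \<eta>)"
    using half_plane_koenigs_shift(1) half_plane_koenigs_axioms by blast
  obtain s where s: "s \<ge> 0"
    "\<And>M e. M > 0 \<Longrightarrow> e > 0 \<Longrightarrow> \<exists>d>0. \<forall>w. Re w > 0 \<longrightarrow> norm w \<le> M * Re w \<longrightarrow> norm w \<le> d \<longrightarrow>
       norm (w * Q (w + Complex 0 \<eta>) - of_real s) < e"
    using julia_caratheodory_zero[OF sh.Q_hol sh.Q_nonneg] by blast
  define d where "d = min (c - c1) (c2 - c) / 2"
  have d: "d > 0" using c by (simp add: d_def)
  have par: "((\<lambda>t. G (Complex t (c + x))) \<longlongrightarrow> Complex 0 \<eta>) at_bot" if "\<bar>x\<bar> \<le> d" for x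
    by (rule orbit_limit_parallel[OF strip c _ lim]) (use that in \<open>simp add: d_def\<close>)
  have ray: "Complex t (c + x) \<in> D" if "\<bar>x\<bar> \<le> d" for t x
    using that c strip by (force simp: d_def)
  have low: "2 * d \<le> 252 * r * norm (Q (Complex r \<eta>))" if "r > 0" for r
    using pole_residue_lower_bound[OF ray[of "- d"] ray[of d] par[of "- d"] par[of d] that] d by simp
  have "s \<noteq> 0"
  proof
    assume s0: "s = 0"
    \<comment> \<open>For \<open>s = 0\<close> the product of \<open>\<rho>\<close> and the norm of
      \<open>Q\<close> falls below \<open>d / 252\<close> on the normal, whereas the orbits at
      heights \<open>c - d\<close> and \<open>c + d\<close> force it to be at least
      \<open>2 * d / 252\<close>.\<close>
    obtain \<rho> where \<rho>: "\<rho> > 0" "\<And>w. Re w > 0 \<Longrightarrow> norm w \<le> 1 * Re w \<Longrightarrow> norm w \<le> \<rho> \<Longrightarrow>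
       norm (w * Q (w + Complex 0 \<eta>) - of_real s) < d / 252"
      using s(2)[of 1 "d / 252"] d by auto
    have "norm (of_real \<rho> * Q (of_real \<rho> + Complex 0 \<eta>) - of_real s) < d / 252"
      by (rule \<rho>(2)) (use \<rho>(1) in auto)
    moreover have "of_real \<rho> + Complex 0 \<eta> = Complex \<rho> \<eta>" by (simp add: complex_eq_iff)
    ultimately have "252 * \<rho> * norm (Q (Complex \<rho> \<eta>)) < d" using s0 \<rho>(1) by (simp add: norm_mult)
    then show False using low[OF \<rho>(1)] d by simp
  qed
  with s(1) have "s > 0" by simp
  then show thesis by (rule that[OF _ s(2)])
qed

end

section \<open>Semigroups of the disc and their generators\<close>

definition cayley :: "complex \<Rightarrow> complex" where "cayley z = (1 + z) / (1 - z)"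

definition icayley :: "complex \<Rightarrow> complex" where "icayley w = (w - 1) / (w + 1)"

lemma disc_ne_1: "z \<in> \<Delta> \<Longrightarrow> z \<noteq> 1" by auto

lemma rhp_ne_minus_1: "Re w > 0 \<Longrightarrow> w + 1 \<noteq> 0" by (auto simp: complex_eq_iff)

lemma Re_cayley: "z \<in> \<Delta> \<Longrightarrow> Re (cayley z) > 0"
  using Re_moebius_disc_half_plane[of 1 z] by (simp add: cayley_def)

lemma icayley_disc: "Re w > 0 \<Longrightarrow> icayley w \<in> \<Delta>"
  using moebius_half_plane_disc_inverse(1)[of w 1] by (simp add: icayley_def)

lemma cayley_icayley: "Re w > 0 \<Longrightarrow> cayley (icayley w) = w"
  using moebius_half_plane_disc_inverse(2)[of w 1] by (simp add: icayley_def cayley_def)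

lemma icayley_cayley: "z \<in> \<Delta> \<Longrightarrow> icayley (cayley z) = z"
  using disc_ne_1[of z] by (simp add: icayley_def cayley_def field_simps)

lemma one_minus_icayley: "Re w > 0 \<Longrightarrow> 1 - icayley w = 2 / (w + 1)"
  using rhp_ne_minus_1[of w] by (simp add: icayley_def field_simps)

lemma icayley_deriv: "Re w > 0 \<Longrightarrow> (icayley has_field_derivative 2 / (w + 1)\<^sup>2) (at w)"
  unfolding icayley_def using rhp_ne_minus_1[of w]
  by (auto intro!: derivative_eq_intros simp: power2_eq_square)

lemma cayley_deriv: "z \<in> \<Delta> \<Longrightarrow> (cayley has_field_derivative 2 / (1 - z)\<^sup>2) (at z)"
  unfolding cayley_def using disc_ne_1[of z]
  by (auto intro!: derivative_eq_intros simp: power2_eq_square)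

lemma cayley_hol: "cayley holomorphic_on \<Delta>"
  unfolding holomorphic_on_open[OF open_ball] using cayley_deriv by blast

lemma icayley_hol: "icayley holomorphic_on {w. Re w > 0}"
  unfolding holomorphic_on_open[OF open_rhp] using icayley_deriv by blast

lemma cayley_tendsto:
  assumes "(u \<longlongrightarrow> z) F" "z \<noteq> 1"
  shows "((\<lambda>t. cayley (u t)) \<longlongrightarrow> cayley z) F"
  unfolding cayley_def using assms by (intro tendsto_intros) auto

lemma icayley_tendsto:
  assumes "(u \<longlongrightarrow> w) F" "w \<noteq> - 1"
  shows "((\<lambda>t. icayley (u t)) \<longlongrightarrow> icayley w) F"
  unfolding icayley_def using assms by (intro tendsto_intros) (auto simp: add_eq_0_iff2)

text \<open>After squaring, the product of the two large norms cancels and the four real parts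
  remain as separate factors. This form survives the passage to infinity of one of the
  points.\<close>

lemma schwarz_pick_half_plane_product:
  assumes "R holomorphic_on {w. Re w > 0}" "\<And>w. Re w > 0 \<Longrightarrow> Re (R w) > 0"
    and a: "Re a > 0" and b: "Re b > 0"
  shows "Re a * Re b * (norm (R a + cnj (R b)))\<^sup>2 \<le> Re (R a) * Re (R b) * (norm (a + cnj b))\<^sup>2"
proof -
  have id: "(norm (x - y))\<^sup>2 = (norm (x + cnj y))\<^sup>2 - 4 * (Re x * Re y)" for x y :: complex
    by (simp add: cmod_power2) (simp add: power2_eq_square algebra_simps)
  have "(norm (R a - R b) * norm (a + cnj b))\<^sup>2 \<le> (norm (a - b) * norm (R a + cnj (R b)))\<^sup>2"
    by (intro power_mono schwarz_pick_half_plane assms) auto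
  then show ?thesis unfolding power_mult_distrib id by (simp add: algebra_simps)
qed

text \<open>A semigroup supplies only right derivatives in time, so the usual mean value theorem
  does not apply. Instead take the infimum \<open>c\<close> of the times violating the slope bound
  \<open>e * t\<close>: the bound holds at \<open>c\<close> by continuity, and the right derivative
  at \<open>c\<close> carries it further.\<close>

lemma right_derivative_zero_imp_constant:
  fixes \<phi> :: "real \<Rightarrow> 'a::real_normed_vector"
  assumes cont: "continuous_on {0..} \<phi>"
    and der: "\<And>t. t \<ge> 0 \<Longrightarrow> ((\<lambda>s. (\<phi> (t + s) - \<phi> t) /\<^sub>R s) \<longlongrightarrow> 0) (at_right 0)"
    and T: "T \<ge> 0"
  shows "\<phi> T = \<phi> 0"
proof -
  have bound: "norm (\<phi> T - \<phi> 0) \<le> e * T" if e: "e > 0" for e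
  proof (rule ccontr)
    assume T': "\<not> norm (\<phi> T - \<phi> 0) \<le> e * T"
    define g where "g t = norm (\<phi> t - \<phi> 0) - e * t" for t
    define B where "B = {t. 0 \<le> t \<and> g t > 0}"
    define c where "c = Inf B"
    have gcont: "continuous_on {0..} g" unfolding g_def by (intro continuous_intros cont)
    have TB: "T \<in> B" using T T' by (simp add: B_def g_def)
    have bdd: "bdd_below B" by (auto simp: B_def)
    have c0: "c \<ge> 0" unfolding c_def using TB by (intro cInf_greatest) (auto simp: B_def)
    have below: "g s \<le> 0" if "0 \<le> s" "s < c" for s
      using that cInf_lower[OF _ bdd, of s] unfolding c_def[symmetric] by (force simp: B_def)
    have gc: "g c \<le> 0"
    proof (rule ccontr)
      assume "\<not> g c \<le> 0"
      then have gc: "g c > 0" by simp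
      have "c \<noteq> 0" using gc by (auto simp: g_def)
      then have cpos: "c > 0" using c0 by simp
      obtain d where d: "d > 0" "\<And>s. s \<in> {0..} \<Longrightarrow> dist s c < d \<Longrightarrow> dist (g s) (g c) < g c"
        using gcont c0 gc unfolding continuous_on_iff by (metis atLeast_iff)
      define s where "s = max 0 (c - d / 2)"
      have s: "0 \<le> s" "s < c" "dist s c < d" using cpos d by (auto simp: s_def dist_real_def)
      then have "g s > 0" using d(2)[of s] by (auto simp: dist_real_def)
      then show False using below[OF s(1,2)] by simp
    qed
    have "\<forall>\<^sub>F s in at_right 0. norm ((\<phi> (c + s) - \<phi> c) /\<^sub>R s) < e"
      using tendstoD[OF der[OF c0] e] by (simp add: dist_norm)
    then obtain b where b: "b > 0" "\<And>s. 0 < s \<Longrightarrow> s < b \<Longrightarrow> norm ((\<phi> (c + s) - \<phi> c) /\<^sub>R s) < e"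
      unfolding eventually_at_right_field by auto
    obtain t where t: "t \<in> B" "t < c + b"
      using cInf_lessD[of B "c + b"] TB b(1) unfolding c_def by auto
    have "t \<ge> c" unfolding c_def by (rule cInf_lower[OF t(1) bdd])
    moreover have "t \<noteq> c" using t gc by (auto simp: B_def)
    ultimately have s: "0 < t - c" "t - c < b" using t by auto
    have "norm (\<phi> t - \<phi> c) / (t - c) < e" using b(2)[OF s] s by (simp add: divide_inverse mult.commute)
    then have "norm (\<phi> t - \<phi> c) < e * (t - c)" using s by (simp add: divide_less_eq)
    moreover have "norm (\<phi> t - \<phi> 0) \<le> norm (\<phi> t - \<phi> c) + norm (\<phi> c - \<phi> 0)"
      using norm_triangle_ineq[of "\<phi> t - \<phi> c" "\<phi> c - \<phi> 0"] by simp
    ultimately have "g t \<le> g c" by (simp add: g_def algebra_simps)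
    then show False using t gc by (simp add: B_def)
  qed
  have "norm (\<phi> T - \<phi> 0) \<le> 0"
  proof (rule field_le_epsilon)
    fix e :: real assume "e > 0"
    have "norm (\<phi> T - \<phi> 0) \<le> e / (T + 1) * T" by (rule bound) (use \<open>e > 0\<close> T in auto)
    also have "\<dots> \<le> e" using \<open>e > 0\<close> T by (simp add: field_simps)
    finally show "norm (\<phi> T - \<phi> 0) \<le> 0 + e" by simp
  qed
  then show ?thesis by simp
qed

section \<open>Time regularity of the semigroup and Wolff's lemma\<close>

locale semigroup_on_disc =
  fixes F :: "real \<Rightarrow> complex \<Rightarrow> complex"
  assumes semigroup: "continuous_semigroup F"
begin

lemma F_hol: "t \<ge> 0 \<Longrightarrow> F t holomorphic_on \<Delta>"
  and F_disc: "t \<ge> 0 \<Longrightarrow> z \<in> \<Delta> \<Longrightarrow> F t z \<in> \<Delta>"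
  and F_0: "z \<in> \<Delta> \<Longrightarrow> F 0 z = z"
  and F_add: "t \<ge> 0 \<Longrightarrow> s \<ge> 0 \<Longrightarrow> z \<in> \<Delta> \<Longrightarrow> F (t + s) z = F t (F s z)"
  and F_right: "z \<in> \<Delta> \<Longrightarrow> ((\<lambda>t. F t z) \<longlongrightarrow> z) (at_right 0)"
  using semigroup unfolding continuous_semigroup_def image_subset_iff by blast+

definition \<Phi> where "\<Phi> t w = cayley (F t (icayley w))"

lemma \<Phi>_pos: "t \<ge> 0 \<Longrightarrow> Re w > 0 \<Longrightarrow> Re (\<Phi> t w) > 0"
  unfolding \<Phi>_def by (intro Re_cayley F_disc icayley_disc)

lemma \<Phi>_hol: "t \<ge> 0 \<Longrightarrow> \<Phi> t holomorphic_on {w. Re w > 0}"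
proof -
  assume t: "t \<ge> 0"
  have "(F t \<circ> icayley) holomorphic_on {w. Re w > 0}"
    by (rule holomorphic_on_compose_gen[OF icayley_hol F_hol[OF t]]) (use icayley_disc in blast)
  then have "(cayley \<circ> (F t \<circ> icayley)) holomorphic_on {w. Re w > 0}"
    by (rule holomorphic_on_compose_gen[OF _ cayley_hol]) (use icayley_disc F_disc[OF t] in \<open>unfold o_def, blast\<close>)
  then show ?thesis by (simp add: o_def \<Phi>_def[abs_def])
qed

lemma \<Phi>_add: "t \<ge> 0 \<Longrightarrow> s \<ge> 0 \<Longrightarrow> Re w > 0 \<Longrightarrow> \<Phi> (t + s) w = \<Phi> t (\<Phi> s w)"
  unfolding \<Phi>_def using F_add icayley_disc icayley_cayley F_disc by simp

lemma \<Phi>_right: "Re w > 0 \<Longrightarrow> ((\<lambda>t. \<Phi> t w) \<longlongrightarrow> w) (at_right 0)"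
  using cayley_tendsto[OF F_right[OF icayley_disc]] disc_ne_1[OF icayley_disc] cayley_icayley
  unfolding \<Phi>_def by metis

text \<open>The definition gives continuity at 0 from the right only. By Schwarz-Pick,
  \<open>\<Phi> (t - h)\<close> does not increase the pseudo-hyperbolic distance, so
  \<open>\<Phi> t w\<close> and \<open>\<Phi> (t - h) w\<close> are no further apart than
  \<open>\<Phi> h w\<close> and \<open>w\<close>. Once that distance \<open>\<rho> h\<close> is
  below 1/2, it yields the Euclidean bound \<open>4 * \<rho> h * Re x\<close>.\<close>

lemma \<Phi>_left:
  assumes w: "Re w > 0" and t: "t > 0"
  shows "((\<lambda>h. \<Phi> (t - h) w) \<longlongrightarrow> \<Phi> t w) (at_right 0)"
proof -
  define x where "x = \<Phi> t w"
  define \<rho> where "\<rho> h = norm (\<Phi> h w - w) / norm (\<Phi> h w + cnj w)" for h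
  have x: "Re x > 0" using \<Phi>_pos t w by (simp add: x_def)
  have nz: "w + cnj w \<noteq> 0" using Re_pos_imp_add_cnj_nonzero[OF w w] .
  have "(\<rho> \<longlongrightarrow> norm (w - w) / norm (w + cnj w)) (at_right 0)"
    unfolding \<rho>_def using nz by (intro tendsto_intros \<Phi>_right w) auto
  then have \<rho>: "(\<rho> \<longlongrightarrow> 0) (at_right 0)" by simp
  have half: "\<forall>\<^sub>F h in at_right 0. \<rho> h < 1 / 2" by (rule order_tendstoD(2)[OF \<rho>]) simp
  have le: "\<forall>\<^sub>F h in at_right 0. norm (\<Phi> (t - h) w - x) \<le> 4 * \<rho> h * Re x"
    using half eventually_at_right_real[OF t]
  proof eventually_elim
    case (elim h)
    then have h: "0 < h" "h < t" "\<rho> h < 1 / 2" by auto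
    define y where "y = \<Phi> (t - h) w"
    have xy: "x = \<Phi> (t - h) (\<Phi> h w)" using \<Phi>_add[of "t - h" h w] h w by (simp add: x_def)
    have hp: "Re (\<Phi> h w) > 0" using \<Phi>_pos h w by simp
    have "norm (x - y) * norm (\<Phi> h w + cnj w) \<le> norm (\<Phi> h w - w) * norm (x + cnj y)"
      unfolding xy y_def by (rule schwarz_pick_half_plane[OF \<Phi>_hol \<Phi>_pos hp w]) (use h in auto)
    then have 1: "norm (x - y) \<le> \<rho> h * norm (x + cnj y)"
      using Re_pos_imp_add_cnj_nonzero[OF hp w] by (simp add: \<rho>_def field_simps)
    have "x + cnj y = of_real (2 * Re x) - cnj (x - y)" by (simp add: complex_eq_iff)
    then have 2: "norm (x + cnj y) \<le> 2 * Re x + norm (x - y)"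
      using norm_triangle_ineq4[of "of_real (2 * Re x)" "cnj (x - y)"] x by (simp del: of_real_mult complex_cnj_diff)
    have \<rho>0: "\<rho> h \<ge> 0" by (simp add: \<rho>_def)
    have "norm (x - y) \<le> \<rho> h * (2 * Re x) + \<rho> h * norm (x - y)"
      using 1 mult_left_mono[OF 2 \<rho>0] by (simp add: algebra_simps)
    moreover have "\<rho> h * norm (x - y) \<le> 1 / 2 * norm (x - y)" using h by (intro mult_right_mono) auto
    ultimately show "norm (\<Phi> (t - h) w - x) \<le> 4 * \<rho> h * Re x" by (simp add: y_def norm_minus_commute)
  qed
  have "((\<lambda>h. \<Phi> (t - h) w - x) \<longlongrightarrow> 0) (at_right 0)"
  proof (rule Lim_null_comparison[OF le])
    show "((\<lambda>h. 4 * \<rho> h * Re x) \<longlongrightarrow> 0) (at_right 0)"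
      using tendsto_mult_left[OF tendsto_mult_right[OF \<rho>, of "Re x"], of 4] by (simp add: mult.assoc)
  qed
  then show ?thesis using Lim_null x_def by blast
qed

lemma F_continuous:
  assumes z: "z \<in> \<Delta>"
  shows "continuous_on {0..} (\<lambda>t. F t z)"
  unfolding continuous_on_iff
proof (intro ballI allI impI)
  fix t e :: real assume t: "t \<in> {0..}" and e: "e > 0"
  have "\<forall>\<^sub>F s in at_right 0. dist (F s (F t z)) (F t z) < e"
    using tendstoD[OF F_right[OF F_disc] e] t z by simp
  then obtain b where b: "b > 0" "\<And>s. 0 < s \<Longrightarrow> s < b \<Longrightarrow> dist (F s (F t z)) (F t z) < e"
    unfolding eventually_at_right_field by auto
  have "\<exists>b'>0. \<forall>s. 0 < s \<and> s < b' \<and> s \<le> t \<longrightarrow> dist (F (t - s) z) (F t z) < e"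
  proof (cases "t = 0")
    case False
    then have t0: "t > 0" using t by simp
    define w where "w = cayley z"
    have w: "Re w > 0" "icayley w = z" using z Re_cayley icayley_cayley by (auto simp: w_def)
    have "((\<lambda>h. icayley (\<Phi> (t - h) w)) \<longlongrightarrow> icayley (\<Phi> t w)) (at_right 0)"
      by (rule icayley_tendsto[OF \<Phi>_left[OF w(1) t0]]) (use \<Phi>_pos[of t w] w(1) t0 in auto)
    from tendstoD[OF this e]
    obtain b' where b': "b' > 0" "\<And>s. 0 < s \<Longrightarrow> s < b' \<Longrightarrow> dist (icayley (\<Phi> (t - s) w)) (icayley (\<Phi> t w)) < e"
      unfolding eventually_at_right_field by auto
    have eq: "icayley (\<Phi> s w) = F s z" if "s \<ge> 0" for s
      unfolding \<Phi>_def w(2) using icayley_cayley F_disc that z by simp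
    have "dist (F (t - s) z) (F t z) < e" if "0 < s" "s < b'" "s \<le> t" for s
      using b'(2)[OF that(1,2)] eq[of "t - s"] eq[of t] t0 that by simp
    then show ?thesis using b' by blast
  qed (auto intro: exI[of _ 1])
  then obtain b' where b': "b' > 0" "\<And>s. 0 < s \<Longrightarrow> s < b' \<Longrightarrow> s \<le> t \<Longrightarrow> dist (F (t - s) z) (F t z) < e" by blast
  have "dist (F s z) (F t z) < e" if s: "s \<ge> 0" "dist s t < min b b'" for s
  proof -
    consider "s = t" | "s > t" | "s < t" by linarith
    then show ?thesis
    proof cases
      case 2
      then have "F s z = F (s - t) (F t z)" using F_add[of "s - t" t z] t z by simp
      then show ?thesis using b(2)[of "s - t"] 2 s by (simp add: dist_real_def)
    next
      case 3
      then show ?thesis using b'(2)[of "t - s"] s by (simp add: dist_real_def)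
    qed (use e in simp)
  qed
  then show "\<exists>d>0. \<forall>s\<in>{0..}. dist s t < d \<longrightarrow> dist (F s z) (F t z) < e"
    using b(1) b'(1) by (intro exI[of _ "min b b'"]) auto
qed

text \<open>Wolff's lemma: compare with the orbit \<open>b\<^sub>n\<close> of \<open>1\<close>, which tends to infinity.
  In the Schwarz-Pick inequality the quotient of the values of \<open>Re (1 / b)\<close> at consecutive points cannot
  stay above a constant exceeding 1, since these values are positive and tend to 0.\<close>

lemma horocycle_invariance:
  assumes lim: "((\<lambda>t. F t 0) \<longlongrightarrow> 1) at_top" and t: "t > 0" and a: "Re a > 0"
  shows "Re a \<le> Re (\<Phi> t a)"
proof (rule ccontr)
  assume "\<not> Re a \<le> Re (\<Phi> t a)"
  define a' where "a' = \<Phi> t a"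
  have a': "Re a' > 0" "Re a' < Re a" using \<Phi>_pos[of t a] t a \<open>\<not> _\<close> by (auto simp: a'_def)
  define b where "b n = \<Phi> (real n * t) 1" for n
  have bpos: "Re (b n) > 0" for n using \<Phi>_pos[of "real n * t" 1] t by (simp add: b_def)
  have bnz: "b n \<noteq> 0" for n using bpos[of n] by auto
  have bS: "b (Suc n) = \<Phi> t (b n)" for n
    using \<Phi>_add[of t "real n * t" 1] t by (simp add: b_def algebra_simps)
  have ib: "(\<lambda>n. 1 / b n) \<longlonglongrightarrow> 0"
  proof -
    have "filterlim (\<lambda>n. real n * t) at_top sequentially"
      using filterlim_at_top_mult_tendsto_pos[OF tendsto_const t filterlim_real_sequentially] by (simp add: mult.commute)
    then have "(\<lambda>n. F (real n * t) 0) \<longlonglongrightarrow> 1" using lim filterlim_compose by blast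
    then have "(\<lambda>n. (1 - F (real n * t) 0) / (1 + F (real n * t) 0)) \<longlonglongrightarrow> (1 - 1) / (1 + 1)"
      by (intro tendsto_intros) auto
    then show ?thesis by (simp add: b_def \<Phi>_def cayley_def icayley_def)
  qed
  define \<kappa> where "\<kappa> n = Re (b n) / (norm (b n))\<^sup>2" for n
  have \<kappa>pos: "\<kappa> n > 0" for n using bpos[of n] bnz[of n] by (simp add: \<kappa>_def)
  have "\<kappa> = (\<lambda>n. Re (1 / b n))" by (rule ext) (simp add: \<kappa>_def Re_divide cmod_power2)
  then have \<kappa>0: "\<kappa> \<longlonglongrightarrow> 0" using tendsto_Re[OF ib] by (simp only: zero_complex.sel)
  \<comment> \<open>Dividing the Schwarz-Pick inequality by the squared norms of \<open>b n\<close>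
    and \<open>b (Suc n)\<close> leaves \<open>x n\<close> and \<open>y n\<close>, which tend to 1
    because \<open>1 / b n\<close> tends to 0. So \<open>Re a' < Re a\<close> would make
    \<open>\<kappa>\<close>, the real part of \<open>1 / b n\<close>, eventually
    nondecreasing.\<close>
  define x where "x n = (norm (1 + cnj a' * (1 / b (Suc n))))\<^sup>2" for n
  define y where "y n = (norm (1 + cnj a * (1 / b n)))\<^sup>2" for n
  have "x \<longlonglongrightarrow> (norm (1 + cnj a' * 0))\<^sup>2" unfolding x_def by (intro tendsto_intros LIMSEQ_Suc[OF ib])
  moreover have "y \<longlonglongrightarrow> (norm (1 + cnj a * 0))\<^sup>2" unfolding y_def by (intro tendsto_intros ib)
  ultimately have "(\<lambda>n. Re a * x n - Re a' * y n) \<longlonglongrightarrow> Re a * (norm (1 + cnj a' * 0))\<^sup>2 - Re a' * (norm (1 + cnj a * 0))\<^sup>2"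
    by (intro tendsto_intros)
  then have "(\<lambda>n. Re a * x n - Re a' * y n) \<longlonglongrightarrow> Re a - Re a'" by simp
  from order_tendstoD(1)[OF this, of 0] obtain n0 where n0: "\<And>n. n \<ge> n0 \<Longrightarrow> Re a' * y n < Re a * x n"
    using a' by (auto simp: eventually_sequentially)
  have step: "\<kappa> n * (Re a * x n) \<le> \<kappa> (Suc n) * (Re a' * y n)" for n
  proof -
    have sp: "Re a * Re (b n) * (norm (a' + cnj (b (Suc n))))\<^sup>2 \<le> Re a' * Re (b (Suc n)) * (norm (a + cnj (b n)))\<^sup>2"
      unfolding a'_def bS by (rule schwarz_pick_half_plane_product[OF \<Phi>_hol \<Phi>_pos a bpos]) (use t in auto)
    have e: "(norm (c + cnj v))\<^sup>2 = (norm v)\<^sup>2 * (norm (1 + cnj c * (1 / v)))\<^sup>2" if "v \<noteq> 0" for c v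
    proof -
      have "norm (c + cnj v) = norm (cnj (c + cnj v))" by (rule complex_mod_cnj[symmetric])
      also have "cnj (c + cnj v) = v * (1 + cnj c * (1 / v))" using that by (simp add: field_simps)
      finally show ?thesis by (simp add: norm_mult power_mult_distrib)
    qed
    have "Re a * Re (b n) * ((norm (b (Suc n)))\<^sup>2 * x n) \<le> Re a' * Re (b (Suc n)) * ((norm (b n))\<^sup>2 * y n)"
      using sp unfolding e[OF bnz] x_def y_def .
    then show ?thesis using bnz[of n] bnz[of "Suc n"] by (simp add: \<kappa>_def field_simps)
  qed
  have mono: "\<kappa> n \<le> \<kappa> (Suc n)" if "n \<ge> n0" for n
  proof -
    have "y n \<ge> 0" by (simp add: y_def)
    then have xp: "Re a * x n > 0" using n0[OF that] a' by (smt (verit) mult_nonneg_nonneg)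
    have "\<kappa> n * (Re a * x n) \<le> \<kappa> (Suc n) * (Re a' * y n)" by (rule step)
    also have "\<dots> \<le> \<kappa> (Suc n) * (Re a * x n)" using n0[OF that] \<kappa>pos[of "Suc n"] by (intro mult_left_mono) auto
    finally show ?thesis by (rule mult_right_le_imp_le[OF _ xp])
  qed
  have "\<kappa> n0 \<le> \<kappa> n" if "n \<ge> n0" for n
    using that
  proof (induction n rule: dec_induct)
    case (step m)
    then show ?case using mono[of m] by simp
  qed simp
  then have "\<kappa> n0 \<le> 0" by (intro LIMSEQ_le_const[OF \<kappa>0]) auto
  then show False using \<kappa>pos[of n0] by simp
qed

end

section \<open>Holomorphy of the generator\<close>

locale generated_semigroup = semigroup_on_disc +
  fixes f :: "complex \<Rightarrow> complex"
  assumes generator: "is_generator f F"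
begin

lemma gen: "z \<in> \<Delta> \<Longrightarrow> ((\<lambda>t. (F t z - z) / of_real t) \<longlongrightarrow> - f z) (at_right 0)"
proof -
  assume "z \<in> \<Delta>"
  then have "((\<lambda>t. - ((z - F t z) / of_real t)) \<longlongrightarrow> - f z) (at_right 0)"
    using generator unfolding is_generator_def by (intro tendsto_minus) auto
  then show ?thesis by (simp add: minus_divide_left)
qed

text \<open>Caratheodory's form of the derivative, \<open>h y - h a = k y * (y - a)\<close>, avoids
  dividing by \<open>F s a - a\<close>, which may vanish.\<close>

lemma right_derivative_along_orbit:
  assumes h: "(h has_field_derivative h') (at (F t z))" and z: "z \<in> \<Delta>" and t: "t \<ge> 0"
  shows "((\<lambda>s. (h (F (t + s) z) - h (F t z)) / of_real s) \<longlongrightarrow> h' * - f (F t z)) (at_right 0)"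
proof -
  define a where "a = F t z"
  have a: "a \<in> \<Delta>" using F_disc t z by (simp add: a_def)
  obtain k where k: "\<And>y. h y - h a = k y * (y - a)" "isCont k a" "k a = h'"
    using h unfolding a_def[symmetric] CARAT_DERIV by blast
  have "((\<lambda>s. k (F s a)) \<longlongrightarrow> h') (at_right 0)"
    using isCont_tendsto_compose[OF k(2) F_right[OF a]] k(3) by simp
  from tendsto_mult[OF this gen[OF a]]
  have "((\<lambda>s. (h (F s a) - h a) / of_real s) \<longlongrightarrow> h' * - f a) (at_right 0)" by (simp add: k(1))
  then show ?thesis unfolding a_def[symmetric]
  proof (rule Lim_transform_eventually)
    show "\<forall>\<^sub>F s in at_right 0. (h (F s a) - h a) / of_real s = (h (F (t + s) z) - h a) / of_real s"
      using eventually_at_right_less[of 0]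
    proof eventually_elim
      case (elim s)
      then show ?case using F_add[of s t z] t z by (simp add: a_def add.commute)
    qed
  qed
qed

text \<open>The generator is only a pointwise limit of difference quotients. By Wolff's lemma these
  have nonnegative real part, so Harnack's inequality turns boundedness at the single point 1 into
  local boundedness, and Montel's theorem makes the limit holomorphic.\<close>

lemma generator_half_plane:
  assumes lim: "((\<lambda>t. F t 0) \<longlongrightarrow> 1) at_top"
  defines "P \<equiv> \<lambda>w. - f (icayley w) * (w + 1)\<^sup>2 / 2"
  shows "P holomorphic_on {w. Re w > 0}" "\<And>w. Re w > 0 \<Longrightarrow> Re (P w) \<ge> 0"
proof -
  define p where "p n w = (\<Phi> (1 / real (Suc n)) w - w) / of_real (1 / real (Suc n))" for n w
  have tn: "filterlim (\<lambda>n. 1 / real (Suc n)) (at_right 0) sequentially"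
    by (rule tendsto_imp_filterlim_at_right) (use LIMSEQ_inverse_real_of_nat in \<open>auto simp: inverse_eq_divide\<close>)
  have phol: "p n holomorphic_on {w. Re w > 0}" for n
    unfolding p_def by (intro holomorphic_intros \<Phi>_hol) auto
  have ppos: "Re (p n w) \<ge> 0" if "Re w > 0" for n w
  proof -
    have "Re w \<le> Re (\<Phi> (1 / real (Suc n)) w)" using horocycle_invariance[OF lim _ that] by simp
    then show ?thesis unfolding p_def Re_divide_of_real by simp
  qed
  have plim: "(\<lambda>n. p n w) \<longlonglongrightarrow> P w" if w: "Re w > 0" for w
  proof -
    define z where "z = icayley w"
    have z: "z \<in> \<Delta>" using icayley_disc w by (simp add: z_def)
    have "((\<lambda>s. (cayley (F (0 + s) z) - cayley (F 0 z)) / of_real s) \<longlongrightarrow> 2 / (1 - z)\<^sup>2 * - f (F 0 z)) (at_right 0)"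
      by (rule right_derivative_along_orbit) (use cayley_deriv[OF z] F_0[OF z] z in auto)
    then have "((\<lambda>s. (\<Phi> s w - w) / of_real s) \<longlongrightarrow> 2 / (1 - z)\<^sup>2 * - f z) (at_right 0)"
      using F_0[OF z] cayley_icayley[OF w] by (simp add: \<Phi>_def z_def)
    also have "2 / (1 - z)\<^sup>2 * - f z = P w"
      using one_minus_icayley[OF w] rhp_ne_minus_1[OF w] by (simp add: P_def z_def power_divide)
    finally show ?thesis unfolding p_def using filterlim_compose[OF _ tn] by fastforce
  qed
  have P: "Re (P w) \<ge> 0" if "Re w > 0" for w
    by (rule LIMSEQ_le_const[OF tendsto_Re[OF plim[OF that]]]) (use ppos that in auto)
  have "Bseq (\<lambda>n. p n 1)" using plim[of 1] by (simp add: convergent_imp_Bseq convergentI)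
  then obtain B where B: "\<And>n. norm (p n 1) \<le> B" by (auto simp: Bseq_def)
  have bounded: "\<exists>C. \<forall>h\<in>range p. \<forall>w\<in>K. norm (h w) \<le> C" if K: "compact K" "K \<subseteq> {w. Re w > 0}" for K
  proof -
    have "continuous_on K (\<lambda>w. B * (1 + (norm (w + cnj 1))\<^sup>2 / (Re w * Re 1)))"
      using K(2) by (intro continuous_intros) auto
    then have "bounded ((\<lambda>w. B * (1 + (norm (w + cnj 1))\<^sup>2 / (Re w * Re 1))) ` K)"
      using K(1) compact_continuous_image compact_imp_bounded by blast
    then obtain C where C: "\<And>w. w \<in> K \<Longrightarrow> norm (B * (1 + (norm (w + cnj 1))\<^sup>2 / (Re w * Re 1))) \<le> C"
      unfolding bounded_iff by blast
    have "norm (p n w) \<le> C" if w: "w \<in> K" for n w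
    proof -
      have wp: "Re w > 0" using K(2) w by auto
      have "norm (p n w) \<le> norm (p n 1) * (1 + (norm (w + cnj 1))\<^sup>2 / (Re w * Re 1))"
        by (rule harnack_half_plane_norm[OF phol ppos wp]) auto
      also have "\<dots> \<le> B * (1 + (norm (w + cnj 1))\<^sup>2 / (Re w * Re 1))"
        using B wp by (intro mult_right_mono) auto
      also have "\<dots> \<le> C" using C[OF w] by (metis abs_le_D1 real_norm_def)
      finally show ?thesis .
    qed
    then show ?thesis by blast
  qed
  obtain g r where g: "g holomorphic_on {w. Re w > 0}" "strict_mono (r :: nat \<Rightarrow> nat)"
    "\<And>w. w \<in> {w. Re w > 0} \<Longrightarrow> (\<lambda>n. p (r n) w) \<longlonglongrightarrow> g w"
    by (rule Montel[OF open_rhp, of "range p" p]) (use phol bounded in auto)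
  have "g w = P w" if "Re w > 0" for w
    using LIMSEQ_subseq_LIMSEQ[OF plim[OF that] g(2)] g(3)[of w] that LIMSEQ_unique by (auto simp: o_def)
  then show "P holomorphic_on {w. Re w > 0}" 
    using holomorphic_transform[OF g(1), of P] by auto
  show "\<And>w. Re w > 0 \<Longrightarrow> Re (P w) \<ge> 0" by (rule P)
qed

end

section \<open>Boundary regular null points and the Koenigs function\<close>

lemma Re_cayley_eq: "z \<noteq> 1 \<Longrightarrow> Re (cayley z) = (1 - (norm z)\<^sup>2) / (norm (1 - z))\<^sup>2"
proof -
  assume "z \<noteq> 1"
  have "cayley z = (1 + z) * (1 - cnj z) / of_real ((norm (1 - z))\<^sup>2)"
    unfolding cayley_def complex_div_cnj[of "1 + z" "1 - z"] by simp
  then have "Re (cayley z) = Re ((1 + z) * (1 - cnj z)) / (norm (1 - z))\<^sup>2"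
    by (metis Re_divide_of_real)
  moreover have "Re ((1 + z) * (1 - cnj z)) = 1 - (norm z)\<^sup>2"
    by (simp add: cmod_power2) (simp add: power2_eq_square algebra_simps)
  ultimately show ?thesis by simp
qed

lemma cayley_diff: "z \<noteq> 1 \<Longrightarrow> \<zeta> \<noteq> 1 \<Longrightarrow> cayley z - cayley \<zeta> = 2 * (z - \<zeta>) / ((1 - z) * (1 - \<zeta>))"
  by (simp add: cayley_def divide_simps) (simp add: algebra_simps)

lemma Re_cayley_lower:
  assumes "z \<in> \<Delta>"
  shows "1 - norm z \<le> Re (cayley z) * (norm (1 - z))\<^sup>2"
proof -
  have "(norm z)\<^sup>2 \<le> norm z" using assms by (simp add: power2_eq_square mult_left_le)
  then show ?thesis using disc_ne_1[OF assms] by (simp add: Re_cayley_eq)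
qed

text \<open>\<open>1 - norm z\<close> is at most \<open>Re (cayley z)\<close> times the square of
  \<open>norm (1 - z)\<close>; one of these two factors cancels against \<open>cayley_diff\<close>,
  the other is at most 2. So Stolz regions at a point \<open>\<zeta>\<close> of the circle go to
  sectors with vertex \<open>cayley \<zeta>\<close>.\<close>

lemma stolz_cayley:
  assumes z: "z \<in> \<Delta>" "dist z \<zeta> < M * (1 - norm z)" and \<zeta>: "\<zeta> \<noteq> 1"
  shows "norm (cayley z - cayley \<zeta>) \<le> 4 * M / norm (1 - \<zeta>) * Re (cayley z)"
proof -
  have nz: "norm (1 - z) > 0" "norm (1 - \<zeta>) > 0" using disc_ne_1[OF z(1)] \<zeta> by auto
  have M: "M > 0" using z by (smt (verit) dist_norm mem_ball_0 mult_nonpos_nonneg norm_ge_zero)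
  have "norm (1 - z) \<le> 2" using z norm_triangle_ineq4[of 1 z] by simp
  have "norm (cayley z - cayley \<zeta>) * (norm (1 - z) * norm (1 - \<zeta>)) = 2 * dist z \<zeta>"
  proof -
    have "z \<noteq> 1" "\<zeta> \<noteq> 1" using nz by auto
    then show ?thesis using nz unfolding cayley_diff[OF \<open>z \<noteq> 1\<close> \<open>\<zeta> \<noteq> 1\<close>] norm_mult norm_divide dist_norm
      by simp
  qed
  also have "\<dots> \<le> 2 * M * (1 - norm z)" using z(2) by simp
  also have "\<dots> \<le> 2 * M * (Re (cayley z) * (norm (1 - z))\<^sup>2)"
    using M Re_cayley_lower[OF z(1)] by (intro mult_left_mono) auto
  also have "\<dots> = 2 * M * Re (cayley z) * norm (1 - z) * norm (1 - z)" by (simp add: power2_eq_square)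
  also have "\<dots> \<le> 2 * M * Re (cayley z) * norm (1 - z) * 2"
    using M Re_cayley[OF z(1)] \<open>norm (1 - z) \<le> 2\<close> by (intro mult_left_mono) auto
  finally have "norm (1 - z) * (norm (cayley z - cayley \<zeta>) * norm (1 - \<zeta>)) \<le> norm (1 - z) * (4 * M * Re (cayley z))"
    by (simp add: algebra_simps)
  then have "norm (cayley z - cayley \<zeta>) * norm (1 - \<zeta>) \<le> 4 * M * Re (cayley z)"
    using nz(1) by (simp only: mult_le_cancel_left_pos)
  then show ?thesis using nz(2) by (simp add: field_simps)
qed

lemma stolz_cayley_1:
  assumes z: "z \<in> \<Delta>" "dist z 1 < M * (1 - norm z)"
  shows "norm (cayley z) \<le> 2 * M * Re (cayley z)"
proof -
  have nz: "norm (1 - z) > 0" using disc_ne_1[OF z(1)] by auto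
  have M: "M > 0" using z by (smt (verit) dist_norm mem_ball_0 mult_nonpos_nonneg norm_ge_zero)
  have "norm (1 + z) \<le> 2" using z norm_triangle_ineq[of 1 z] by simp
  have "norm (cayley z) * norm (1 - z) = norm (1 + z)"
    using nz by (simp add: cayley_def norm_divide)
  then have "norm (cayley z) * norm (1 - z) * norm (1 - z) \<le> 2 * norm (1 - z)"
    using \<open>norm (1 + z) \<le> 2\<close> by (intro mult_right_mono) auto
  also have "\<dots> \<le> 2 * M * (1 - norm z)" using z(2) by (simp add: dist_norm norm_minus_commute)
  also have "\<dots> \<le> 2 * M * (Re (cayley z) * (norm (1 - z))\<^sup>2)"
    using M Re_cayley_lower[OF z(1)] by (intro mult_left_mono) auto
  finally have "(norm (1 - z))\<^sup>2 * norm (cayley z) \<le> (norm (1 - z))\<^sup>2 * (2 * M * Re (cayley z))"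
    by (simp add: power2_eq_square algebra_simps)
  then show ?thesis using nz by (simp only: mult_le_cancel_left_pos zero_less_power)
qed

text \<open>Cauchy's estimate on discs of half the distance to the circle passes the angular limit
  from the difference quotient to the derivative. These discs may leave the Stolz region of aperture
  \<open>M\<close>, but they stay in the one of aperture \<open>2 * M + 1\<close>.\<close>

lemma boundary_regular_null_pointI:
  assumes f: "f holomorphic_on \<Delta>" and \<zeta>: "norm \<zeta> = 1"
    and lim: "\<And>M. M > 1 \<Longrightarrow>
      ((\<lambda>z. f z / (z - \<zeta>)) \<longlongrightarrow> L) (at \<zeta> within {z \<in> \<Delta>. dist z \<zeta> < M * (1 - norm z)})"
  shows "boundary_regular_null_point f \<zeta>"
proof -
  have "angular_limit f \<zeta> 0" unfolding angular_limit_def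
  proof (intro allI impI)
    fix M :: real assume M: "M > 1"
    let ?S = "{z \<in> \<Delta>. dist z \<zeta> < M * (1 - norm z)}"
    have "((\<lambda>z. f z / (z - \<zeta>) * (z - \<zeta>)) \<longlongrightarrow> L * (\<zeta> - \<zeta>)) (at \<zeta> within ?S)"
      by (intro tendsto_intros lim M)
    then have "((\<lambda>z. f z / (z - \<zeta>) * (z - \<zeta>)) \<longlongrightarrow> 0) (at \<zeta> within ?S)" by simp
    then show "(f \<longlongrightarrow> 0) (at \<zeta> within ?S)"
      by (rule Lim_transform_eventually) (auto simp: eventually_at intro!: exI[of _ 1])
  qed
  moreover have "angular_limit (deriv f) \<zeta> L" unfolding angular_limit_def
  proof (intro allI impI)
    fix M :: real assume M: "M > 1"
    define S where "S M = {z \<in> \<Delta>. dist z \<zeta> < M * (1 - norm z)}" for M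
    define E where "E z = f z - L * (z - \<zeta>)" for z
    have Ehol: "E holomorphic_on \<Delta>" unfolding E_def by (intro holomorphic_intros f)
    show "(deriv f \<longlongrightarrow> L) (at \<zeta> within {z \<in> \<Delta>. dist z \<zeta> < M * (1 - norm z)})"
      unfolding S_def[symmetric] tendsto_iff
    proof (intro allI impI)
      fix e :: real assume e: "e > 0"
      \<comment> \<open>The error \<open>E\<close> is at most
        \<open>e' * ((2 * M + 1) * \<rho>)\<close> on the circle around \<open>z\<close>; Cauchy's
        estimate divides by \<open>\<rho>\<close> and leaves \<open>e / 2\<close>.\<close>
      define e' where "e' = e / (2 * (2 * M + 1))"
      have e': "e' > 0" using e M by (simp add: e'_def)
      have "((\<lambda>z. f z / (z - \<zeta>)) \<longlongrightarrow> L) (at \<zeta> within S (2 * M + 1))"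
        unfolding S_def by (rule lim) (use M in simp)
      from tendstoD[OF this e'] obtain d where d: "d > 0"
        "\<And>z. z \<in> S (2 * M + 1) \<Longrightarrow> z \<noteq> \<zeta> \<Longrightarrow> dist z \<zeta> < d \<Longrightarrow> dist (f z / (z - \<zeta>)) L < e'"
        unfolding eventually_at by blast
      have "dist (deriv f z) L < e" if z: "z \<in> S M" "dist z \<zeta> < d / 2" for z
      proof -
        define \<rho> where "\<rho> = (1 - norm z) / 2"
        have zD: "norm z < 1" using z by (simp add: S_def)
        have \<rho>: "\<rho> > 0" using zD by (simp add: \<rho>_def)
        have z\<zeta>: "1 - norm z \<le> dist z \<zeta>"
          using norm_triangle_ineq2[of \<zeta> z] \<zeta> by (simp add: dist_norm norm_minus_commute)
        have "2 * \<rho> = 1 - norm z" by (simp add: \<rho>_def)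
        then have zM: "dist z \<zeta> < M * (2 * \<rho>)" using z by (simp add: S_def)
        have sub: "cball z \<rho> \<subseteq> \<Delta>"
        proof
          fix \<xi> assume "\<xi> \<in> cball z \<rho>"
          then have "norm \<xi> \<le> norm z + \<rho>" using norm_triangle_ineq2[of \<xi> z] by (simp add: dist_norm norm_minus_commute)
          then show "\<xi> \<in> \<Delta>" using zD by (simp add: \<rho>_def field_simps)
        qed
        have bd: "norm (E \<xi>) \<le> e' * ((2 * M + 1) * \<rho>)" if "norm (z - \<xi>) = \<rho>" for \<xi>
        proof -
          have n: "norm \<xi> \<le> norm z + \<rho>" using norm_triangle_ineq2[of \<xi> z] that by (simp add: norm_minus_commute)
          then have \<xi>1: "1 - norm \<xi> \<ge> \<rho>" by (simp add: \<rho>_def field_simps)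
          have tri: "dist \<xi> \<zeta> \<le> dist z \<zeta> + \<rho>" using dist_triangle[of \<xi> \<zeta> z] that by (simp add: dist_norm norm_minus_commute)
          also have "\<dots> < (2 * M + 1) * \<rho>" using zM by (simp add: algebra_simps)
          finally have 1: "dist \<xi> \<zeta> < (2 * M + 1) * \<rho>" .
          also have "\<dots> \<le> (2 * M + 1) * (1 - norm \<xi>)" using \<xi>1 M by (intro mult_left_mono) auto
          finally have "\<xi> \<in> S (2 * M + 1)" using \<xi>1 \<rho> by (simp add: S_def)
          moreover have ne: "\<xi> \<noteq> \<zeta>" using \<xi>1 \<rho> \<zeta> by auto
          moreover have "dist \<xi> \<zeta> < d"
          proof -
            have "\<rho> \<le> dist z \<zeta> / 2" using z\<zeta> by (simp add: \<rho>_def)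
            then have "dist \<xi> \<zeta> \<le> dist z \<zeta> + dist z \<zeta>" using tri zero_le_dist[of z \<zeta>] by linarith
            also have "\<dots> < d" using z(2) by simp
            finally show ?thesis .
          qed
          ultimately have "norm (f \<xi> / (\<xi> - \<zeta>) - L) < e'" using d(2) by (simp add: dist_norm)
          moreover have "E \<xi> = (f \<xi> / (\<xi> - \<zeta>) - L) * (\<xi> - \<zeta>)" using ne by (simp add: E_def field_simps)
          ultimately have "norm (E \<xi>) \<le> e' * dist \<xi> \<zeta>"
            by (simp add: norm_mult dist_norm mult_right_mono)
          also have "\<dots> \<le> e' * ((2 * M + 1) * \<rho>)" using 1 e' by (intro mult_left_mono) auto
          finally show ?thesis .
        qed
        have "norm ((deriv ^^ 1) E z) \<le> fact 1 * (e' * ((2 * M + 1) * \<rho>)) / \<rho> ^ 1"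
        proof (rule Cauchy_inequality[OF _ _ \<rho> bd])
          show "E holomorphic_on ball z \<rho>" 
            by (rule holomorphic_on_subset[OF Ehol]) (use sub ball_subset_cball[of z \<rho>] in blast)
          show "continuous_on (cball z \<rho>) E"
            using Ehol sub holomorphic_on_imp_continuous_on holomorphic_on_subset by blast
        qed
        also have "e' * ((2 * M + 1) * \<rho>) = e / 2 * \<rho>"
        proof -
          have "2 * M + 1 \<noteq> 0" using M by simp
          then have "e' * (2 * M + 1) = e / 2" unfolding e'_def by (metis nonzero_mult_divide_mult_cancel_right2 times_divide_eq_left mult.right_neutral mult.commute)
          then show ?thesis by (simp only: mult.assoc[symmetric])
        qed
        also have "fact 1 * (e / 2 * \<rho>) / \<rho> ^ 1 = e / 2" using \<rho> by simp
        finally have "norm (deriv E z) \<le> e / 2" by simp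
        moreover have "deriv E z = deriv f z - L"
        proof (rule DERIV_imp_deriv)
          have "(f has_field_derivative deriv f z) (at z)"
            by (rule holomorphic_derivI[OF f open_ball]) (use zD in simp)
          then show "(E has_field_derivative deriv f z - L) (at z)"
            unfolding E_def by (auto intro!: derivative_eq_intros)
        qed
        ultimately show ?thesis using e by (simp add: dist_norm)
      qed
      then show "\<forall>\<^sub>F z in at \<zeta> within S M. dist (deriv f z) L < e"
        unfolding eventually_at using d(1) by (intro exI[of _ "d / 2"]) auto
    qed
  qed
  ultimately show ?thesis unfolding boundary_regular_null_point_def using \<zeta> by auto
qed

section \<open>The Koenigs function and Abel's equation\<close>

lemma koenigs_deriv:
  assumes f: "f holomorphic_on \<Delta>" "\<And>z. z \<in> \<Delta> \<Longrightarrow> f z \<noteq> 0" and z: "z \<in> \<Delta>"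
  shows "(koenigs f has_field_derivative - 1 / f z) (at z)"
proof -
  have "(\<lambda>\<xi>. 1 / f \<xi>) holomorphic_on \<Delta>" using f by (intro holomorphic_intros)
  from holomorphic_convex_primitive'[OF convex_ball open_ball this]
  obtain g where g: "\<And>x. x \<in> \<Delta> \<Longrightarrow> (g has_field_derivative 1 / f x) (at x within \<Delta>)" by blast
  have eq: "koenigs f x = g 0 - g x" if x: "x \<in> \<Delta>" for x
  proof -
    have "path_image (linepath 0 x) \<subseteq> \<Delta>" 
      unfolding path_image_linepath by (rule closed_segment_subset) (use x in auto)
    from contour_integral_primitive[OF g valid_path_linepath this]
    have "contour_integral (linepath 0 x) (\<lambda>\<xi>. 1 / f \<xi>) = g x - g 0"
      by (simp add: contour_integral_unique)
    then show ?thesis by (simp add: koenigs_def)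
  qed
  have "(g has_field_derivative 1 / f z) (at z)" using g[OF z] z at_within_open[of z \<Delta>] by simp
  then have "((\<lambda>x. g 0 - g x) has_field_derivative 0 - 1 / f z) (at z)" by (intro DERIV_diff DERIV_const)
  then have "(koenigs f has_field_derivative 0 - 1 / f z) (at z)"
    by (rule has_field_derivative_transform_within_open[OF _ open_ball z]) (simp add: eq)
  then show ?thesis by simp
qed

lemma koenigs_0: "koenigs f 0 = 0"
  by (simp add: koenigs_def)

text \<open>The velocity field \<open>- f\<close> of the flow pushed forward by
  \<open>cayley\<close>, whose derivative \<open>2 / (1 - z)\<^sup>2\<close> equals
  \<open>(w + 1)\<^sup>2 / 2\<close> at \<open>z = icayley w\<close>.\<close>

definition half_plane_field :: "(complex \<Rightarrow> complex) \<Rightarrow> complex \<Rightarrow> complex" where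
  "half_plane_field f w = - f (icayley w) * (w + 1)\<^sup>2 / 2"

lemma half_plane_field_cayley:
  assumes "z \<in> \<Delta>" shows "f z = - half_plane_field f (cayley z) * (1 - z)\<^sup>2 / 2"
proof -
  have ne: "z \<noteq> 1" using assms by auto
  then have w: "cayley z + 1 = 2 / (1 - z)" by (simp add: cayley_def field_simps)
  have "(cayley z + 1)\<^sup>2 * (1 - z)\<^sup>2 = 4" unfolding w using ne by (simp add: power_divide)
  then show ?thesis using icayley_cayley[OF assms] by (simp add: half_plane_field_def algebra_simps)
qed

text \<open>The second alternative is the parabolic group, in the half-plane the translations by
  multiples of \<open>c\<close> along the imaginary axis. The value 0 is excluded because it would
  keep the orbit of 0 fixed instead of sending it to 1.\<close>

lemma (in generated_semigroup) generator_dichotomy: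
  assumes lim: "\<And>z. z \<in> \<Delta> \<Longrightarrow> ((\<lambda>t. F t z) \<longlongrightarrow> 1) at_top"
  shows "f holomorphic_on \<Delta>"
    and "(\<forall>w. Re w > 0 \<longrightarrow> Re (half_plane_field f w) > 0) \<or>
         (\<exists>c. c \<noteq> 0 \<and> Re c = 0 \<and> (\<forall>w. Re w > 0 \<longrightarrow> half_plane_field f w = c))"
proof -
  have lim0: "((\<lambda>t. F t 0) \<longlongrightarrow> 1) at_top" by (rule lim) simp
  have P: "half_plane_field f holomorphic_on {w. Re w > 0}" "\<And>w. Re w > 0 \<Longrightarrow> Re (half_plane_field f w) \<ge> 0"
    using generator_half_plane[OF lim0] unfolding half_plane_field_def[abs_def] by auto
  have "(half_plane_field f \<circ> cayley) holomorphic_on \<Delta>"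
    by (rule holomorphic_on_compose_gen[OF cayley_hol P(1)]) (use Re_cayley in blast)
  then have "(\<lambda>z. half_plane_field f (cayley z)) holomorphic_on \<Delta>" by (simp add: o_def)
  then have "(\<lambda>z. - half_plane_field f (cayley z) * (1 - z)\<^sup>2 / 2) holomorphic_on \<Delta>"
    by (intro holomorphic_intros) auto
  then show "f holomorphic_on \<Delta>"
    by (rule holomorphic_transform) (rule half_plane_field_cayley[symmetric])
  have "(\<forall>w\<in>{w. Re w > 0}. Re (half_plane_field f w) > 0) \<or> half_plane_field f constant_on {w. Re w > 0}"
    by (rule Re_nonneg_dichotomy[OF P(1) open_rhp convex_connected[OF convex_rhp]]) (use P(2) in auto)
  moreover {
    assume const: "half_plane_field f constant_on {w. Re w > 0}"
      and np: "\<not> (\<forall>w. Re w > 0 \<longrightarrow> Re (half_plane_field f w) > 0)"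
    then obtain c where c: "\<And>w. Re w > 0 \<Longrightarrow> half_plane_field f w = c" by (auto simp: constant_on_def)
    have "Re c = 0" using np c P(2) by force
    moreover have "c \<noteq> 0"
    proof
      assume "c = 0"
      then have f0: "f z = 0" if "z \<in> \<Delta>" for z
        using half_plane_field_cayley[OF that, of f] c[OF Re_cayley[OF that]] by simp
      have "F t 0 = F 0 0" if t: "t \<ge> 0" for t
      proof (rule right_derivative_zero_imp_constant[OF F_continuous _ t])
        fix s :: real assume s: "s \<ge> 0"
        have "((\<lambda>r. (F (s + r) 0 - F s 0) / of_real r) \<longlongrightarrow> 1 * - f (F s 0)) (at_right 0)"
          by (rule right_derivative_along_orbit) (use s in auto)
        then show "((\<lambda>r. (F (s + r) 0 - F s 0) /\<^sub>R r) \<longlongrightarrow> 0) (at_right 0)"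
          using f0[OF F_disc[OF s]] by (simp add: scaleR_conv_of_real divide_inverse mult.commute)
      qed simp
      then have "\<forall>\<^sub>F t in at_top. F t 0 = 0"
        using F_0[of 0] by (intro eventually_at_top_linorderI[of 0]) auto
      from Lim_transform_eventually[OF lim0 this] have "((\<lambda>t::real. 0 :: complex) \<longlongrightarrow> 1) at_top" .
      then show False using tendsto_const_iff[of "at_top :: real filter" "0 :: complex" 1] by simp
    qed
    ultimately have "\<exists>c. c \<noteq> 0 \<and> Re c = 0 \<and> (\<forall>w. Re w > 0 \<longrightarrow> half_plane_field f w = c)" using c by blast
  }
  ultimately show "(\<forall>w. Re w > 0 \<longrightarrow> Re (half_plane_field f w) > 0) \<or>
         (\<exists>c. c \<noteq> 0 \<and> Re c = 0 \<and> (\<forall>w. Re w > 0 \<longrightarrow> half_plane_field f w = c))" by blast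
qed

text \<open>Along an orbit the factors \<open>- 1 / f\<close> and \<open>- f\<close> cancel, so
  \<open>h\<close> has right derivative 1 in time.\<close>

lemma (in generated_semigroup) abel_equation:
  assumes h: "\<And>z. z \<in> \<Delta> \<Longrightarrow> (h has_field_derivative - 1 / f z) (at z)"
    and f: "\<And>z. z \<in> \<Delta> \<Longrightarrow> f z \<noteq> 0" and z: "z \<in> \<Delta>" and t: "t \<ge> 0"
  shows "h (F t z) = h z + of_real t"
proof -
  define \<phi> where "\<phi> t = h (F t z) - of_real t" for t :: real
  have hc: "continuous_on \<Delta> h"
    using h by (meson DERIV_isCont continuous_at_imp_continuous_on)
  have "\<phi> t = \<phi> 0"
  proof (rule right_derivative_zero_imp_constant[OF _ _ t])
    show "continuous_on {0..} \<phi>" unfolding \<phi>_def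
      by (intro continuous_intros continuous_on_compose2[OF hc F_continuous[OF z]]) (use F_disc z in blast)
    fix s :: real assume s: "s \<ge> 0"
    note D = F_disc[OF s z]
    have "((\<lambda>r. (h (F (s + r) z) - h (F s z)) / of_real r) \<longlongrightarrow> (- 1 / f (F s z)) * - f (F s z)) (at_right 0)"
      by (rule right_derivative_along_orbit[OF h[OF D] z s])
    from tendsto_diff[OF this tendsto_const[of 1]]
    have "((\<lambda>r. (h (F (s + r) z) - h (F s z)) / of_real r - 1) \<longlongrightarrow> 0) (at_right 0)"
      using f[OF D] by simp
    then show "((\<lambda>r. (\<phi> (s + r) - \<phi> s) /\<^sub>R r) \<longlongrightarrow> 0) (at_right 0)"
    proof (rule Lim_transform_eventually)
      show "\<forall>\<^sub>F r in at_right 0. (h (F (s + r) z) - h (F s z)) / of_real r - 1 = (\<phi> (s + r) - \<phi> s) /\<^sub>R r"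
        using eventually_at_right_less[of 0]
        by eventually_elim (simp add: \<phi>_def scaleR_conv_of_real field_simps)
    qed
  qed
  then show ?thesis using F_0[OF z] by (simp add: \<phi>_def algebra_simps)
qed

section \<open>Translation-invariant domains and the differential equation\<close>

text \<open>Normal forms of a group of translations: \<open>model a b \<circ> cayley\<close> maps the disc onto a horizontal
  strip (\<open>a \<noteq> 0\<close>) or half-plane (\<open>a = 0\<close>), and its derivative is the reciprocal of the
  coefficient in the differential equation, up to sign.\<close>

definition model :: "real \<Rightarrow> real \<Rightarrow> complex \<Rightarrow> complex" where
  "model a b w = (if a = 0 then \<i> * w / of_real (2 * b)
                  else Ln (w - \<i> * of_real (b / a)) / of_real (2 * a))"

definition model_range :: "real \<Rightarrow> real \<Rightarrow> complex set" where
  "model_range a b = (if a = 0 then {v. 0 < b * Im v} else {v. \<bar>Im v\<bar> < pi / (4 * \<bar>a\<bar>)})"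

definition model_coeff :: "real \<Rightarrow> real \<Rightarrow> complex \<Rightarrow> complex" where
  "model_coeff a b z = of_real a * (z\<^sup>2 - 1) + \<i> * of_real b * (1 - z)\<^sup>2"

text \<open>In the half-plane the field \<open>- model_coeff a b\<close> becomes the affine field
  \<open>2 * (a * w - \<i> * b)\<close>. It generates the dilations about
  \<open>\<i> * b / a\<close>, or vertical translations if \<open>a = 0\<close>: the automorphism
  groups that fix infinity.\<close>

lemma model_coeff_cayley:
  assumes "z \<in> \<Delta>"
  shows "model_coeff a b z = - (of_real a * cayley z - \<i> * of_real b) * (1 - z)\<^sup>2"
proof -
  have ne: "1 - z \<noteq> 0" using assms by auto
  have "cayley z * (1 - z)\<^sup>2 = (1 + z) * (1 - z)" using ne by (simp add: cayley_def power2_eq_square)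
  moreover have "- (of_real a * cayley z - \<i> * of_real b) * (1 - z)\<^sup>2
      = - (of_real a * (cayley z * (1 - z)\<^sup>2)) + \<i> * of_real b * (1 - z)\<^sup>2"
    by (simp add: algebra_simps)
  ultimately have "- (of_real a * cayley z - \<i> * of_real b) * (1 - z)\<^sup>2
      = - (of_real a * ((1 + z) * (1 - z))) + \<i> * of_real b * (1 - z)\<^sup>2" by metis
  then show ?thesis by (simp add: model_coeff_def power2_eq_square algebra_simps)
qed

lemma linear_nonzero:
  assumes "a \<noteq> 0 \<or> b \<noteq> 0" "Re w > 0"
  shows "of_real a * w - \<i> * of_real b \<noteq> 0"
  using assms by (auto simp: complex_eq_iff)

lemma model_coeff_nonzero:
  assumes "a \<noteq> 0 \<or> b \<noteq> 0" "z \<in> \<Delta>"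
  shows "model_coeff a b z \<noteq> 0"
  using linear_nonzero[OF assms(1) Re_cayley[OF assms(2)]] disc_ne_1[OF assms(2)]
  by (simp add: model_coeff_cayley[OF assms(2)])

lemma model_deriv:
  assumes ab: "a \<noteq> 0 \<or> b \<noteq> 0" and w: "Re w > 0"
  shows "(model a b has_field_derivative 1 / (2 * (of_real a * w - \<i> * of_real b))) (at w)"
proof (cases "a = 0")
  case True
  then have "b \<noteq> 0" using ab by simp
  have "((\<lambda>w. \<i> * w / of_real (2 * b)) has_field_derivative \<i> / of_real (2 * b)) (at w)"
    using \<open>b \<noteq> 0\<close> by (auto intro!: derivative_eq_intros)
  moreover have "\<i> / of_real (2 * b) = 1 / (2 * (of_real a * w - \<i> * of_real b))"
    using True \<open>b \<noteq> 0\<close> by (simp add: field_simps)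
  ultimately show ?thesis using True by (simp add: model_def[abs_def])
next
  case False
  define u where "u = w - \<i> * of_real (b / a)"
  have u: "Re u > 0" using w by (simp add: u_def)
  then have nn: "u \<notin> \<real>\<^sub>\<le>\<^sub>0" by (auto simp: complex_nonpos_Reals_iff)
  have "((\<lambda>w. Ln (w - \<i> * of_real (b / a)) / of_real (2 * a)) has_field_derivative inverse u / of_real (2 * a)) (at w)"
    using nn False unfolding u_def by (auto intro!: derivative_eq_intros)
  moreover have "inverse u / of_real (2 * a) = 1 / (2 * (of_real a * w - \<i> * of_real b))"
  proof -
    have "of_real a * u = of_real a * w - \<i> * of_real b" using False by (simp add: u_def field_simps)
    moreover have "u \<noteq> 0" using u by auto
    ultimately show ?thesis using False by (metis (no_types, lifting) divide_divide_eq_right inverse_eq_divide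
        mult.assoc mult.commute of_real_mult of_real_numeral divide_divide_eq_left)
  qed
  ultimately show ?thesis using False by (simp add: model_def[abs_def])
qed

lemma model_cayley_deriv:
  assumes ab: "a \<noteq> 0 \<or> b \<noteq> 0" and z: "z \<in> \<Delta>"
  shows "((\<lambda>z. model a b (cayley z)) has_field_derivative - 1 / model_coeff a b z) (at z)"
proof -
  have "((\<lambda>z. model a b (cayley z)) has_field_derivative
      1 / (2 * (of_real a * cayley z - \<i> * of_real b)) * (2 / (1 - z)\<^sup>2)) (at z)"
    using DERIV_chain[OF model_deriv[OF ab Re_cayley[OF z]] cayley_deriv[OF z]] by (simp add: o_def)
  moreover have "1 / (2 * (of_real a * cayley z - \<i> * of_real b)) * (2 / (1 - z)\<^sup>2) = - 1 / model_coeff a b z"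
    unfolding model_coeff_cayley[OF z] by (simp add: divide_simps)
  ultimately show ?thesis by simp
qed

lemma model_inj:
  assumes ab: "a \<noteq> 0 \<or> b \<noteq> 0"
  shows "inj_on (model a b) {w. Re w > 0}"
proof (rule inj_onI)
  fix v w assume vw: "v \<in> {w. Re w > 0}" "w \<in> {w. Re w > 0}" "model a b v = model a b w"
  show "v = w"
  proof (cases "a = 0")
    case True
    then show ?thesis using vw ab by (simp add: model_def)
  next
    case False
    then have "Ln (v - \<i> * of_real (b / a)) = Ln (w - \<i> * of_real (b / a))" using vw by (simp add: model_def)
    moreover have "v - \<i> * of_real (b / a) \<noteq> 0" "w - \<i> * of_real (b / a) \<noteq> 0"
      using vw by (auto simp: complex_eq_iff)
    ultimately have "v - \<i> * of_real (b / a) = w - \<i> * of_real (b / a)" by (metis exp_Ln)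
    then show ?thesis by simp
  qed
qed

text \<open>For \<open>a \<noteq> 0\<close> the shift along the axis preserves the half-plane, and
  the principal logarithm maps it onto the strip of half-width pi / 2; dividing by
  \<open>2 * a\<close> gives \<open>pi / (4 * \<bar>a\<bar>)\<close>.\<close>

lemma model_image:
  assumes ab: "a \<noteq> 0 \<or> b \<noteq> 0"
  shows "model a b ` {w. Re w > 0} = model_range a b"
proof (cases "a = 0")
  case True
  then have b: "b \<noteq> 0" using ab by simp
  have Im: "b * Im (model a b w) = Re w / 2" for w
    using True b by (simp add: model_def Im_divide_of_real del: of_real_mult)
  show ?thesis
  proof (intro equalityI subsetI)
    fix v assume "v \<in> model_range a b"
    then have "0 < b * Im v" using True by (simp add: model_range_def)
    moreover have "model a b (- \<i> * of_real (2 * b) * v) = v"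
      using True b by (simp add: model_def)
    moreover have "Re (- \<i> * of_real (2 * b) * v) = 2 * (b * Im v)" by simp
    ultimately show "v \<in> model a b ` {w. Re w > 0}" by (intro image_eqI[of _ _ "- \<i> * of_real (2 * b) * v"]) auto
  next
    fix v assume "v \<in> model a b ` {w. Re w > 0}"
    then obtain w where "Re w > 0" "v = model a b w" by auto
    then show "v \<in> model_range a b" using True Im[of w] by (simp add: model_range_def)
  qed
next
  case False
  show ?thesis
  proof (intro equalityI subsetI)
    fix v assume "v \<in> model a b ` {w. Re w > 0}"
    then obtain w where w: "Re w > 0" "v = model a b w" by auto
    define u where "u = w - \<i> * of_real (b / a)"
    have u: "Re u > 0" "u \<noteq> 0" using w by (auto simp: u_def complex_eq_iff)
    then have l: "\<bar>Im (Ln u)\<bar> < pi / 2" using Re_Ln_pos_lt[of u] by auto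
    have "v = Ln u / of_real (2 * a)" using w False by (simp add: model_def u_def)
    then have "\<bar>Im v\<bar> = \<bar>Im (Ln u)\<bar> / (2 * \<bar>a\<bar>)" by (simp add: Im_divide_of_real abs_mult del: of_real_mult)
    also have "\<dots> < pi / 2 / (2 * \<bar>a\<bar>)" using l False by (intro divide_strict_right_mono) auto
    finally show "v \<in> model_range a b" using False by (simp add: model_range_def)
  next
    fix v assume "v \<in> model_range a b"
    then have v: "\<bar>Im v\<bar> < pi / (4 * \<bar>a\<bar>)" using False by (simp add: model_range_def)
    define u where "u = exp (of_real (2 * a) * v)"
    have "\<bar>2 * a * Im v\<bar> = 2 * \<bar>a\<bar> * \<bar>Im v\<bar>" by (simp add: abs_mult)
    also have "\<dots> < 2 * \<bar>a\<bar> * (pi / (4 * \<bar>a\<bar>))" using v False by (intro mult_strict_left_mono) auto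
    also have "\<dots> = pi / 2" using False by simp
    finally have im: "\<bar>2 * a * Im v\<bar> < pi / 2" .
    then have "cos (2 * a * Im v) > 0" by (intro cos_gt_zero_pi) auto
    then have "Re u > 0" by (simp add: u_def Re_exp)
    moreover have "Ln u = of_real (2 * a) * v" unfolding u_def
      by (rule Ln_exp) (use im pi_gt_zero in \<open>auto simp: abs_less_iff\<close>)
    then have "model a b (u + \<i> * of_real (b / a)) = v" using False by (simp add: model_def)
    ultimately show "v \<in> model a b ` {w. Re w > 0}"
      by (intro image_eqI[of _ _ "u + \<i> * of_real (b / a)"]) auto
  qed
qed

lemma model_range_props:
  assumes ab: "a \<noteq> 0 \<or> b \<noteq> 0"
  shows "open (model_range a b)" "convex (model_range a b)" "model_range a b \<noteq> {}"
    and "v \<in> model_range a b \<Longrightarrow> v + of_real t \<in> model_range a b"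
proof -
  have "model_range a b = (if a = 0 then (if b > 0 then {v. Im v > 0} else {v. Im v < 0})
      else {v. Im v > - (pi / (4 * \<bar>a\<bar>))} \<inter> {v. Im v < pi / (4 * \<bar>a\<bar>)})"
    using ab by (auto simp: model_range_def zero_less_mult_iff)
  then show "open (model_range a b)" "convex (model_range a b)"
    by (auto intro!: open_Int convex_Int open_halfspace_Im_gt open_halfspace_Im_lt convex_halfspace_Im_gt convex_halfspace_Im_lt)
  show "model_range a b \<noteq> {}" 
    using imageI[of 1 "{w. Re w > 0}" "model a b"] unfolding model_image[OF ab] by auto
  show "v \<in> model_range a b \<Longrightarrow> v + of_real t \<in> model_range a b"
    by (auto simp: model_range_def split: if_splits)
qed

lemma contains_strip:
  assumes "horizontal_strip A \<or> horizontal_half_plane A"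
  obtains c1 c2 where "c1 < c2" "{w. c1 < Im w \<and> Im w < c2} \<subseteq> A"
proof -
  consider c1 c2 where "c1 < c2" "A = {w. c1 < Im w \<and> Im w < c2}"
    | c where "A = {w. c < Im w}" | c where "A = {w. Im w < c}"
    using assms unfolding horizontal_strip_def horizontal_half_plane_def by blast
  then show thesis
  proof cases
    case (2 c)
    then show ?thesis using that[of c "c + 1"] by auto
  next
    case (3 c)
    then show ?thesis using that[of "c - 1" c] by auto
  qed (use that in blast)
qed

text \<open>The facts about \<open>f\<close> are assumptions here because they are obtained from a
  semigroup known to tend to 1, while \<open>F\<close> is only known to have the same generator. The
  locale is instantiated with both.\<close>

locale koenigs_semigroup = generated_semigroup +
  assumes f_hol: "f holomorphic_on \<Delta>"
    and dichotomy: "(\<forall>w. Re w > 0 \<longrightarrow> Re (half_plane_field f w) > 0) \<or>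
         (\<exists>c. c \<noteq> 0 \<and> Re c = 0 \<and> (\<forall>w. Re w > 0 \<longrightarrow> half_plane_field f w = c))"
begin

abbreviation h where "h \<equiv> koenigs f"

lemma field_nz: "Re w > 0 \<Longrightarrow> half_plane_field f w \<noteq> 0"
  using dichotomy by force

lemma f_nz: "z \<in> \<Delta> \<Longrightarrow> f z \<noteq> 0"
  using field_nz[OF Re_cayley] half_plane_field_cayley[of z f] disc_ne_1[of z] by simp

lemma h_deriv: "z \<in> \<Delta> \<Longrightarrow> (h has_field_derivative - 1 / f z) (at z)"
  using koenigs_deriv f_hol f_nz by blast

lemma abel: "z \<in> \<Delta> \<Longrightarrow> t \<ge> 0 \<Longrightarrow> h (F t z) = h z + of_real t"
  using abel_equation h_deriv f_nz by blast

lemma half_plane_deriv: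
  assumes w: "Re w > 0"
  shows "((\<lambda>w. h (icayley w)) has_field_derivative 1 / half_plane_field f w) (at w)"
proof -
  have "((\<lambda>w. h (icayley w)) has_field_derivative - 1 / f (icayley w) * (2 / (w + 1)\<^sup>2)) (at w)"
    using DERIV_chain[OF h_deriv[OF icayley_disc[OF w]] icayley_deriv[OF w]] by (simp add: o_def)
  then show ?thesis by (simp add: half_plane_field_def)
qed

text \<open>Injectivity is the Noshiro-Warschawski criterion, rotated by the field value
  \<open>c\<close> itself if the field is an imaginary constant. Starlikeness is Abel's
  equation.\<close>

sublocale half_plane_koenigs "\<lambda>w. h (icayley w)" "\<lambda>w. 1 / half_plane_field f w"
proof
  show "((\<lambda>w. h (icayley w)) has_field_derivative 1 / half_plane_field f w) (at w)" if "Re w > 0" for w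
    by (rule half_plane_deriv[OF that])
  show "Re (1 / half_plane_field f w) \<ge> 0" if "Re w > 0" for w
    using dichotomy that by (fastforce simp: Re_divide)
  show "inj_on (\<lambda>w. h (icayley w)) {w. Re w > 0}"
  proof -
    consider "\<forall>w. Re w > 0 \<longrightarrow> Re (half_plane_field f w) > 0"
      | c where "c \<noteq> 0" "\<forall>w. Re w > 0 \<longrightarrow> half_plane_field f w = c" using dichotomy by blast
    then show ?thesis
    proof cases
      case 1
      show ?thesis
        by (rule inj_on_Re_deriv_pos[OF convex_rhp, of _ "\<lambda>w. 1 / half_plane_field f w" 1])
          (use 1 half_plane_deriv in \<open>auto simp: Re_divide intro!: divide_pos_pos simp: sum_power2_gt_zero_iff\<close>)
    next
      case (2 c)
      show ?thesis
        by (rule inj_on_Re_deriv_pos[OF convex_rhp, of _ "\<lambda>w. 1 / half_plane_field f w" c])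
          (use 2 half_plane_deriv in auto)
    qed
  qed
  show "h (icayley w) + of_real t \<in> (\<lambda>w. h (icayley w)) ` {w. Re w > 0}" if w: "Re w > 0" and t: "t \<ge> 0" for w t
  proof -
    define v where "v = cayley (F t (icayley w))"
    have "F t (icayley w) \<in> \<Delta>" using F_disc icayley_disc w t by blast
    then have "Re v > 0" "icayley v = F t (icayley w)" using Re_cayley icayley_cayley by (auto simp: v_def)
    then show ?thesis using abel[OF icayley_disc[OF w] t] by (intro image_eqI[of _ _ v]) auto
  qed
qed

section \<open>The inverse of the Koenigs function and the flow\<close>

lemma D_eq: "D = h ` \<Delta>"
proof (intro equalityI subsetI)
  fix p assume "p \<in> h ` \<Delta>"
  then obtain z where "z \<in> \<Delta>" "p = h z" by auto
  then show "p \<in> D" using Re_cayley[of z] icayley_cayley[of z] by (intro image_eqI[of _ _ "cayley z"]) auto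
next
  fix p assume "p \<in> D"
  then show "p \<in> h ` \<Delta>" using icayley_disc by blast
qed

definition g where "g p = icayley (G p)"

lemma g_h: "z \<in> \<Delta> \<Longrightarrow> g (h z) = z"
  using G_H[OF Re_cayley[of z]] icayley_cayley[of z] by (simp add: g_def)

lemma h_g: "p \<in> D \<Longrightarrow> h (g p) = p" and g_disc: "p \<in> D \<Longrightarrow> g p \<in> \<Delta>"
  using H_G Re_G_pos icayley_disc unfolding g_def by auto

lemma h_inj: "inj_on h \<Delta>"
  using g_h by (metis inj_onI)

lemma g_deriv: "p \<in> D \<Longrightarrow> (g has_field_derivative - f (g p)) (at p)"
proof -
  assume p: "p \<in> D"
  have "((\<lambda>p. icayley (G p)) has_field_derivative 2 / (G p + 1)\<^sup>2 * inverse (1 / half_plane_field f (G p))) (at p)"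
    using DERIV_chain[OF icayley_deriv[OF Re_G_pos[OF p]] G_deriv[OF p]] by (simp add: o_def)
  moreover have "2 / (G p + 1)\<^sup>2 * inverse (1 / half_plane_field f (G p)) = - f (g p)"
    using rhp_ne_minus_1[OF Re_G_pos[OF p]] by (simp add: half_plane_field_def g_def)
  ultimately show ?thesis by (simp add: g_def[abs_def])
qed

lemma g_hol: "g holomorphic_on D"
  unfolding holomorphic_on_open[OF D_open] using g_deriv by blast

lemma F_eq: "z \<in> \<Delta> \<Longrightarrow> t \<ge> 0 \<Longrightarrow> F t z = g (h z + of_real t)"
  using g_h[OF F_disc] abel by metis

lemma h_hol: "h holomorphic_on \<Delta>"
  unfolding holomorphic_on_open[OF open_ball] using h_deriv by blast

lemma koenigs_Sigma1:
  assumes lim: "\<And>z. z \<in> \<Delta> \<Longrightarrow> ((\<lambda>t. F t z) \<longlongrightarrow> 1) at_top"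
  shows "h \<in> Sigma1"
proof -
  have "h z + of_real t \<in> h ` \<Delta>" if "z \<in> \<Delta>" "t \<ge> 0" for z t
    using abel[OF that] F_disc[OF that(2,1)] by (metis image_eqI)
  moreover have "((\<lambda>t. inv_into \<Delta> h (h z + of_real t)) \<longlongrightarrow> 1) at_top" if z: "z \<in> \<Delta>" for z
  proof (rule Lim_transform_eventually[OF lim[OF z]])
    show "\<forall>\<^sub>F t in at_top. F t z = inv_into \<Delta> h (h z + of_real t)"
      using eventually_ge_at_top[of 0]
    proof eventually_elim
      case (elim t)
      then show ?case using inv_into_f_f[OF h_inj F_disc[OF elim z]] abel[OF z elim] by simp
    qed
  qed
  ultimately show ?thesis unfolding Sigma1_def using h_hol h_inj koenigs_0 by blast
qed

text \<open>Surjectivity of \<open>F t\<close> on \<open>\<Omega>\<close> makes the image of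
  \<open>\<Omega>\<close> under \<open>h\<close> invariant under translations to the left as well,
  so any ball in it sweeps out a strip.\<close>

lemma strip_of_automorphisms:
  assumes "\<Omega> \<noteq> {}" and op: "open \<Omega>" and sub: "\<Omega> \<subseteq> \<Delta>" and aut: "\<forall>t\<ge>0. automorphism_of \<Omega> (F t)"
  shows "\<exists>c1 c2. c1 < c2 \<and> {w. c1 < Im w \<and> Im w < c2} \<subseteq> D"
proof -
  obtain z0 where z0: "z0 \<in> \<Omega>" using assms(1) by blast
  have "open (h ` \<Omega>)"
    using open_mapping_thm3[OF holomorphic_on_subset[OF h_hol sub] op inj_on_subset[OF h_inj sub]] .
  then obtain e where e: "e > 0" "ball (h z0) e \<subseteq> h ` \<Omega>" using z0 by (meson image_eqI open_contains_ball)
  have tr: "p + of_real t \<in> h ` \<Omega>" if p: "p \<in> h ` \<Omega>" for p t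
  proof -
    obtain z where z: "z \<in> \<Omega>" "p = h z" using p by auto
    show ?thesis
    proof (cases "t \<ge> 0")
      case True
      then have "F t z \<in> \<Omega>" using aut z by (auto simp: automorphism_of_def bij_betw_def)
      then show ?thesis using abel[of z t] z sub True by (metis image_eqI subsetD)
    next
      case False
      then have "F (- t) ` \<Omega> = \<Omega>" using aut by (auto simp: automorphism_of_def bij_betw_def)
      then obtain x where x: "x \<in> \<Omega>" "z = F (- t) x" using z by (metis imageE)
      have "h z = h x + of_real (- t)" using abel[of x "- t"] x sub False by auto
      then have "p + of_real t = h x" using z by simp
      then show ?thesis using x by blast
    qed
  qed
  have "v \<in> D" if v: "Im (h z0) - e < Im v" "Im v < Im (h z0) + e" for v
  proof -
    define p where "p = Complex (Re (h z0)) (Im v)"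
    have "h z0 - p = \<i> * of_real (Im (h z0) - Im v)" by (simp add: p_def complex_eq_iff)
    then have "dist (h z0) p = \<bar>Im (h z0) - Im v\<bar>" by (simp add: dist_norm norm_mult del: of_real_diff)
    also have "\<dots> < e" using v by linarith
    finally have "p \<in> h ` \<Omega>" using e(2) by auto
    moreover have "v = p + of_real (Re v - Re (h z0))" by (simp add: p_def complex_eq_iff)
    ultimately have "v \<in> h ` \<Omega>" using tr by metis
    then show ?thesis using sub D_eq by blast
  qed
  then show ?thesis using e(1) by (intro exI[of _ "Im (h z0) - e"] exI[of _ "Im (h z0) + e"]) auto
qed

text \<open>Translation to the left inside \<open>A\<close> provides the holomorphic inverse
  \<open>k\<close> of \<open>F t\<close>. Convexity of \<open>A\<close> gives simple connectedness
  through the homeomorphism \<open>g\<close>.\<close>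

lemma BFID_of_translation_invariant:
  assumes A: "A \<noteq> {}" "open A" "convex A" "A \<subseteq> D" and tr: "\<And>p t. p \<in> A \<Longrightarrow> p + of_real t \<in> A"
  shows "BFID F {z \<in> \<Delta>. h z \<in> A}"
proof -
  define \<Omega> where "\<Omega> = {z \<in> \<Delta>. h z \<in> A}"
  have \<Omega>g: "\<Omega> = g ` A"
  proof (intro equalityI subsetI)
    fix z assume "z \<in> \<Omega>"
    then show "z \<in> g ` A" using g_h[of z] by (intro image_eqI[of _ _ "h z"]) (auto simp: \<Omega>_def)
  next
    fix z assume "z \<in> g ` A"
    then show "z \<in> \<Omega>" using A(4) g_disc h_g unfolding \<Omega>_def by auto
  qed
  have hc: "continuous_on \<Delta> h" using h_hol holomorphic_on_imp_continuous_on by blast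
  have "\<Omega> = \<Delta> \<inter> h -` A" by (auto simp: \<Omega>_def)
  then have op: "open \<Omega>" using continuous_open_preimage[OF hc open_ball A(2)] by simp
  have gh: "g holomorphic_on A" using g_hol A(4) holomorphic_on_subset by blast
  have "homeomorphism A \<Omega> g h"
    unfolding homeomorphism_def
  proof (intro conjI ballI)
    show "g ` A = \<Omega>" using \<Omega>g by simp
    show "continuous_on A g" using gh holomorphic_on_imp_continuous_on by blast
    show "continuous_on \<Omega> h" by (rule continuous_on_subset[OF hc]) (auto simp: \<Omega>_def)
    show "h ` \<Omega> = A" unfolding \<Omega>g using h_g A(4) by (auto simp: image_image) (metis image_eqI subsetD)
  qed (use h_g A(4) g_h in \<open>auto simp: \<Omega>_def\<close>)
  then have "A homeomorphic \<Omega>" unfolding homeomorphic_def by blast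
  then have sc: "simply_connected \<Omega>"
    using homeomorphic_simply_connected_eq convex_imp_simply_connected A(3) by blast
  have "automorphism_of \<Omega> (F t)" if t: "t \<ge> 0" for t
  proof -
    define k where "k z = g (h z - of_real t)" for z
    have tr': "h z - of_real t \<in> A" if "z \<in> \<Omega>" for z
      using tr[of "h z" "- t"] that by (simp add: \<Omega>_def)
    have k: "k z \<in> \<Omega>" "F t (k z) = z" if z: "z \<in> \<Omega>" for z
    proof -
      show "k z \<in> \<Omega>" unfolding k_def \<Omega>g using tr'[OF z] by blast
      then have "F t (k z) = g (h (k z) + of_real t)" using F_eq t by (simp add: \<Omega>_def)
      also have "h (k z) = h z - of_real t"
        unfolding k_def by (rule h_g) (use tr'[OF z] A(4) in blast)
      also have "g (h z - of_real t + of_real t) = z" using g_h z by (simp add: \<Omega>_def)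
      finally show "F t (k z) = z" .
    qed
    have F: "F t z \<in> \<Omega>" "k (F t z) = z" if z: "z \<in> \<Omega>" for z
      using abel[of z t] F_disc[of t z] tr[of "h z" t] g_h[of z] z t by (auto simp: k_def \<Omega>_def)
    have bij: "bij_betw (F t) \<Omega> \<Omega>"
      by (rule bij_betw_byWitness[of _ k]) (use k F in auto)
    have "inv_into \<Omega> (F t) z = k z" if "z \<in> \<Omega>" for z
      using bij k[OF that] by (metis bij_betw_inv_into_left)
    moreover have "k holomorphic_on \<Omega>"
    proof -
      have "(\<lambda>z. h z - of_real t) holomorphic_on \<Omega>"
        by (intro holomorphic_intros holomorphic_on_subset[OF h_hol]) (auto simp: \<Omega>_def)
      from holomorphic_on_compose_gen[OF this gh] show ?thesis using tr' by (auto simp: o_def k_def[abs_def])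
    qed
    ultimately have "inv_into \<Omega> (F t) holomorphic_on \<Omega>" using holomorphic_transform by metis
    moreover have "F t holomorphic_on \<Omega>" by (rule holomorphic_on_subset[OF F_hol[OF t]]) (auto simp: \<Omega>_def)
    ultimately show ?thesis using bij by (simp add: automorphism_of_def)
  qed
  moreover have "\<Omega> \<noteq> {}" using A(1) \<Omega>g by simp
  ultimately show ?thesis using op sc unfolding BFID_def \<Omega>_def[symmetric] by (auto simp: \<Omega>_def)
qed

text \<open>Separation of variables: the equation says that \<open>h \<circ> \<phi>\<close> and
  \<open>model a b \<circ> cayley\<close> have the same derivative. The coefficient does not vanish
  identically because \<open>f\<close> has no zeros.\<close>

lemma solution_linearized:
  assumes sol: "nonconstant_solution f a b \<phi>"
  shows "a \<noteq> 0 \<or> b \<noteq> 0"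
    and "\<exists>k. \<forall>z\<in>\<Delta>. h (\<phi> z) = model a b (cayley z) + k"
proof -
  have \<phi>: "\<phi> holomorphic_on \<Delta>" "\<And>z. z \<in> \<Delta> \<Longrightarrow> \<phi> z \<in> \<Delta>"
    and eq: "\<And>z. z \<in> \<Delta> \<Longrightarrow> model_coeff a b z * deriv \<phi> z = f (\<phi> z)"
    using sol unfolding nonconstant_solution_def model_coeff_def by blast+
  show ab: "a \<noteq> 0 \<or> b \<noteq> 0"
    using eq[of 0] f_nz[OF \<phi>(2)[of 0]] by (auto simp: model_coeff_def)
  have "((\<lambda>z. h (\<phi> z) - model a b (cayley z)) has_field_derivative 0) (at z within \<Delta>)" if z: "z \<in> \<Delta>" for z
  proof -
    have "(\<phi> has_field_derivative deriv \<phi> z) (at z)" by (rule holomorphic_derivI[OF \<phi>(1) open_ball z])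
    from DERIV_chain[OF h_deriv[OF \<phi>(2)[OF z]] this]
    have "((\<lambda>z. h (\<phi> z)) has_field_derivative - 1 / f (\<phi> z) * deriv \<phi> z) (at z)" by (simp add: o_def)
    moreover have "- 1 / f (\<phi> z) * deriv \<phi> z = - 1 / model_coeff a b z"
      using eq[OF z] f_nz[OF \<phi>(2)[OF z]] model_coeff_nonzero[OF ab z] by (auto simp: field_simps)
    ultimately have "((\<lambda>z. h (\<phi> z)) has_field_derivative - 1 / model_coeff a b z) (at z)" by simp
    from DERIV_diff[OF this model_cayley_deriv[OF ab z]]
    show ?thesis by (simp add: has_field_derivative_at_within)
  qed
  then have "\<exists>k. \<forall>z\<in>\<Delta>. h (\<phi> z) - model a b (cayley z) = k"
    by (rule has_field_derivative_zero_constant[OF convex_ball])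
  then show "\<exists>k. \<forall>z\<in>\<Delta>. h (\<phi> z) = model a b (cayley z) + k" by (metis add.commute diff_add_cancel)
qed

lemma solution_BFID:
  assumes sol: "nonconstant_solution f a b \<phi>"
  shows "inj_on \<phi> \<Delta>" "BFID F (\<phi> ` \<Delta>)"
proof -
  have \<phi>: "\<And>z. z \<in> \<Delta> \<Longrightarrow> \<phi> z \<in> \<Delta>" using sol unfolding nonconstant_solution_def by blast
  note ab = solution_linearized(1)[OF sol]
  obtain k where k: "\<And>z. z \<in> \<Delta> \<Longrightarrow> h (\<phi> z) = model a b (cayley z) + k"
    using solution_linearized(2)[OF sol] by blast
  show "inj_on \<phi> \<Delta>"
  proof (rule inj_onI)
    fix x y assume xy: "x \<in> \<Delta>" "y \<in> \<Delta>" "\<phi> x = \<phi> y"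
    then have "model a b (cayley x) = model a b (cayley y)" using k[OF xy(1)] k[OF xy(2)] by simp
    then have "cayley x = cayley y" using inj_onD[OF model_inj[OF ab]] Re_cayley xy by blast
    then show "x = y" using icayley_cayley xy by metis
  qed
  \<comment> \<open>The image of \<open>h \<circ> \<phi>\<close> is a translate of a strip or
    half-plane, hence convex and invariant under horizontal translations.\<close>
  define A where "A = (+) k ` model_range a b"
  have A: "A = (\<lambda>z. h (\<phi> z)) ` \<Delta>"
  proof (intro equalityI subsetI)
    fix p assume "p \<in> A"
    then obtain w where w: "Re w > 0" "p = k + model a b w" unfolding A_def model_image[OF ab, symmetric] by auto
    then have "p = h (\<phi> (icayley w))" using k[OF icayley_disc[OF w(1)]] cayley_icayley[OF w(1)] by simp
    then show "p \<in> (\<lambda>z. h (\<phi> z)) ` \<Delta>" using icayley_disc[OF w(1)] by blast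
  next
    fix p assume "p \<in> (\<lambda>z. h (\<phi> z)) ` \<Delta>"
    then obtain z where z: "z \<in> \<Delta>" "p = h (\<phi> z)" by auto
    then have "p = k + model a b (cayley z)" using k by simp
    then show "p \<in> A" unfolding A_def model_image[OF ab, symmetric] using Re_cayley[OF z(1)] by blast
  qed
  have "BFID F {z \<in> \<Delta>. h z \<in> A}"
  proof (rule BFID_of_translation_invariant)
    show "A \<noteq> {}" "open A" "convex A"
      unfolding A_def using model_range_props(1-3)[OF ab] by (auto intro: open_translation convex_translation)
    show "A \<subseteq> D" unfolding A D_eq using \<phi> by auto
    show "p + of_real t \<in> A" if "p \<in> A" for p t
      using that model_range_props(4)[OF ab] unfolding A_def by (auto simp: add.assoc)
  qed
  moreover have "{z \<in> \<Delta>. h z \<in> A} = \<phi> ` \<Delta>"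
  proof (intro equalityI subsetI)
    fix z assume "z \<in> {z \<in> \<Delta>. h z \<in> A}"
    then obtain x where "z \<in> \<Delta>" "x \<in> \<Delta>" "h z = h (\<phi> x)" unfolding A by auto
    then show "z \<in> \<phi> ` \<Delta>" using inj_onD[OF h_inj] \<phi> by blast
  qed (use A \<phi> in auto)
  ultimately show "BFID F (\<phi> ` \<Delta>)" by simp
qed

lemma solution_of_strip:
  assumes c: "c1 < c2" and strip: "{w. c1 < Im w \<and> Im w < c2} \<subseteq> D"
  shows "\<exists>a b \<phi>. nonconstant_solution f a b \<phi>"
proof -
  \<comment> \<open>Chosen so that \<open>model_range a 0\<close> has half-width
    \<open>(c2 - c1) / 2\<close>; adding \<open>k\<close> centres it on the given strip.\<close>
  define a where "a = pi / (2 * (c2 - c1))"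
  define k where "k = Complex 0 ((c1 + c2) / 2)"
  have a: "a > 0" "pi / (4 * \<bar>a\<bar>) = (c2 - c1) / 2" using c by (auto simp: a_def field_simps)
  then have ab: "a \<noteq> 0 \<or> (0::real) \<noteq> 0" by simp
  define \<psi> where "\<psi> z = model a 0 (cayley z) + k" for z
  define \<phi> where "\<phi> z = g (\<psi> z)" for z
  have \<psi>: "\<psi> z \<in> D" if z: "z \<in> \<Delta>" for z
  proof -
    have "model a 0 (cayley z) \<in> model_range a 0"
      using model_image[OF ab] Re_cayley[OF z] by blast
    then have "\<bar>Im (model a 0 (cayley z))\<bar> < (c2 - c1) / 2" using a by (simp add: model_range_def)
    then have "Im (model a 0 (cayley z)) < (c2 - c1) / 2" "- Im (model a 0 (cayley z)) < (c2 - c1) / 2"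
      by (auto simp only: abs_less_iff)
    moreover have "Im (\<psi> z) = Im (model a 0 (cayley z)) + (c1 + c2) / 2" by (simp add: \<psi>_def k_def)
    ultimately have "c1 < Im (\<psi> z) \<and> Im (\<psi> z) < c2" by (simp add: field_simps)
    then show ?thesis using strip by blast
  qed
  have d: "(\<phi> has_field_derivative f (\<phi> z) / model_coeff a 0 z) (at z)" if z: "z \<in> \<Delta>" for z
  proof -
    have "(\<psi> has_field_derivative - 1 / model_coeff a 0 z) (at z)"
      unfolding \<psi>_def using DERIV_add[OF model_cayley_deriv[OF ab z] DERIV_const[of k]] by simp
    from DERIV_chain[OF g_deriv[OF \<psi>[OF z]] this] show ?thesis by (simp add: o_def \<phi>_def[abs_def])
  qed
  have inj: "inj_on \<phi> \<Delta>"
  proof (rule inj_onI)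
    fix x y assume xy: "x \<in> \<Delta>" "y \<in> \<Delta>" "\<phi> x = \<phi> y"
    then have "\<psi> x = \<psi> y" using h_g[OF \<psi>] unfolding \<phi>_def by metis
    then have "model a 0 (cayley x) = model a 0 (cayley y)" by (simp add: \<psi>_def)
    then have "cayley x = cayley y" using inj_onD[OF model_inj[OF ab]] Re_cayley xy by blast
    then show "x = y" using icayley_cayley xy by metis
  qed
  have "\<not> \<phi> constant_on \<Delta>"
  proof
    assume "\<phi> constant_on \<Delta>"
    then have "\<phi> 0 = \<phi> (1 / 2)" by (force simp: constant_on_def)
    then have "0 = (1 / 2 :: complex)" using inj_onD[OF inj, of 0 "1 / 2"] by simp
    then show False by simp
  qed
  moreover have "\<phi> holomorphic_on \<Delta>" unfolding holomorphic_on_open[OF open_ball] using d by blast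
  moreover have "\<phi> ` \<Delta> \<subseteq> \<Delta>" using g_disc[OF \<psi>] unfolding \<phi>_def by blast
  moreover have "model_coeff a 0 z * deriv \<phi> z = f (\<phi> z)" if "z \<in> \<Delta>" for z
    using DERIV_imp_deriv[OF d[OF that]] model_coeff_nonzero[OF ab that] by simp
  ultimately have "nonconstant_solution f a 0 \<phi>"
    unfolding nonconstant_solution_def model_coeff_def by blast
  then show ?thesis by blast
qed

end

section \<open>Regular null points and strips\<close>

lemma icayley_imaginary_axis:
  shows "norm (icayley (Complex 0 \<eta>)) = 1" "icayley (Complex 0 \<eta>) \<noteq> 1"
    "cayley (icayley (Complex 0 \<eta>)) = Complex 0 \<eta>"
proof -
  have ne: "Complex 0 \<eta> + 1 \<noteq> 0" by (simp add: complex_eq_iff)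
  have "norm (Complex 0 \<eta> - 1) = norm (Complex 0 \<eta> + 1)" by (simp add: cmod_def)
  then show "norm (icayley (Complex 0 \<eta>)) = 1" using ne by (simp add: icayley_def norm_divide)
  show ne1: "icayley (Complex 0 \<eta>) \<noteq> 1" using ne by (simp add: icayley_def divide_eq_eq)
  show "cayley (icayley (Complex 0 \<eta>)) = Complex 0 \<eta>"
    using ne by (simp add: icayley_def cayley_def divide_simps)
qed

lemma cayley_circle:
  assumes "norm \<zeta> = 1" "\<zeta> \<noteq> 1"
  shows "cayley \<zeta> = Complex 0 (Im (cayley \<zeta>))"
  using Re_cayley_eq[OF assms(2)] assms(1) by (simp add: complex_eq_iff)

context koenigs_semigroup begin

lemma field_hol: "half_plane_field f holomorphic_on {w. Re w > 0}"
proof -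
  have "(f \<circ> icayley) holomorphic_on {w. Re w > 0}"
    by (rule holomorphic_on_compose_gen[OF icayley_hol f_hol]) (use icayley_disc in blast)
  then have "(\<lambda>w. f (icayley w)) holomorphic_on {w. Re w > 0}" by (simp add: o_def)
  then show ?thesis unfolding half_plane_field_def[abs_def] by (intro holomorphic_intros) auto
qed

lemma field_nonneg: "Re w > 0 \<Longrightarrow> Re (half_plane_field f w) \<ge> 0"
  using dichotomy by (metis less_imp_le order_refl)

text \<open>\<open>f z / (z - 1)\<close> is \<open>half_plane_field f w / w\<close> at
  \<open>w = cayley z\<close>, times \<open>(1 + z) / 2\<close>, and the Julia-Caratheodory limit of
  the quotient at infinity always exists. Its value \<open>s\<close> may be 0.\<close>

lemma regular_null_point_1: "boundary_regular_null_point f 1"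
proof -
  obtain s where s: "\<And>M e. M > 0 \<Longrightarrow> e > 0 \<Longrightarrow> \<exists>B>0. \<forall>w. Re w > 0 \<longrightarrow> norm w \<le> M * Re w \<longrightarrow> norm w \<ge> B \<longrightarrow>
      norm (half_plane_field f w / w - of_real s) < e"
    using julia_caratheodory_infinity[OF field_hol field_nonneg] by blast
  show ?thesis
  proof (rule boundary_regular_null_pointI[OF f_hol, where L = "of_real s"])
    fix M :: real assume M: "M > 1"
    define S where "S = {z \<in> \<Delta>. dist z 1 < M * (1 - norm z)}"
    have "((\<lambda>z. half_plane_field f (cayley z) / cayley z) \<longlongrightarrow> of_real s) (at 1 within S)"
    proof (rule tendstoI)
      fix e :: real assume e: "e > 0"
      obtain B where B: "B > 0" "\<And>w. Re w > 0 \<Longrightarrow> norm w \<le> 2 * M * Re w \<Longrightarrow> norm w \<ge> B \<Longrightarrow>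
          norm (half_plane_field f w / w - of_real s) < e" using s[of "2 * M" e] M e by auto
      \<comment> \<open>Within distance \<open>d\<close> of 1 the numerator of
        \<open>cayley z\<close> has modulus at least 1 and the denominator less than
        \<open>1 / B\<close>.\<close>
      define d where "d = min 1 (1 / B)"
      have d: "d > 0" "d \<le> 1" "d * B \<le> 1" using B(1) by (auto simp: d_def field_simps min_def)
      have "dist (half_plane_field f (cayley z) / cayley z) (of_real s) < e" if z: "z \<in> S" "dist z 1 < d" for z
      proof -
        have zD: "z \<in> \<Delta>" "dist z 1 < M * (1 - norm z)" using z by (auto simp: S_def)
        have n: "norm (1 - z) < d" "norm (1 - z) > 0" using z(2) disc_ne_1[OF zD(1)] by (auto simp: dist_norm norm_minus_commute)
        have "1 + z = 2 - (1 - z)" by simp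
        then have "norm (1 + z) \<ge> 2 - norm (1 - z)" by (metis norm_numeral norm_triangle_ineq2)
        then have "norm (1 + z) \<ge> 1" using n d by linarith
        moreover have "B * norm (1 - z) \<le> B * d" using n B(1) by (intro mult_left_mono) auto
        ultimately have "B * norm (1 - z) \<le> norm (1 + z)" using d(3) by (simp add: mult.commute)
        then have "norm (cayley z) \<ge> B" using n(2) by (simp add: cayley_def norm_divide field_simps)
        then show ?thesis using B(2)[OF Re_cayley[OF zD(1)] stolz_cayley_1[OF zD]] by (simp add: dist_norm)
      qed
      then show "\<forall>\<^sub>F z in at 1 within S. dist (half_plane_field f (cayley z) / cayley z) (of_real s) < e"
        unfolding eventually_at using d(1) by blast
    qed
    then have "((\<lambda>z. half_plane_field f (cayley z) / cayley z * ((1 + z) / 2)) \<longlongrightarrow> of_real s * ((1 + 1) / 2)) (at 1 within S)"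
      by (intro tendsto_intros) auto
    then have lim: "((\<lambda>z. half_plane_field f (cayley z) / cayley z * ((1 + z) / 2)) \<longlongrightarrow> of_real s) (at 1 within S)" by simp
    show "((\<lambda>z. f z / (z - 1)) \<longlongrightarrow> of_real s) (at 1 within {z \<in> \<Delta>. dist z 1 < M * (1 - norm z)})"
      unfolding S_def[symmetric]
    proof (rule Lim_transform_eventually[OF lim])
      have "half_plane_field f (cayley z) / cayley z * ((1 + z) / 2) = f z / (z - 1)" if "z \<in> S" for z
      proof -
        have zD: "z \<in> \<Delta>" using that by (auto simp: S_def)
        have "z \<noteq> 1" "z \<noteq> - 1" using zD by auto
        then have ne: "1 - z \<noteq> 0" "1 + z \<noteq> 0" by (simp_all add: add_eq_0_iff)
        have "half_plane_field f (cayley z) / cayley z * ((1 + z) / 2) = half_plane_field f (cayley z) * (1 - z) / 2"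
          using ne by (simp add: cayley_def)
        moreover have "f z / (z - 1) = half_plane_field f (cayley z) * (1 - z) / 2"
        proof -
          have "f z = (z - 1) * (half_plane_field f (cayley z) * (1 - z) / 2)"
            using half_plane_field_cayley[OF zD, of f] by (simp add: power2_eq_square algebra_simps)
          then show ?thesis using ne by (metis nonzero_mult_div_cancel_left right_minus_eq)
        qed
        ultimately show ?thesis by simp
      qed
      then show "\<forall>\<^sub>F z in at 1 within S. half_plane_field f (cayley z) / cayley z * ((1 + z) / 2) = f z / (z - 1)"
        unfolding eventually_at by (intro exI[of _ 1]) auto
    qed
  qed simp
qed

text \<open>Inverting the positive limit \<open>s\<close> gives \<open>f\<close> the finite angular
  derivative \<open>- 1 / s\<close>. The negative sign means that the point repels the flow, as
  befits the limit of a backward trajectory.\<close>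

lemma regular_null_point_of_angular_pole:
  assumes \<zeta>: "norm \<zeta> = 1" "\<zeta> \<noteq> 1" "cayley \<zeta> = Complex 0 \<eta>" and s: "s > 0"
    and ang: "\<And>M e. M > 0 \<Longrightarrow> e > 0 \<Longrightarrow> \<exists>d>0. \<forall>w. Re w > 0 \<longrightarrow> norm w \<le> M * Re w \<longrightarrow> norm w \<le> d \<longrightarrow>
       norm (w * (1 / half_plane_field f (w + Complex 0 \<eta>)) - of_real s) < e"
  shows "boundary_regular_null_point f \<zeta>"
proof (rule boundary_regular_null_pointI[OF f_hol \<zeta>(1), where L = "- 1 / of_real s"])
  fix M :: real assume M: "M > 1"
  define S where "S = {z \<in> \<Delta>. dist z \<zeta> < M * (1 - norm z)}"
  define q where "q z = (cayley z - cayley \<zeta>) * (1 / half_plane_field f (cayley z))" for z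
  have n\<zeta>: "norm (1 - \<zeta>) > 0" using \<zeta>(2) by simp
  have "(q \<longlongrightarrow> of_real s) (at \<zeta> within S)"
  proof (rule tendstoI)
    fix e :: real assume e: "e > 0"
    define M' where "M' = 4 * M / norm (1 - \<zeta>)"
    have M': "M' > 0" using M n\<zeta> by (simp add: M'_def)
    obtain d where d: "d > 0" "\<And>w. Re w > 0 \<Longrightarrow> norm w \<le> M' * Re w \<Longrightarrow> norm w \<le> d \<Longrightarrow>
       norm (w * (1 / half_plane_field f (w + Complex 0 \<eta>)) - of_real s) < e" using ang[OF M' e] by blast
    have "((\<lambda>z. cayley z) \<longlongrightarrow> cayley \<zeta>) (at \<zeta> within S)" by (intro cayley_tendsto tendsto_ident_at \<zeta>)
    from tendstoD[OF this d(1)] have "\<forall>\<^sub>F z in at \<zeta> within S. dist (cayley z) (cayley \<zeta>) < d" .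
    moreover have "\<forall>\<^sub>F z in at \<zeta> within S. z \<in> S" unfolding eventually_at by (intro exI[of _ 1]) auto
    ultimately show "\<forall>\<^sub>F z in at \<zeta> within S. dist (q z) (of_real s) < e"
    proof eventually_elim
      case (elim z)
      then have zD: "z \<in> \<Delta>" "dist z \<zeta> < M * (1 - norm z)" by (auto simp: S_def)
      define w where "w = cayley z - cayley \<zeta>"
      have Rw: "Re w = Re (cayley z)" by (simp add: w_def \<zeta>(3))
      have "norm w \<le> M' * Re w" unfolding Rw unfolding w_def M'_def by (rule stolz_cayley[OF zD \<zeta>(2)])
      moreover have "norm w \<le> d" using elim by (simp add: w_def dist_norm)
      moreover have "w + Complex 0 \<eta> = cayley z" by (simp add: w_def \<zeta>(3))
      ultimately have "norm (w * (1 / half_plane_field f (cayley z)) - of_real s) < e"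
        using d(2)[of w] Re_cayley[OF zD(1)] Rw by simp
      then show ?case by (simp add: q_def w_def dist_norm)
    qed
  qed
  then have "((\<lambda>z. - ((1 - z) / (1 - \<zeta>)) / q z) \<longlongrightarrow> - ((1 - \<zeta>) / (1 - \<zeta>)) / of_real s) (at \<zeta> within S)"
    using s \<zeta>(2) by (intro tendsto_intros) auto
  then have lim: "((\<lambda>z. - ((1 - z) / (1 - \<zeta>)) / q z) \<longlongrightarrow> - 1 / of_real s) (at \<zeta> within S)"
    using \<zeta>(2) by simp
  show "((\<lambda>z. f z / (z - \<zeta>)) \<longlongrightarrow> - 1 / of_real s) (at \<zeta> within {z \<in> \<Delta>. dist z \<zeta> < M * (1 - norm z)})"
    unfolding S_def[symmetric]
  proof (rule Lim_transform_eventually[OF lim])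
    have "- ((1 - z) / (1 - \<zeta>)) / q z = f z / (z - \<zeta>)" if "z \<in> S" for z
    proof -
      have zD: "z \<in> \<Delta>" using that by (auto simp: S_def)
      have ne: "z \<noteq> 1" "1 - z \<noteq> 0" "1 - \<zeta> \<noteq> 0" "z - \<zeta> \<noteq> 0" using zD \<zeta> by auto
      define p where "p = half_plane_field f (cayley z)"
      have p: "p \<noteq> 0" using field_nz[OF Re_cayley[OF zD]] by (simp add: p_def)
      have q: "q z = 2 * (z - \<zeta>) / ((1 - z) * (1 - \<zeta>)) / p"
        unfolding q_def cayley_diff[OF ne(1) \<zeta>(2)] p_def by simp
      have f: "f z = - p * (1 - z)\<^sup>2 / 2" using half_plane_field_cayley[OF zD] by (simp add: p_def)
      show ?thesis unfolding q f using ne(2-4) p by (simp add: power2_eq_square)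
    qed
    then show "\<forall>\<^sub>F z in at \<zeta> within S. - ((1 - z) / (1 - \<zeta>)) / q z = f z / (z - \<zeta>)"
      unfolding eventually_at by (intro exI[of _ 1]) auto
  qed
qed

text \<open>The middle line of the strip, seen through \<open>g\<close>, is a complete trajectory.
  Backwards it tends either to infinity, that is to the null point 1, or to a point of the axis with
  a positive angular limit by \<open>angular_pole_of_strip\<close>.\<close>

lemma regular_trajectory_of_strip:
  assumes c12: "c1 < c2" and strip: "{w. c1 < Im w \<and> Im w < c2} \<subseteq> D"
  shows "\<exists>z\<in>\<Delta>. \<exists>u \<zeta>. full_trajectory f z u \<and> (u \<longlongrightarrow> \<zeta>) at_bot \<and> boundary_regular_null_point f \<zeta>"
proof -
  define c where "c = (c1 + c2) / 2"
  have c: "c1 < c" "c < c2" using c12 by (auto simp: c_def)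
  have ray: "Complex t c \<in> D" for t using strip c by auto
  define u where "u t = g (Complex t c)" for t
  have u: "u t \<in> \<Delta>" "(u has_vector_derivative - f (u t)) (at t)" for t
    using g_disc[OF ray] has_vector_derivative_horizontal[OF g_deriv[OF ray]] unfolding u_def by auto
  have traj: "full_trajectory f (u 0) u" unfolding full_trajectory_def using u by simp
  have "\<exists>\<zeta>. (u \<longlongrightarrow> \<zeta>) at_bot \<and> boundary_regular_null_point f \<zeta>"
    using backward_orbit_converges[OF ray]
  proof
    assume "filterlim (\<lambda>t. norm (G (Complex t c))) at_top at_bot"
    then have "filterlim (\<lambda>t. G (Complex t c)) at_infinity at_bot"
      by (rule filterlim_norm_at_top_imp_at_infinity)
    then have "filterlim (\<lambda>t. 1 + G (Complex t c)) at_infinity at_bot"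
      by (intro tendsto_add_filterlim_at_infinity[OF tendsto_const])
    from tendsto_divide_0[OF tendsto_const this, of 2]
    have "((\<lambda>t. 1 - 2 / (1 + G (Complex t c))) \<longlongrightarrow> 1 - 0) at_bot" by (intro tendsto_intros)
    moreover have "1 - 2 / (1 + G (Complex t c)) = u t" for t
      using rhp_ne_minus_1[OF Re_G_pos[OF ray[of t]]] by (simp add: u_def g_def icayley_def field_simps)
    ultimately have "(u \<longlongrightarrow> 1) at_bot" by simp
    then show ?thesis using regular_null_point_1 by blast
  next
    assume "\<exists>\<eta>. ((\<lambda>t. G (Complex t c)) \<longlongrightarrow> Complex 0 \<eta>) at_bot"
    then obtain \<eta> where \<eta>: "((\<lambda>t. G (Complex t c)) \<longlongrightarrow> Complex 0 \<eta>) at_bot" by blast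
    have "(u \<longlongrightarrow> icayley (Complex 0 \<eta>)) at_bot"
      unfolding u_def g_def by (rule icayley_tendsto[OF \<eta>]) (simp add: complex_eq_iff)
    moreover obtain s where s: "s > 0"
      "\<And>M e. M > 0 \<Longrightarrow> e > 0 \<Longrightarrow> \<exists>d>0. \<forall>w. Re w > 0 \<longrightarrow> norm w \<le> M * Re w \<longrightarrow> norm w \<le> d \<longrightarrow>
       norm (w * (1 / half_plane_field f (w + Complex 0 \<eta>)) - of_real s) < e"
      using angular_pole_of_strip[OF strip c \<eta>] by metis
    ultimately show ?thesis
      using regular_null_point_of_angular_pole[OF icayley_imaginary_axis s] by blast
  qed
  then show ?thesis using u(1) traj by blast
qed

text \<open>Only a limit of \<open>f\<close> at \<open>\<zeta>\<close> is given, so the bound on the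
  derivative is integrated along the radius up to some \<open>r' < 1\<close> where
  \<open>norm (f z) < e\<close>, and \<open>e\<close> is removed at the end.\<close>

lemma radial_growth:
  assumes \<zeta>: "norm \<zeta> = 1" and f0: "angular_limit f \<zeta> 0" and f': "angular_limit (deriv f) \<zeta> L"
  obtains d where "0 < d" "d < 1"
    "\<And>r. 1 - d < r \<Longrightarrow> r < 1 \<Longrightarrow> norm (f (of_real r * \<zeta>)) \<le> (norm L + 1) * (1 - r)"
proof -
  define S where "S = {z \<in> \<Delta>. dist z \<zeta> < 2 * (1 - norm z)}"
  have dist: "dist (of_real r * \<zeta>) \<zeta> = 1 - r" "norm (of_real r * \<zeta>) = r" if "0 < r" "r < 1" for r
  proof -
    have "of_real r * \<zeta> - \<zeta> = of_real (r - 1) * \<zeta>" by (simp add: algebra_simps)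
    then show "dist (of_real r * \<zeta>) \<zeta> = 1 - r" using \<zeta> that by (simp add: dist_norm norm_mult del: of_real_diff)
  qed (use \<zeta> that in \<open>simp add: norm_mult\<close>)
  have inS: "of_real r * \<zeta> \<in> S" if "0 < r" "r < 1" for r using dist[OF that] that by (simp add: S_def)
  have "(deriv f \<longlongrightarrow> L) (at \<zeta> within S)" unfolding S_def by (rule f'[unfolded angular_limit_def, rule_format]) simp
  from tendstoD[OF this zero_less_one] obtain d0 where d0: "d0 > 0"
    "\<And>z. z \<in> S \<Longrightarrow> z \<noteq> \<zeta> \<Longrightarrow> dist z \<zeta> < d0 \<Longrightarrow> dist (deriv f z) L < 1"
    unfolding eventually_at by blast
  have f0': "(f \<longlongrightarrow> 0) (at \<zeta> within S)" unfolding S_def by (rule f0[unfolded angular_limit_def, rule_format]) simp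
  define d where "d = min d0 (1 / 2)"
  have d: "0 < d" "d < 1" "d \<le> d0" using d0(1) by (auto simp: d_def)
  have "norm (f (of_real r * \<zeta>)) \<le> (norm L + 1) * (1 - r)" if r: "1 - d < r" "r < 1" for r
  proof (rule field_le_epsilon)
    fix e :: real assume e: "e > 0"
    from tendstoD[OF f0' e] obtain d1 where d1: "d1 > 0"
      "\<And>z. z \<in> S \<Longrightarrow> z \<noteq> \<zeta> \<Longrightarrow> dist z \<zeta> < d1 \<Longrightarrow> norm (f z) < e"
      unfolding eventually_at by auto
    define r' where "r' = max r (1 - d1 / 2)"
    have r': "r \<le> r'" "r' < 1" "1 - r' < d1" using r d1 by (auto simp: r'_def)
    have r0: "r > 0" using r d by simp
    have "of_real r' * \<zeta> \<noteq> \<zeta>" using dist[of r'] r' r0 by (metis diff_gt_0_iff_gt dist_self less_irrefl less_le_trans)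
    then have fr': "norm (f (of_real r' * \<zeta>)) < e"
      using d1(2)[OF inS[of r']] dist[of r'] r' r0 by auto
    define T where "T = (\<lambda>\<rho>. of_real \<rho> * \<zeta>) ` {r..r'}"
    have "linear (\<lambda>\<rho>. of_real \<rho> * \<zeta>)" by (auto simp: linear_iff algebra_simps scaleR_conv_of_real)
    then have "convex T" unfolding T_def by (intro convex_linear_image) auto
    then have "norm (f (of_real r * \<zeta>) - f (of_real r' * \<zeta>)) \<le> (norm L + 1) * norm (of_real r * \<zeta> - of_real r' * \<zeta>)"
    proof (rule field_differentiable_bound[where f' = "deriv f"])
      fix z assume "z \<in> T"
      then obtain \<rho> where "\<rho> \<in> {r..r'}" and \<rho>z: "z = of_real \<rho> * \<zeta>" unfolding T_def by (elim imageE)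
      then have \<rho>: "z = of_real \<rho> * \<zeta>" "r \<le> \<rho>" "\<rho> \<le> r'" by auto
      have \<rho>1: "0 < \<rho>" "\<rho> < 1" using \<rho> r0 r' by auto
      have "z \<in> S" using inS[OF \<rho>1] \<rho>(1) by simp
      then show "(f has_field_derivative deriv f z) (at z within T)"
        using has_field_derivative_at_within[OF holomorphic_derivI[OF f_hol open_ball, of z]] by (simp add: S_def)
      have "dist z \<zeta> = 1 - \<rho>" using dist(1)[OF \<rho>1] \<rho>(1) by simp
      then have "z \<noteq> \<zeta>" "dist z \<zeta> < d0" using \<rho>1 \<rho> r d by auto
      then have "norm (deriv f z - L) < 1" using d0(2)[OF \<open>z \<in> S\<close>] by (simp add: dist_norm)
      then show "norm (deriv f z) \<le> norm L + 1" using norm_triangle_ineq2[of "deriv f z" L] by linarith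
    qed (use r' in \<open>auto simp: T_def\<close>)
    also have "of_real r * \<zeta> - of_real r' * \<zeta> = of_real (r - r') * \<zeta>" by (simp add: algebra_simps)
    also have "norm (of_real (r - r') * \<zeta>) = r' - r" using r' \<zeta> by (simp add: norm_mult del: of_real_diff)
    also have "(norm L + 1) * (r' - r) \<le> (norm L + 1) * (1 - r)" using r' by (intro mult_left_mono) auto
    finally show "norm (f (of_real r * \<zeta>)) \<le> (norm L + 1) * (1 - r) + e"
      using fr' norm_triangle_ineq2[of "f (of_real r * \<zeta>)" "f (of_real r' * \<zeta>)"] by linarith
  qed
  then show thesis using that d by blast
qed

text \<open>If \<open>s\<close> vanished, the field would be large compared with the distance to
  \<open>cayley \<zeta>\<close>, and so \<open>f\<close> large compared with \<open>1 - r\<close> on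
  the radius, against \<open>radial_growth\<close>.\<close>

lemma strip_of_regular_null_point:
  assumes reg: "boundary_regular_null_point f \<zeta>" and \<zeta>1: "\<zeta> \<noteq> 1"
  shows "\<exists>c1 c2. c1 < c2 \<and> {w. c1 < Im w \<and> Im w < c2} \<subseteq> D"
proof -
  obtain L where \<zeta>: "norm \<zeta> = 1" and L: "angular_limit f \<zeta> 0" "angular_limit (deriv f) \<zeta> L"
    using reg unfolding boundary_regular_null_point_def by auto
  define \<eta> where "\<eta> = Im (cayley \<zeta>)"
  have c\<zeta>: "cayley \<zeta> = Complex 0 \<eta>" unfolding \<eta>_def by (rule cayley_circle[OF \<zeta> \<zeta>1])
  interpret sh: half_plane_koenigs "\<lambda>w. h (icayley (w + Complex 0 \<eta>))" "\<lambda>w. 1 / half_plane_field f (w + Complex 0 \<eta>)"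
    using half_plane_koenigs_shift(1)[OF half_plane_koenigs_axioms] .
  obtain s where s: "s \<ge> 0"
    "\<And>M e. M > 0 \<Longrightarrow> e > 0 \<Longrightarrow> \<exists>d>0. \<forall>w. Re w > 0 \<longrightarrow> norm w \<le> M * Re w \<longrightarrow> norm w \<le> d \<longrightarrow>
       norm (w * (1 / half_plane_field f (w + Complex 0 \<eta>)) - of_real s) < e"
    using julia_caratheodory_zero[OF sh.Q_hol sh.Q_nonneg] by blast
  define C where "C = norm L + 1"
  have C: "C > 0" by (simp add: C_def add_nonneg_pos)
  have n\<zeta>: "norm (1 - \<zeta>) > 0" using \<zeta>1 by simp
  have "s \<noteq> 0"
  proof
    assume s0: "s = 0"
    obtain d where d: "0 < d" "d < 1"
      "\<And>r. 1 - d < r \<Longrightarrow> r < 1 \<Longrightarrow> norm (f (of_real r * \<zeta>)) \<le> C * (1 - r)"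
      using radial_growth[OF \<zeta> L] unfolding C_def by metis
    \<comment> \<open>The radius lies in the Stolz region of aperture 2, which
      \<open>stolz_cayley\<close> sends into the sector with this constant.\<close>
    define M where "M = 4 * 2 / norm (1 - \<zeta>)"
    have M: "M > 0" using n\<zeta> by (simp add: M_def)
    obtain \<delta> where \<delta>: "\<delta> > 0" "\<And>w. Re w > 0 \<Longrightarrow> norm w \<le> M * Re w \<Longrightarrow> norm w \<le> \<delta> \<Longrightarrow>
       norm (w * (1 / half_plane_field f (w + Complex 0 \<eta>)) - of_real s) < 1 / (2 * C)"
      using s(2)[OF M, of "1 / (2 * C)"] C by auto
    have lim: "((\<lambda>r. of_real r * \<zeta>) \<longlongrightarrow> of_real 1 * \<zeta>) (at_left (1::real))" by (intro tendsto_intros)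
    then have lim': "((\<lambda>r. of_real r * \<zeta>) \<longlongrightarrow> \<zeta>) (at_left (1::real))" by simp
    have "\<forall>\<^sub>F r in at_left 1. dist (cayley (of_real r * \<zeta>)) (cayley \<zeta>) < \<delta>"
      by (rule tendstoD[OF cayley_tendsto[OF lim' \<zeta>1] \<delta>(1)])
    moreover have "\<forall>\<^sub>F r in at_left 1. norm (1 - of_real r * \<zeta>) > 3 / 4 * norm (1 - \<zeta>)"
      by (rule order_tendstoD(1)[OF tendsto_norm[OF tendsto_diff[OF tendsto_const lim']]]) (use n\<zeta> in simp)
    moreover have "\<forall>\<^sub>F r in at_left 1. r \<in> {1 - d<..<1}"
      by (rule eventually_at_left_real) (use d in simp)
    ultimately have "\<forall>\<^sub>F r in at_left 1. dist (cayley (of_real r * \<zeta>)) (cayley \<zeta>) < \<delta> \<and>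
        norm (1 - of_real r * \<zeta>) > 3 / 4 * norm (1 - \<zeta>) \<and> r \<in> {1 - d<..<1}"
      by (intro eventually_conj)
    then obtain r where r: "dist (cayley (of_real r * \<zeta>)) (cayley \<zeta>) < \<delta>"
      "norm (1 - of_real r * \<zeta>) > 3 / 4 * norm (1 - \<zeta>)" "1 - d < r" "r < 1"
      using eventually_happens'[OF trivial_limit_at_left_real] by (metis (no_types, lifting) greaterThanLessThan_iff)
    have r0: "r > 0" using r d by simp
    define z where "z = of_real r * \<zeta>"
    have nz: "norm z = r" using \<zeta> r0 by (simp add: z_def norm_mult)
    have zD: "z \<in> \<Delta>" using nz r by simp
    have "z - \<zeta> = of_real (r - 1) * \<zeta>" by (simp add: z_def algebra_simps)
    then have dz: "norm (z - \<zeta>) = 1 - r" using \<zeta> r by (simp add: norm_mult del: of_real_diff)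
    define w where "w = cayley z - cayley \<zeta>"
    have Rw: "Re w = Re (cayley z)" by (simp add: w_def c\<zeta>)
    have "norm w \<le> M * Re w" unfolding Rw unfolding w_def M_def
      by (rule stolz_cayley[OF zD _ \<zeta>1]) (use dz nz r in \<open>simp add: dist_norm\<close>)
    moreover have "norm w \<le> \<delta>" using r(1) by (simp add: w_def z_def dist_norm)
    moreover have "w + Complex 0 \<eta> = cayley z" by (simp add: w_def c\<zeta>)
    ultimately have small: "norm (w * (1 / half_plane_field f (cayley z))) < 1 / (2 * C)"
      using \<delta>(2)[of w] Re_cayley[OF zD] Rw s0 by simp
    define p where "p = norm (half_plane_field f (cayley z))"
    have p: "p > 0" using field_nz[OF Re_cayley[OF zD]] by (simp add: p_def)
    define m where "m = norm (1 - z)"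
    have m: "m > 3 / 4 * norm (1 - \<zeta>)" "m > 0" using r(2) disc_ne_1[OF zD] by (auto simp: m_def z_def)
    have "norm (f z) = p * m\<^sup>2 / 2"
      using half_plane_field_cayley[OF zD, of f] by (simp add: p_def m_def norm_mult norm_divide norm_power)
    then have up: "p * m\<^sup>2 \<le> 2 * C * (1 - r)" using d(3)[OF r(3,4)] by (simp add: z_def)
    have "norm w = 2 * (1 - r) / (m * norm (1 - \<zeta>))"
      unfolding w_def cayley_diff[OF disc_ne_1[OF zD] \<zeta>1] norm_divide norm_mult dz m_def by simp
    moreover have "norm w / p < 1 / (2 * C)" using small by (simp add: norm_mult norm_divide p_def)
    ultimately have "2 * (1 - r) / (m * norm (1 - \<zeta>)) < 1 / (2 * C) * p" using p by (simp only: pos_divide_less_eq)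
    then have "2 * (1 - r) < 1 / (2 * C) * p * (m * norm (1 - \<zeta>))"
      using m(2) n\<zeta> by (simp only: pos_divide_less_eq mult_pos_pos)
    then have "2 * (1 - r) * (2 * C) < 1 / (2 * C) * p * (m * norm (1 - \<zeta>)) * (2 * C)"
      using C by (intro mult_strict_right_mono) auto
    also have "\<dots> = p * (m * norm (1 - \<zeta>))" using C by simp
    finally have "2 * (1 - r) * (2 * C) < p * (m * norm (1 - \<zeta>))" .
    also have "\<dots> < p * (m * (4 / 3 * m))"
      using p m by (intro mult_strict_left_mono) auto
    also have "\<dots> = 4 / 3 * (p * m\<^sup>2)" by (simp add: power2_eq_square)
    also have "\<dots> \<le> 4 / 3 * (2 * C * (1 - r))" using up by simp
    \<comment> \<open>The 4 comes from the choice \<open>1 / (2 * C)\<close> above. Replacing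
      \<open>norm (1 - \<zeta>)\<close> by \<open>m\<close> near \<open>\<zeta>\<close> costs only
      4/3, which is not enough to restore the balance.\<close>
    finally have "4 * (C * (1 - r)) < 8 / 3 * (C * (1 - r))" by (simp add: algebra_simps)
    moreover have "C * (1 - r) > 0" using C r by simp
    ultimately show False by simp
  qed
  then have spos: "s > 0" using s(1) by simp
  obtain d where d: "d > 0" "\<And>w. Re w > 0 \<Longrightarrow> norm w \<le> 2 * Re w \<Longrightarrow> norm w \<le> d \<Longrightarrow>
       norm (w * (1 / half_plane_field f (w + Complex 0 \<eta>)) - of_real s) < s / 10"
    using s(2)[of 2 "s / 10"] spos by auto
  from sh.strip_of_angular_pole[OF spos d] show ?thesis
    unfolding half_plane_koenigs_shift(2)[OF half_plane_koenigs_axioms] .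
qed

text \<open>The identity solves the equation with \<open>a = 0\<close> and
  \<open>b = - Im c / 2\<close>, so the whole disc is a backward flow invariant domain.\<close>

lemma strip_of_constant_field:
  assumes "Re c = 0" "\<And>w. Re w > 0 \<Longrightarrow> half_plane_field f w = c"
  shows "\<exists>c1 c2. c1 < c2 \<and> {w. c1 < Im w \<and> Im w < c2} \<subseteq> D"
proof -
  have c: "c = \<i> * of_real (Im c)" using assms(1) by (simp add: complex_eq_iff)
  have "f z = - c * (1 - z)\<^sup>2 / 2" if "z \<in> \<Delta>" for z
    using half_plane_field_cayley[OF that, of f] assms(2)[OF Re_cayley[OF that]] by simp
  then have "f z = (of_real 0 * (z\<^sup>2 - 1) + \<i> * of_real (- Im c / 2) * (1 - z)\<^sup>2) * deriv (\<lambda>z. z) z"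
    if "z \<in> \<Delta>" for z
    using that by (subst (asm) c) simp
  moreover have "\<not> (\<lambda>z. z) constant_on \<Delta>"
  proof
    assume "(\<lambda>z. z) constant_on \<Delta>"
    then obtain y where y: "\<And>x. x \<in> \<Delta> \<Longrightarrow> x = y" unfolding constant_on_def by blast
    from y[of 0] y[of "1 / 2"] show False by simp
  qed
  ultimately have "nonconstant_solution f 0 (- Im c / 2) (\<lambda>z. z)"
    unfolding nonconstant_solution_def by auto
  from solution_BFID(2)[OF this, unfolded BFID_def] show ?thesis
    by (elim conjE) (rule strip_of_automorphisms)
qed

lemma strip_of_regular_trajectory:
  assumes traj: "full_trajectory f z u" and lim: "(u \<longlongrightarrow> \<zeta>) at_bot" and reg: "boundary_regular_null_point f \<zeta>"
  shows "\<exists>c1 c2. c1 < c2 \<and> {w. c1 < Im w \<and> Im w < c2} \<subseteq> D"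
proof (cases "\<zeta> = 1")
  case False
  then show ?thesis using strip_of_regular_null_point[OF reg] by blast
next
  case True
  have u: "u 0 = z" "u t \<in> \<Delta>" "(u has_vector_derivative - f (u t)) (at t)" for t
    using traj unfolding full_trajectory_def by auto
  \<comment> \<open>Along any solution of the Cauchy problem \<open>h\<close> moves to the right at
    unit speed, so \<open>u\<close> is the preimage of a full horizontal line, parametrised up to
    the shift \<open>x\<close>.\<close>
  have "((\<lambda>t. h (u t) - of_real t) has_vector_derivative 0) (at t within UNIV)" for t
  proof -
    from field_vector_diff_chain_at[OF u(3) h_deriv[OF u(2)]]
    have "((\<lambda>t. h (u t)) has_vector_derivative 1) (at t)" using f_nz[OF u(2)] by (simp add: o_def)
    from has_vector_derivative_diff[OF this has_vector_derivative_of_real[OF DERIV_ident]]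
    show ?thesis by simp
  qed
  then obtain k where k: "\<And>t. h (u t) - of_real t = k"
    using has_vector_derivative_zero_constant[of UNIV "\<lambda>t. h (u t) - of_real t"] by auto
  define c where "c = Im k"
  define x where "x = Re k"
  have hu: "Complex t c = h (u (t - x))" for t
    using k[of "t - x"] by (auto simp: c_def x_def complex_eq_iff algebra_simps)
  have ray: "Complex t c \<in> D" for t unfolding D_eq hu using u(2) by blast
  have Gu: "G (Complex t c) = cayley (u (t - x))" for t
    using G_H[OF Re_cayley[OF u(2)[of "t - x"]]] icayley_cayley[OF u(2)[of "t - x"]] unfolding hu by simp
  have "filterlim (\<lambda>t. t - x) at_bot at_bot"
    unfolding filterlim_at_bot
  proof
    fix Z show "\<forall>\<^sub>F t in at_bot. t - x \<le> Z"
      using eventually_le_at_bot[of "Z + x"] by eventually_elim simp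
  qed
  from filterlim_compose[OF lim this] have ux: "((\<lambda>t. u (t - x)) \<longlongrightarrow> 1) at_bot" using True by simp
  have "((\<lambda>t. 1 - u (t - x)) \<longlongrightarrow> 1 - 1) at_bot" by (intro tendsto_intros ux)
  then have "filterlim (\<lambda>t. 1 - u (t - x)) (at 0) at_bot"
    using u(2) disc_ne_1 by (intro filterlim_atI) auto
  moreover have "((\<lambda>t. 1 + u (t - x)) \<longlongrightarrow> 1 + 1) at_bot" by (intro tendsto_intros ux)
  ultimately have "filterlim (\<lambda>t. (1 + u (t - x)) * inverse (1 - u (t - x))) at_infinity at_bot"
    by (intro tendsto_mult_filterlim_at_infinity[of _ "1 + 1"] filterlim_compose[OF filterlim_inverse_at_infinity]) auto
  then have inf: "filterlim (\<lambda>t. norm (G (Complex t c))) at_top at_bot"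
    unfolding Gu cayley_def divide_inverse by (rule filterlim_at_infinity_imp_norm_at_top)
  show ?thesis
    using dichotomy
  proof
    assume pos: "\<forall>w. Re w > 0 \<longrightarrow> Re (half_plane_field f w) > 0"
    show ?thesis
    proof (rule strip_of_orbit_to_infinity[OF _ ray inf])
      fix w :: complex assume "Re w > 0"
      then show "Re (1 / half_plane_field f w) > 0"
        using pos by (auto simp: Re_divide sum_power2_gt_zero_iff intro!: divide_pos_pos)
    qed
  qed (use strip_of_constant_field in blast)
qed

end

theorem theorem34:
  fixes f :: "complex \<Rightarrow> complex" and F :: "real \<Rightarrow> complex \<Rightarrow> complex"
  assumes "f \<in> G1"
    and "continuous_semigroup F" and "is_generator f F"
  defines "cond_i \<equiv> \<exists>z\<in>\<Delta>. \<exists>u \<zeta>. full_trajectory f z u \<and> (u \<longlongrightarrow> \<zeta>) at_bot \<and>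
                       boundary_regular_null_point f \<zeta>"
    and "cond_ii \<equiv> koenigs f \<in> Sigma1 \<and>
                   (\<exists>A. (horizontal_strip A \<or> horizontal_half_plane A) \<and> A \<subseteq> koenigs f ` \<Delta>)"
    and "cond_iii \<equiv> \<exists>\<Omega>. \<Omega> \<noteq> {} \<and> open \<Omega> \<and> simply_connected \<Omega> \<and> \<Omega> \<subseteq> \<Delta> \<and>
                        (\<forall>t\<ge>0. automorphism_of \<Omega> (F t))"
    and "cond_iv \<equiv> \<exists>a b \<phi>. nonconstant_solution f a b \<phi>"
  shows "(cond_i \<longleftrightarrow> cond_ii) \<and> (cond_ii \<longleftrightarrow> cond_iii) \<and> (cond_iii \<longleftrightarrow> cond_iv) \<and>
         (\<forall>a b \<phi>. nonconstant_solution f a b \<phi> \<longrightarrow> inj_on \<phi> \<Delta> \<and> BFID F (\<phi> ` \<Delta>))"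
proof -
  \<comment> \<open>Membership in \<open>G1\<close> yields some semigroup \<open>F'\<close>
    generated by \<open>f\<close> and tending to 1, a priori different from \<open>F\<close>. The
    properties of \<open>f\<close> come from \<open>F'\<close>; Abel's equation then transfers them
    to \<open>F\<close>.\<close>
  obtain F' where F': "continuous_semigroup F'" "is_generator f F'" "\<And>z. z \<in> \<Delta> \<Longrightarrow> ((\<lambda>t. F' t z) \<longlongrightarrow> 1) at_top"
    using assms(1) unfolding G1_def by blast
  interpret F': generated_semigroup F' f by unfold_locales (use F' in auto)
  note f_props = F'.generator_dichotomy[OF F'(3)]
  interpret koenigs_semigroup F f by unfold_locales (use assms(2,3) f_props in auto)
  interpret F': koenigs_semigroup F' f by unfold_locales (use f_props in auto)
  define strip where "strip \<longleftrightarrow> (\<exists>c1 c2. c1 < c2 \<and> {w. c1 < Im w \<and> Im w < c2} \<subseteq> D)"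
  have "cond_ii \<longleftrightarrow> strip"
  proof
    assume cond_ii
    then obtain A where A: "horizontal_strip A \<or> horizontal_half_plane A" "A \<subseteq> h ` \<Delta>"
      unfolding cond_ii_def by (elim conjE exE)
    obtain c1 c2 where c: "c1 < c2" "{w. c1 < Im w \<and> Im w < c2} \<subseteq> A" by (rule contains_strip[OF A(1)])
    have "{w. c1 < Im w \<and> Im w < c2} \<subseteq> D" unfolding D_eq by (rule subset_trans[OF c(2) A(2)])
    then show strip unfolding strip_def using c(1) by (intro exI conjI)
  next
    assume strip
    then obtain c1 c2 where c: "c1 < c2" "{w. c1 < Im w \<and> Im w < c2} \<subseteq> h ` \<Delta>"
      unfolding strip_def D_eq by (elim conjE exE)
    then have "horizontal_strip {w. c1 < Im w \<and> Im w < c2}" unfolding horizontal_strip_def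
      by (intro exI[of _ c1] exI[of _ c2] conjI refl)
    then show cond_ii
      unfolding cond_ii_def using c(2) F'.koenigs_Sigma1[OF F'(3)] by (intro conjI exI disjI1)
  qed
  moreover have "cond_i \<Longrightarrow> strip"
    unfolding cond_i_def strip_def by (elim bexE exE conjE) (rule strip_of_regular_trajectory)
  moreover have "strip \<Longrightarrow> cond_i"
    unfolding cond_i_def strip_def by (elim exE conjE) (rule regular_trajectory_of_strip)
  moreover have "cond_iv \<Longrightarrow> cond_iii"
    unfolding cond_iv_def cond_iii_def BFID_def[symmetric] by (elim exE) (intro exI, rule solution_BFID(2))
  moreover have "cond_iii \<Longrightarrow> strip"
    unfolding cond_iii_def strip_def by (elim exE conjE) (rule strip_of_automorphisms)
  moreover have "strip \<Longrightarrow> cond_iv"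
    unfolding cond_iv_def strip_def by (elim exE conjE) (rule solution_of_strip)
  moreover have "\<forall>a b \<phi>. nonconstant_solution f a b \<phi> \<longrightarrow> inj_on \<phi> \<Delta> \<and> BFID F (\<phi> ` \<Delta>)"
    using solution_BFID by (intro allI impI conjI)
  ultimately show ?thesis by argo
qed

end
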